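(* Let $K$ be a complete discretely valued field of characteristic $0$ with valuation ring $\mathcal V$ and perfect residue field $k$ of characteristic $p$. Let $\hat P=\mathrm{Spf}(A)$ be a smooth connected affine $p$-adic formal scheme over $\mathcal V$ with smooth special fiber $\hat P_k=\mathrm{Spec}(A_k)$, and let $X\hookrightarrow\hat P_k$ be a regular closed immersion of an affine $k$-variety whose ideal is generated by a regular sequence. The tempered tube $]X[_{\hat P,\mathrm{temp}}$ is independent of the choice of regular sequence defining $X$ in $\hat P_k$ and of the chosen liftings. That is, if $f_1,\dots,f_s$ and $g_1,\dots,g_l$ are two regular sequences in $A_k$ generating the ideal of $X$, with liftings $\tilde f_i,\tilde g_j\in A$, then there is a canonical isomorphism of $A_K$-algebras $$\frac{A_K[\![y_1,\dots,y_s]\!]_{\mathrm{temp}}}{(y_1-\tilde f_1,\dots,y_s-\tilde f_s)}\cong\frac{A_K[\![z_1,\dots,z_l]\!]_{\mathrm{temp}}}{(z_1-\tilde g_1,\dots,z_l-\tilde g_l)}.$$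
   Context: $A_K=A\otimes_{\mathcal V}K$ is the affinoid $K$-algebra of the generic fiber, a Banach ring with the supremum norm $|\cdot|$. $A_K[\![y_1,\dots,y_s]\!]_{\mathrm{temp}}$ is the filtered monomorphic colimit over $n\in\mathbf N$ (in complete bornological spaces, equivalently in $\mathsf{Ind}(\mathsf{Ban}_K)$) of the Banach modules of power series $\sum_Ja_Jy^J$ ($J\in\mathbf N^s$, $a_J\in A_K$) with $\lim_{|J|\to\infty}|a_J|\prod_i(j_i+1)^{-n}=0$, normed by $\sup_J|a_J|\prod_i(j_i+1)^{-n}$. Given a regular sequence $f_1,\dots,f_s\in A_k$ generating the ideal of $X$ and liftings $\tilde f_i\in A$, the tempered tube $]X[_{\hat P,\mathrm{temp}}$ is the affine derived analytic space associated with the quotient $A_K[\![y_1,\dots,y_s]\!]_{\mathrm{temp}}/(y_1-\tilde f_1,\dots,y_s-\tilde f_s)$, computed in complete bornological algebras. Isomorphisms are isomorphisms of bornological algebras. *)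

theory Defs
  imports
    "HOL-Analysis.Abstract_Metric_Spaces"
    "HOL-Algebra.Algebraic_Closure_Type"
    "HOL-Algebra.Ideal_Product"
    "HOL-Algebra.Indexed_Polynomials"
    "HOL-Computational_Algebra.Primes"
begin

text \<open>
  The field \<open>K\<close> is a type \<open>'k\<close> with an absolute value \<open>v\<close>, the affinoid algebra \<open>A\<^sub>K\<close> is a type \<open>'b\<close>
  with structure map \<open>\<kappa> :: 'k \<Rightarrow> 'b\<close>.  Rings that depend on further data (valuation ring, \<open>A\<close>,
  residue rings, power series rings, tubes) are \<open>HOL-Algebra\<close> rings.

  A multi-index \<open>J \<in> \<nat>\<^sup>s\<close> is a multiset over \<open>{..<s}\<close> with \<open>j\<^sub>i = count J i\<close>; thus \<open>\<bar>J\<bar> = size J\<close>, and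
  addition of multi-indices is addition of multisets.  This is the encoding of monomials used in
  \<open>HOL-Algebra.Indexed_Polynomials\<close>.
\<close>


section \<open>Complete discretely valued fields\<close>

definition complete_discretely_valued :: "('k::field \<Rightarrow> real) \<Rightarrow> bool" where
  "complete_discretely_valued v \<longleftrightarrow>
     (\<forall>x. 0 \<le> v x) \<and> (\<forall>x. v x = 0 \<longleftrightarrow> x = 0) \<and>
     (\<forall>x y. v (x * y) = v x * v y) \<and> (\<forall>x y. v (x + y) \<le> max (v x) (v y)) \<and>
     (\<exists>w. 0 < v w \<and> v w < 1 \<and> (\<forall>x. x \<noteq> 0 \<longrightarrow> (\<exists>n::int. v x = v w powi n))) \<and>
     Metric_space.mcomplete UNIV (\<lambda>x y. v (x - y))"

definition valuation_ring :: "('k::field \<Rightarrow> real) \<Rightarrow> 'k ring" where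
  "valuation_ring v = ring_of_type_algebra\<lparr>carrier := {x. v x \<le> 1}\<rparr>"

definition valuation_ideal :: "('k::field \<Rightarrow> real) \<Rightarrow> 'k set" where
  "valuation_ideal v = {x. v x < 1}"

definition residue_ring_of :: "('k::field \<Rightarrow> real) \<Rightarrow> 'k set ring" where
  "residue_ring_of v = valuation_ring v Quot valuation_ideal v"

definition perfect_of_char :: "('a, 'm) ring_scheme \<Rightarrow> nat \<Rightarrow> bool" where
  "perfect_of_char k p \<longleftrightarrow>
     field k \<and> prime p \<and> add_pow k p \<one>\<^bsub>k\<^esub> = \<zero>\<^bsub>k\<^esub> \<and>
     (\<forall>x\<in>carrier k. \<exists>y\<in>carrier k. y [^]\<^bsub>k\<^esub> p = x)"


section \<open>Polynomials and power series in several variables\<close>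

definition multi_indices :: "nat \<Rightarrow> nat multiset set" where
  "multi_indices s = {J. set_mset J \<subseteq> {..<s}}"

definition mv_mult ::
  "('a, 'm) ring_scheme \<Rightarrow> (nat multiset \<Rightarrow> 'a) \<Rightarrow> (nat multiset \<Rightarrow> 'a) \<Rightarrow> nat multiset \<Rightarrow> 'a" where
  "mv_mult R f g =
     (\<lambda>M. finsum R (\<lambda>(I, J). f I \<otimes>\<^bsub>R\<^esub> g J) {(I, J). I + J = M})"

definition mv_ring ::
  "('a, 'm) ring_scheme \<Rightarrow> (nat multiset \<Rightarrow> 'a) set \<Rightarrow> (nat multiset \<Rightarrow> 'a) ring" where
  "mv_ring R F =
     \<lparr>carrier = F, monoid.mult = mv_mult R, one = ring.indexed_const R \<one>\<^bsub>R\<^esub>,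
      zero = ring.indexed_const R \<zero>\<^bsub>R\<^esub>, add = ring.indexed_padd R\<rparr>"

definition mv_poly_ring :: "('a, 'm) ring_scheme \<Rightarrow> nat \<Rightarrow> (nat multiset \<Rightarrow> 'a) ring" where
  "mv_poly_ring R m =
     mv_ring R {f. ring.carrier_coeff R f \<and> finite {J. f J \<noteq> \<zero>\<^bsub>R\<^esub>} \<and>
                   (\<forall>J. J \<notin> multi_indices m \<longrightarrow> f J = \<zero>\<^bsub>R\<^esub>)}"

definition mv_eval ::
  "('a, 'm) ring_scheme \<Rightarrow> ('c, 'n) ring_scheme \<Rightarrow> ('a \<Rightarrow> 'c) \<Rightarrow> (nat \<Rightarrow> 'c)
    \<Rightarrow> (nat multiset \<Rightarrow> 'a) \<Rightarrow> 'c" where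
  "mv_eval R S h t f =
     finsum S (\<lambda>J. h (f J) \<otimes>\<^bsub>S\<^esub> finprod S (\<lambda>i. t i [^]\<^bsub>S\<^esub> count J i) (set_mset J))
       {J. f J \<noteq> \<zero>\<^bsub>R\<^esub>}"

definition mv_deriv ::
  "('a, 'm) ring_scheme \<Rightarrow> nat \<Rightarrow> (nat multiset \<Rightarrow> 'a) \<Rightarrow> nat multiset \<Rightarrow> 'a" where
  "mv_deriv R j f = (\<lambda>J. add_pow R (count J j + 1) (f (J + {#j#})))"


section \<open>Smooth algebras and smooth affine formal schemes\<close>

text \<open>
  A ring map \<open>h : R \<rightarrow> S\<close> is smooth if it is of finite presentation and its naive cotangent complex
  is a finite projective module in degree \<open>0\<close>.  For a finite presentation \<open>S = P/J\<close>, with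
  \<open>P = R[x\<^sub>0,\<dots>,x\<^sub>m\<^sub>-\<^sub>1]\<close>, the condition is that the conormal map
  \<open>J/J\<^sup>2 \<rightarrow> \<Omega>\<^bsub>P/R\<^esub> \<otimes> S = \<Oplus> S dx\<^sub>j\<close> has an \<open>S\<close>-linear left inverse; below, \<open>g j \<in> J\<close>
  represents the image of \<open>dx\<^sub>j\<close> under it.  The condition does not depend on the presentation.
\<close>

definition smooth_ring_hom ::
  "('a, 'm) ring_scheme \<Rightarrow> ('c, 'n) ring_scheme \<Rightarrow> ('a \<Rightarrow> 'c) \<Rightarrow> bool" where
  "smooth_ring_hom R S h \<longleftrightarrow>
     cring R \<and> cring S \<and> h \<in> ring_hom R S \<and>
     (\<exists>m. \<exists>t \<in> {..<m} \<rightarrow> carrier S.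
        let P = mv_poly_ring R m; ev = mv_eval R S h t; J = a_kernel P S ev in
          ev ` carrier P = carrier S \<and>
          (\<exists>E. finite E \<and> E \<subseteq> J \<and> J = Idl\<^bsub>P\<^esub> E) \<and>
          (\<exists>g \<in> {..<m} \<rightarrow> J. \<forall>f\<in>J.
             f \<ominus>\<^bsub>P\<^esub> finsum P (\<lambda>j. mv_deriv R j f \<otimes>\<^bsub>P\<^esub> g j) {..<m} \<in> ideal_prod P J J))"

definition subring_of :: "'b::comm_ring_1 set \<Rightarrow> 'b ring" where
  "subring_of A = ring_of_type_algebra\<lparr>carrier := A\<rparr>"

text \<open>The map \<open>R/\<aa> \<rightarrow> S/J\<close> induced by \<open>\<kappa> : R \<rightarrow> S\<close>, on cosets.\<close>

definition residue_map :: "('a \<Rightarrow> 'c) \<Rightarrow> ('c, 'n) ring_scheme \<Rightarrow> 'c set \<Rightarrow> 'a set \<Rightarrow> 'c set" where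
  "residue_map \<kappa> S J = (\<lambda>C. \<Union>c\<in>C. J +>\<^bsub>S\<^esub> \<kappa> c)"

text \<open>
  \<open>Spf A\<close> is a smooth \<open>p\<close>-adic formal scheme over the valuation ring \<open>V\<close>: the map
  \<open>A \<rightarrow> lim A/p\<^sup>nA\<close> is bijective and every \<open>A/p\<^sup>nA\<close> is smooth over \<open>V/p\<^sup>nV\<close>.  Such an \<open>A\<close> is
  topologically of finite presentation and flat over \<open>V\<close>, so \<open>A \<rightarrow> A \<otimes>\<^sub>V K\<close> is injective; \<open>A\<close> is
  accordingly taken to be a subring of \<open>A\<^sub>K\<close>.
\<close>

definition smooth_formal_algebra ::
  "('k::field \<Rightarrow> real) \<Rightarrow> nat \<Rightarrow> ('k \<Rightarrow> 'b::comm_ring_1) \<Rightarrow> 'b set \<Rightarrow> bool" where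
  "smooth_formal_algebra v p \<kappa> A \<longleftrightarrow>
     subring A ring_of_type_algebra \<and> \<kappa> ` carrier (valuation_ring v) \<subseteq> A \<and>
     (\<forall>a. (\<forall>n. a n \<in> A \<and> a (Suc n) - a n \<in> PIdl\<^bsub>subring_of A\<^esub> (of_nat p ^ n)) \<longrightarrow>
        (\<exists>!l. l \<in> A \<and> (\<forall>n. a n - l \<in> PIdl\<^bsub>subring_of A\<^esub> (of_nat p ^ n)))) \<and>
     (\<forall>n\<ge>1. smooth_ring_hom
        (valuation_ring v Quot PIdl\<^bsub>valuation_ring v\<^esub> (of_nat p ^ n))
        (subring_of A Quot PIdl\<^bsub>subring_of A\<^esub> (of_nat p ^ n))
        (residue_map \<kappa> (subring_of A) (PIdl\<^bsub>subring_of A\<^esub> (of_nat p ^ n))))"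

text \<open>
  \<open>A\<^sub>K = A \<otimes>\<^sub>V K\<close>.  As \<open>K\<close> is a localisation of \<open>V\<close>, the map \<open>A \<otimes>\<^sub>V K \<rightarrow> A\<^sub>K\<close> is injective for every
  \<open>V\<close>-subalgebra \<open>A\<close> of \<open>A\<^sub>K\<close>, which leaves surjectivity.
\<close>

definition is_generic_fibre :: "('k::field \<Rightarrow> 'b::comm_ring_1) \<Rightarrow> 'b set \<Rightarrow> bool" where
  "is_generic_fibre \<kappa> A \<longleftrightarrow>
     \<kappa> \<in> ring_hom ring_of_type_algebra ring_of_type_algebra \<and>
     (\<forall>b. \<exists>c. \<exists>a\<in>A. b = \<kappa> c * a)"

definition special_ideal ::
  "('k::field \<Rightarrow> real) \<Rightarrow> ('k \<Rightarrow> 'b::comm_ring_1) \<Rightarrow> 'b set \<Rightarrow> 'b set" where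
  "special_ideal v \<kappa> A = Idl\<^bsub>subring_of A\<^esub> (\<kappa> ` valuation_ideal v)"

definition special_fibre ::
  "('k::field \<Rightarrow> real) \<Rightarrow> ('k \<Rightarrow> 'b::comm_ring_1) \<Rightarrow> 'b set \<Rightarrow> 'b set ring" where
  "special_fibre v \<kappa> A = subring_of A Quot special_ideal v \<kappa> A"

text \<open>Connectedness of \<open>Spec R\<close>; the underlying space of \<open>Spf A\<close> is that of \<open>Spec A\<^sub>k\<close>.\<close>

definition connected_spectrum :: "('a, 'm) ring_scheme \<Rightarrow> bool" where
  "connected_spectrum R \<longleftrightarrow>
     \<one>\<^bsub>R\<^esub> \<noteq> \<zero>\<^bsub>R\<^esub> \<and> (\<forall>e\<in>carrier R. e \<otimes>\<^bsub>R\<^esub> e = e \<longrightarrow> e = \<zero>\<^bsub>R\<^esub> \<or> e = \<one>\<^bsub>R\<^esub>)"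

definition regular_sequence :: "('a, 'm) ring_scheme \<Rightarrow> 'a list \<Rightarrow> bool" where
  "regular_sequence R fs \<longleftrightarrow>
     set fs \<subseteq> carrier R \<and>
     (\<forall>i<length fs. \<forall>x\<in>carrier R.
        fs ! i \<otimes>\<^bsub>R\<^esub> x \<in> Idl\<^bsub>R\<^esub> set (take i fs) \<longrightarrow> x \<in> Idl\<^bsub>R\<^esub> set (take i fs)) \<and>
     Idl\<^bsub>R\<^esub> set fs \<noteq> carrier R"

definition are_lifts ::
  "('k::field \<Rightarrow> real) \<Rightarrow> ('k \<Rightarrow> 'b::comm_ring_1) \<Rightarrow> 'b set \<Rightarrow> 'b set list \<Rightarrow> 'b list \<Rightarrow> bool" where
  "are_lifts v \<kappa> A fs lfs \<longleftrightarrow>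
     list_all2 (\<lambda>f lf. lf \<in> A \<and> f = special_ideal v \<kappa> A +>\<^bsub>subring_of A\<^esub> lf) fs lfs"


section \<open>The supremum norm\<close>

text \<open>
  A point \<open>x\<close> of the affinoid space of \<open>A\<^sub>K\<close> is a maximal ideal, with residue field finite over \<open>K\<close>,
  and \<open>\<bar>f(x)\<bar>\<close> is the value of \<open>f mod x\<close> under the unique absolute value of \<open>A\<^sub>K/x\<close> that extends \<open>v\<close>.
  The point is represented by \<open>f \<mapsto> \<bar>f(x)\<bar>\<close>, whose zero set is \<open>x\<close>.
\<close>

definition affinoid_point ::
  "('k::field \<Rightarrow> real) \<Rightarrow> ('k \<Rightarrow> 'b::comm_ring_1) \<Rightarrow> ('b \<Rightarrow> real) \<Rightarrow> bool" where
  "affinoid_point v \<kappa> w \<longleftrightarrow>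
     maximalideal {f. w f = 0} ring_of_type_algebra \<and>
     (\<exists>E. finite E \<and> (\<forall>f. \<exists>c. w (f - (\<Sum>e\<in>E. \<kappa> (c e) * e)) = 0)) \<and>
     (\<forall>f. 0 \<le> w f) \<and> (\<forall>f g. w (f * g) = w f * w g) \<and>
     (\<forall>f g. w (f + g) \<le> max (w f) (w g)) \<and> (\<forall>c. w (\<kappa> c) = v c)"

definition sup_norm ::
  "('k::field \<Rightarrow> real) \<Rightarrow> ('k \<Rightarrow> 'b::comm_ring_1) \<Rightarrow> 'b \<Rightarrow> real" where
  "sup_norm v \<kappa> f = (SUP w\<in>{w. affinoid_point v \<kappa> w}. w f)"

definition banach_ring_norm :: "('b::comm_ring_1 \<Rightarrow> real) \<Rightarrow> bool" where
  "banach_ring_norm N \<longleftrightarrow>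
     (\<forall>f. 0 \<le> N f) \<and> (\<forall>f. N f = 0 \<longleftrightarrow> f = 0) \<and>
     (\<forall>f g. N (f - g) \<le> N f + N g) \<and> (\<forall>f g. N (f * g) \<le> N f * N g) \<and>
     Metric_space.mcomplete UNIV (\<lambda>f g. N (f - g))"


section \<open>Bornological algebras\<close>

text \<open>
  A bornology on a ring \<open>R\<close> is given by its set \<open>\<B>\<close> of bounded subsets; \<open>\<sigma> : K \<rightarrow> R\<close> is the
  structure map.  Convergence is Mackey convergence, and in complete bornological spaces a cokernel
  is the quotient by the bornological (Mackey) closure of the image.
\<close>

definition mackey_limit ::
  "('k::field \<Rightarrow> real) \<Rightarrow> ('r, 'm) ring_scheme \<Rightarrow> ('k \<Rightarrow> 'r) \<Rightarrow> 'r set set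
    \<Rightarrow> (nat \<Rightarrow> 'r) \<Rightarrow> 'r \<Rightarrow> bool" where
  "mackey_limit v R \<sigma> \<B> x l \<longleftrightarrow>
     (\<exists>B\<in>\<B>. \<exists>c. (\<lambda>n. v (c n)) \<longlonglongrightarrow> 0 \<and> (\<forall>n. \<exists>b\<in>B. x n \<ominus>\<^bsub>R\<^esub> l = \<sigma> (c n) \<otimes>\<^bsub>R\<^esub> b))"

definition mackey_closed ::
  "('k::field \<Rightarrow> real) \<Rightarrow> ('r, 'm) ring_scheme \<Rightarrow> ('k \<Rightarrow> 'r) \<Rightarrow> 'r set set \<Rightarrow> 'r set \<Rightarrow> bool" where
  "mackey_closed v R \<sigma> \<B> C \<longleftrightarrow>
     C \<subseteq> carrier R \<and>
     (\<forall>x l. (\<forall>n. x n \<in> C) \<and> l \<in> carrier R \<and> mackey_limit v R \<sigma> \<B> x l \<longrightarrow> l \<in> C)"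

definition mackey_closure ::
  "('k::field \<Rightarrow> real) \<Rightarrow> ('r, 'm) ring_scheme \<Rightarrow> ('k \<Rightarrow> 'r) \<Rightarrow> 'r set set \<Rightarrow> 'r set \<Rightarrow> 'r set" where
  "mackey_closure v R \<sigma> \<B> S = \<Inter>{C. mackey_closed v R \<sigma> \<B> C \<and> S \<subseteq> C}"

definition quotient_bornology ::
  "('r, 'm) ring_scheme \<Rightarrow> 'r set \<Rightarrow> 'r set set \<Rightarrow> 'r set set set" where
  "quotient_bornology R J \<B> = (\<lambda>B. (\<lambda>x. J +>\<^bsub>R\<^esub> x) ` B) ` \<B>"

definition born_alg_hom ::
  "('r, 'm) ring_scheme \<Rightarrow> 'r set set \<Rightarrow> ('b \<Rightarrow> 'r) \<Rightarrow>
   ('t, 'n) ring_scheme \<Rightarrow> 't set set \<Rightarrow> ('b \<Rightarrow> 't) \<Rightarrow> ('r \<Rightarrow> 't) \<Rightarrow> bool" where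
  "born_alg_hom R \<B> \<alpha> S \<C> \<beta> h \<longleftrightarrow>
     h \<in> ring_hom R S \<and> (\<forall>b. h (\<alpha> b) = \<beta> b) \<and> (\<forall>B\<in>\<B>. h ` B \<in> \<C>)"

definition born_alg_iso ::
  "('r, 'm) ring_scheme \<Rightarrow> 'r set set \<Rightarrow> ('b \<Rightarrow> 'r) \<Rightarrow>
   ('t, 'n) ring_scheme \<Rightarrow> 't set set \<Rightarrow> ('b \<Rightarrow> 't) \<Rightarrow> ('r \<Rightarrow> 't) \<Rightarrow> bool" where
  "born_alg_iso R \<B> \<alpha> S \<C> \<beta> h \<longleftrightarrow>
     born_alg_hom R \<B> \<alpha> S \<C> \<beta> h \<and>
     (\<exists>g. born_alg_hom S \<C> \<beta> R \<B> \<alpha> g \<and>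
        (\<forall>x\<in>carrier R. g (h x) = x) \<and> (\<forall>y\<in>carrier S. h (g y) = y))"


section \<open>Tempered power series and tempered tubes\<close>

definition temp_weight :: "nat \<Rightarrow> nat \<Rightarrow> nat multiset \<Rightarrow> real" where
  "temp_weight s n J = (\<Prod>i<s. inverse (real (count J i + 1) ^ n))"

definition temp_banach :: "('b::comm_ring_1 \<Rightarrow> real) \<Rightarrow> nat \<Rightarrow> nat \<Rightarrow> (nat multiset \<Rightarrow> 'b) set" where
  "temp_banach N s n =
     {a. (\<forall>J. J \<notin> multi_indices s \<longrightarrow> a J = 0) \<and>
         ((\<lambda>J. N (a J) * temp_weight s n J) \<longlongrightarrow> 0)
           (inf (filtercomap size at_top) (principal (multi_indices s)))}"

definition temp_norm :: "('b::comm_ring_1 \<Rightarrow> real) \<Rightarrow> nat \<Rightarrow> nat \<Rightarrow> (nat multiset \<Rightarrow> 'b) \<Rightarrow> real" where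
  "temp_norm N s n a = (SUP J\<in>multi_indices s. N (a J) * temp_weight s n J)"

definition temp_ring :: "('b::comm_ring_1 \<Rightarrow> real) \<Rightarrow> nat \<Rightarrow> (nat multiset \<Rightarrow> 'b) ring" where
  "temp_ring N s = mv_ring ring_of_type_algebra (\<Union>n. temp_banach N s n)"

text \<open>The colimit bornology: bounded sets are the bounded subsets of the Banach modules.\<close>

definition temp_bornology ::
  "('b::comm_ring_1 \<Rightarrow> real) \<Rightarrow> nat \<Rightarrow> (nat multiset \<Rightarrow> 'b) set set" where
  "temp_bornology N s =
     {B. \<exists>n r. B \<subseteq> temp_banach N s n \<and> (\<forall>a\<in>B. temp_norm N s n a \<le> r)}"

abbreviation temp_const :: "'b::comm_ring_1 \<Rightarrow> nat multiset \<Rightarrow> 'b" where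
  "temp_const \<equiv> ring.indexed_const ring_of_type_algebra"

abbreviation temp_var :: "nat \<Rightarrow> nat multiset \<Rightarrow> 'b::comm_ring_1" where
  "temp_var \<equiv> ring.indexed_var ring_of_type_algebra"

text \<open>
  The tube attached to liftings \<open>lf\<^sub>0, \<dots>, lf\<^sub>s\<^sub>-\<^sub>1\<close>: the quotient by \<open>(y\<^sub>0 - lf\<^sub>0, \<dots>, y\<^sub>s\<^sub>-\<^sub>1 - lf\<^sub>s\<^sub>-\<^sub>1)\<close> in
  complete bornological algebras, with its bornology and its \<open>A\<^sub>K\<close>-algebra structure map.
\<close>

definition tube_ideal ::
  "('k::field \<Rightarrow> real) \<Rightarrow> ('k \<Rightarrow> 'b::comm_ring_1) \<Rightarrow> 'b list \<Rightarrow> (nat multiset \<Rightarrow> 'b) set" where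
  "tube_ideal v \<kappa> lfs =
     (let N = sup_norm v \<kappa>; s = length lfs; T = temp_ring N s in
        mackey_closure v T (\<lambda>c. temp_const (\<kappa> c)) (temp_bornology N s)
          (Idl\<^bsub>T\<^esub> {temp_var i \<ominus>\<^bsub>T\<^esub> temp_const (lfs ! i) | i. i < s}))"

definition tube_ring ::
  "('k::field \<Rightarrow> real) \<Rightarrow> ('k \<Rightarrow> 'b::comm_ring_1) \<Rightarrow> 'b list \<Rightarrow> (nat multiset \<Rightarrow> 'b) set ring" where
  "tube_ring v \<kappa> lfs = temp_ring (sup_norm v \<kappa>) (length lfs) Quot tube_ideal v \<kappa> lfs"

definition tube_bornology ::
  "('k::field \<Rightarrow> real) \<Rightarrow> ('k \<Rightarrow> 'b::comm_ring_1) \<Rightarrow> 'b list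
    \<Rightarrow> (nat multiset \<Rightarrow> 'b) set set set" where
  "tube_bornology v \<kappa> lfs =
     quotient_bornology (temp_ring (sup_norm v \<kappa>) (length lfs)) (tube_ideal v \<kappa> lfs)
       (temp_bornology (sup_norm v \<kappa>) (length lfs))"

definition tube_scalar ::
  "('k::field \<Rightarrow> real) \<Rightarrow> ('k \<Rightarrow> 'b::comm_ring_1) \<Rightarrow> 'b list \<Rightarrow> 'b \<Rightarrow> (nat multiset \<Rightarrow> 'b) set" where
  "tube_scalar v \<kappa> lfs b =
     tube_ideal v \<kappa> lfs +>\<^bsub>temp_ring (sup_norm v \<kappa>) (length lfs)\<^esub> temp_const b"

end

theory Submission
  imports Defs
begin

text \<open>
  Each \<open>f\<^sub>i\<close> lies in the ideal generated by the \<open>g\<^sub>j\<close>, so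
  \<open>lf\<^sub>i = \<Sum>\<^sub>j a\<^sub>i\<^sub>j lg\<^sub>j + r\<^sub>i\<close> with \<open>a\<^sub>i\<^sub>j \<in> A\<close> and \<open>r\<^sub>i\<close> in the special ideal, where the supremum norm
  is at most \<open>\<bar>\<pi>\<bar> < 1\<close>.  Substituting \<open>y\<^sub>i \<mapsto> \<Sum>\<^sub>j a\<^sub>i\<^sub>j z\<^sub>j + r\<^sub>i\<close> in a tempered series converges: the
  coefficient of \<open>z\<^sup>M\<close> in the image of \<open>y\<^sup>J\<close> has norm at most \<open>\<bar>\<pi>\<bar>\<close> to the power \<open>\<bar>J\<bar> - \<bar>M\<bar>\<close>, which beats
  polynomial growth.  This induces a bounded homomorphism of tubes.  Conversely, a bounded
  homomorphism of \<open>A\<^sub>K\<close>-algebras between tubes is unique, because in a tube every variable equals a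
  scalar, polynomials are Mackey dense, and tubes are separated.  Hence the homomorphisms in the two
  directions are mutually inverse.
\<close>

section \<open>Power series as a type\<close>

text \<open>The estimate behind everything is that elements of \<open>A\<close> have supremum norm
  at most 1. Points are abstract multiplicative seminorms, so this bound has to be extracted from
  the p-adic completeness of \<open>A\<close> and the finiteness of the residue field; the
  discreteness of the valuation then gives a single bound below 1 on the whole special ideal.

  The obstacle in the quotient is the Mackey closure. It is an intersection of closed sets and need
  not consist of limits of sequences from the ideal, so its elements are never written down: a
  statement about all of them is obtained by showing that a suitable preimage is closed and contains
  what generates the closure. This is why the substitution has to be a bounded ring homomorphism on
  all tempered series, and not only on polynomials.

  The weights in the separate degrees are traded for powers of the total degree plus 1. The
  exponents change, the colimit bornology does not, and exponents become additive under
  multiplication.\<close>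

typedef 'a mps = "UNIV :: (nat multiset \<Rightarrow> 'a) set"
  morphisms mcoeff Mps by simp

lemmas mcoeff_Mps [simp] = Mps_inverse[OF UNIV_I]
declare mcoeff_inverse [simp]

lemma mps_eqI: "(\<And>M. mcoeff f M = mcoeff g M) \<Longrightarrow> f = g"
  by (metis ext mcoeff_inverse)

lemma finite_submultisets: "finite {I. I \<subseteq># (M :: 'a multiset)}"
proof -
  have "{I. I \<subseteq># M} \<subseteq> mset ` {xs. set xs \<subseteq> set_mset M \<and> length xs \<le> size M}"
  proof
    fix I assume "I \<in> {I. I \<subseteq># M}"
    moreover obtain xs where "mset xs = I" using ex_mset by blast
    ultimately show "I \<in> mset ` {xs. set xs \<subseteq> set_mset M \<and> length xs \<le> size M}"
      using size_mset_mono set_mset_mono by (force simp flip: set_mset_mset size_mset)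
  qed
  then show ?thesis
    by (rule finite_subset) (simp add: finite_lists_length_le)
qed

definition splits :: "nat multiset \<Rightarrow> (nat multiset \<times> nat multiset) set" where
  "splits M = {(I, J). I + J = M}"

lemma mem_splits [simp]: "(I, J) \<in> splits M \<longleftrightarrow> I + J = M"
  by (simp add: splits_def)

lemma finite_splits [simp]: "finite (splits M)"
proof -
  have "splits M \<subseteq> {I. I \<subseteq># M} \<times> {I. I \<subseteq># M}"
    by (auto simp: splits_def)
  then show ?thesis
    using finite_submultisets finite_subset by blast
qed

lemma splits_empty [simp]: "splits {#} = {({#}, {#})}"
  by (auto simp: splits_def)

text \<open>A Cauchy product with a factor supported at the single multi-index \<open>P\<close>
  keeps at most one term; the unit law and products with monomials are both instances.\<close>

lemma sum_splits_single:
  assumes "\<And>I J. I + J = M \<Longrightarrow> I \<noteq> P \<Longrightarrow> f I J = (0 :: 'a::comm_monoid_add)"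
  shows "(\<Sum>(I, J)\<in>splits M. f I J) = (if P \<subseteq># M then f P (M - P) else 0)"
proof (cases "P \<subseteq># M")
  case True
  then have "(\<Sum>(I, J)\<in>{(P, M - P)}. f I J) = (\<Sum>(I, J)\<in>splits M. f I J)"
    by (intro sum.mono_neutral_left) (use assms in \<open>auto, fastforce+\<close>)
  then show ?thesis using True by simp
next
  case False
  then show ?thesis
    by (auto intro!: sum.neutral assms)
qed

text \<open>Power series without growth condition already form a ring, so the ring axioms are
  settled here and tempered series only need closure properties; \<open>mcoeff\<close> carries the
  results over to \<open>temp_ring\<close>.\<close>

instantiation mps :: (comm_ring_1) comm_ring_1
begin

definition "0 = Mps (\<lambda>_. 0)"
definition "1 = Mps (\<lambda>M. if M = {#} then 1 else 0)"
definition "f + g = Mps (\<lambda>M. mcoeff f M + mcoeff g M)"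
definition "f - g = Mps (\<lambda>M. mcoeff f M - mcoeff g M)"
definition "- f = Mps (\<lambda>M. - mcoeff f M)"
definition "f * g = Mps (\<lambda>M. \<Sum>(I, J)\<in>splits M. mcoeff f I * mcoeff g J)"

lemma mcoeff_simps [simp]:
  "mcoeff 0 M = (0 :: 'a)"
  "mcoeff 1 M = (if M = {#} then 1 else 0 :: 'a)"
  "mcoeff (f + g) M = mcoeff f M + (mcoeff g M :: 'a)"
  "mcoeff (f - g) M = mcoeff f M - (mcoeff g M :: 'a)"
  "mcoeff (- f) M = - (mcoeff f M :: 'a)"
  by (simp_all add: zero_mps_def one_mps_def plus_mps_def minus_mps_def uminus_mps_def)

lemma mcoeff_mult: "mcoeff (f * g) M = (\<Sum>(I, J)\<in>splits M. mcoeff f I * (mcoeff g J :: 'a))"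
  by (simp add: times_mps_def)

instance
proof
  fix f g h :: "'a mps"
  show "f * g * h = f * (g * h)"
  proof (rule mps_eqI)
    fix M
    \<comment> \<open>Both sides are sums over triples with total \<open>M\<close>:
      \<open>?A\<close> splits the first component of a pair once more, \<open>?B\<close> the
      second, and the reindexing regroups the triple.\<close>
    let ?A = "SIGMA p:splits M. splits (fst p)" and ?B = "SIGMA p:splits M. splits (snd p)"
    have "mcoeff (f * g * h) M = (\<Sum>(p, q)\<in>?A. mcoeff f (fst q) * mcoeff g (snd q) * mcoeff h (snd p))"
      by (simp add: mcoeff_mult sum_distrib_right case_prod_unfold sum.Sigma)
    also have "\<dots> = (\<Sum>(p, q)\<in>?B. mcoeff f (fst p) * mcoeff g (fst q) * mcoeff h (snd q))"
      by (rule sum.reindex_bij_witness[where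
            i = "\<lambda>(p, q). ((fst p + fst q, snd q), (fst p, fst q))" and
            j = "\<lambda>(p, q). ((fst q, snd q + snd p), (snd q, snd p))"])
         (auto simp: ac_simps)
    also have "\<dots> = mcoeff (f * (g * h)) M"
      by (simp add: mcoeff_mult sum_distrib_left case_prod_unfold sum.Sigma mult.assoc)
    finally show "mcoeff (f * g * h) M = mcoeff (f * (g * h)) M" .
  qed
  show "f * g = g * f"
  proof (rule mps_eqI)
    fix M
    show "mcoeff (f * g) M = mcoeff (g * f) M"
      unfolding mcoeff_mult
      by (rule sum.reindex_bij_witness[where i = prod.swap and j = prod.swap]) (auto simp: ac_simps)
  qed
  show "1 * f = f"
    by (rule mps_eqI) (subst mcoeff_mult, subst sum_splits_single[where P = "{#}"], auto)
  show "(f + g) * h = f * h + g * h"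
    by (rule mps_eqI)
       (simp add: mcoeff_mult sum.distrib algebra_simps case_prod_unfold)
  have "mcoeff 0 {#} \<noteq> (mcoeff 1 {#} :: 'a)" by simp
  then show "0 \<noteq> (1 :: 'a mps)" by metis
qed (auto intro!: mps_eqI simp: algebra_simps)

end

lemma mcoeff_sum: "mcoeff (sum f S) M = (\<Sum>x\<in>S. mcoeff (f x) M)"
  for f :: "'c \<Rightarrow> 'a::comm_ring_1 mps"
  by (induction S rule: infinite_finite_induct) auto

definition mmonom :: "'a::comm_ring_1 \<Rightarrow> nat multiset \<Rightarrow> 'a mps" where
  "mmonom b J = Mps (\<lambda>M. if M = J then b else 0)"

abbreviation mconst :: "'a::comm_ring_1 \<Rightarrow> 'a mps" where
  "mconst b \<equiv> mmonom b {#}"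

abbreviation mvar :: "nat \<Rightarrow> 'a::comm_ring_1 mps" where
  "mvar i \<equiv> mmonom 1 {#i#}"

lemma mcoeff_mmonom: "mcoeff (mmonom b J) M = (if M = J then b else 0)"
  by (simp add: mmonom_def)

lemma mcoeff_mmonom_mult:
  "mcoeff (mmonom b P * f) M = (if P \<subseteq># M then b * mcoeff f (M - P) else 0)"
  by (subst mcoeff_mult, subst sum_splits_single[where P = P]) (auto simp: mcoeff_mmonom)

lemma mcoeff_mconst_mult [simp]: "mcoeff (mconst b * f) M = b * mcoeff f M"
  by (simp add: mcoeff_mmonom_mult)

lemma mmonom_mult: "mmonom a I * mmonom b J = mmonom (a * b) (I + J)"
  by (rule mps_eqI) (auto simp: mcoeff_mmonom_mult mcoeff_mmonom)

lemma mmonom_add: "mmonom a J + mmonom b J = mmonom (a + b) J"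
  by (rule mps_eqI) (auto simp: mcoeff_mmonom)

lemma mmonom_0: "mmonom 0 J = 0"
  by (rule mps_eqI) (auto simp: mcoeff_mmonom)

lemma mmonom_sum: "mmonom (sum f S) J = (\<Sum>x\<in>S. mmonom (f x) J)"
  by (induction S rule: infinite_finite_induct) (auto simp: mmonom_0 simp flip: mmonom_add)

lemma mconst_1: "mconst 1 = 1"
  by (rule mps_eqI) (auto simp: mcoeff_mmonom)

section \<open>Tempered growth\<close>

definition small_indices :: "nat \<Rightarrow> nat \<Rightarrow> nat multiset set" where
  "small_indices s m = {J \<in> multi_indices s. size J < m}"

lemma finite_small_indices [simp]: "finite (small_indices s m)"
proof -
  have "small_indices s m \<subseteq> mset ` {xs. set xs \<subseteq> {..<s} \<and> length xs \<le> m}"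
  proof
    fix J assume "J \<in> small_indices s m"
    moreover obtain xs where "mset xs = J" using ex_mset by blast
    ultimately show "J \<in> mset ` {xs. set xs \<subseteq> {..<s} \<and> length xs \<le> m}"
      by (force simp: small_indices_def multi_indices_def simp flip: set_mset_mset size_mset)
  qed
  then show ?thesis
    by (rule finite_subset) (simp add: finite_lists_length_le)
qed

lemma multi_indices_add [simp]: "I + J \<in> multi_indices s \<longleftrightarrow> I \<in> multi_indices s \<and> J \<in> multi_indices s"
  by (auto simp: multi_indices_def)

lemma multi_indices_empty [simp]: "{#} \<in> multi_indices s"
  by (simp add: multi_indices_def)

lemma multi_indices_single [simp]: "{#i#} \<in> multi_indices s \<longleftrightarrow> i < s"
  by (auto simp: multi_indices_def)

lemma sum_count_multi_index:
  assumes "J \<in> multi_indices s"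
  shows "(\<Sum>i<s. count J i) = size J"
proof -
  have "sum (count J) (set_mset J) = sum (count J) {..<s}"
    using assms by (intro sum.mono_neutral_left) (auto simp: multi_indices_def not_in_iff)
  then show ?thesis by (simp add: size_multiset_overloaded_eq)
qed

text \<open>The expanded product contains 1 and every \<open>f i\<close> among nonnegative terms.
  Applied to the counts of a multi-index, this compares the product weight with the total
  degree.\<close>

lemma Suc_sum_le_prod_Suc: "Suc (\<Sum>i\<in>A. f i) \<le> (\<Prod>i\<in>A. Suc (f i))"
proof (induction A rule: infinite_finite_induct)
  case (insert x A)
  have "Suc (sum f (insert x A)) \<le> Suc (f x) * Suc (sum f A)"
    using insert by simp
  also have "\<dots> \<le> Suc (f x) * (\<Prod>i\<in>A. Suc (f i))"
    using insert by (intro mult_left_mono) auto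
  finally show ?case using insert by simp
qed auto

lemma temp_weight_pos: "0 < temp_weight s n J"
  by (auto simp: temp_weight_def intro!: prod_pos)

lemma temp_weight_le:
  assumes "J \<in> multi_indices s"
  shows "temp_weight s n J \<le> inverse (real (size J + 1) ^ n)"
proof -
  have "temp_weight s n J = inverse ((\<Prod>i<s. real (Suc (count J i))) ^ n)"
    by (simp add: temp_weight_def prod_power_distrib prod_inversef[unfolded o_def] algebra_simps)
  moreover have "real (size J + 1) \<le> (\<Prod>i<s. real (Suc (count J i)))"
    using Suc_sum_le_prod_Suc[of "count J" "{..<s}"] sum_count_multi_index[OF assms]
    by (metis Suc_eq_plus1 of_nat_le_iff of_nat_prod)
  ultimately show ?thesis
    by (simp add: le_imp_inverse_le power_mono)
qed

text \<open>Each of the \<open>s\<close> factors is at least the inverse of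
  \<open>(size J + 1) ^ n\<close>, whence the exponent \<open>n * s\<close>. With the opposite
  bound, weights and powers of the total degree are interchangeable up to a change of
  exponent.\<close>

lemma temp_weight_ge: "inverse (real (size J + 1) ^ (n * s)) \<le> temp_weight s n J"
proof -
  have "(\<Prod>i<s. inverse (real (size J + 1) ^ n)) \<le> temp_weight s n J"
    unfolding temp_weight_def
    by (intro prod_mono conjI le_imp_inverse_le power_mono)
       (auto simp: count_le_size)
  then show ?thesis
    by (simp add: power_mult power_inverse)
qed

text \<open>What the power series arguments use about the affinoid algebra: a complete ultrametric
  norm, homogeneous under scalars. Later \<open>N\<close> is the supremum norm and
  \<open>\<omega>\<close> a uniformizer; \<open>v \<omega>\<close> is both the bound on the special
  ideal and the ratio of the geometric decay under substitution.\<close>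

locale banach_algebra =
  fixes v :: "'k::field \<Rightarrow> real" and \<kappa> :: "'k \<Rightarrow> 'b::comm_ring_1" and N :: "'b \<Rightarrow> real" and \<omega> :: 'k
  assumes v_nonneg: "0 \<le> v c"
    and v_eq_0: "v c = 0 \<longleftrightarrow> c = 0"
    and v_mult: "v (c * d) = v c * v d"
    and v_pos_\<omega>: "0 < v \<omega>"
    and v_\<omega>_less_1: "v \<omega> < 1"
    and \<kappa>_1: "\<kappa> 1 = 1"
    and \<kappa>_mult: "\<kappa> (c * d) = \<kappa> c * \<kappa> d"
    and N_nonneg: "0 \<le> N x"
    and N_eq_0: "N x = 0 \<longleftrightarrow> x = 0"
    and N_1: "N 1 = 1"
    and N_minus: "N (- x) = N x"
    and N_add: "N (x + y) \<le> max (N x) (N y)"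
    and N_mult: "N (x * y) \<le> N x * N y"
    and N_scale: "N (\<kappa> c * x) = v c * N x"
    and N_complete: "(\<And>e. 0 < e \<Longrightarrow> \<exists>n0. \<forall>m\<ge>n0. \<forall>n\<ge>n0. N (u m - u n) < e)
      \<Longrightarrow> \<exists>l. (\<lambda>n. N (u n - l)) \<longlonglongrightarrow> 0"
begin

lemma N_0 [simp]: "N 0 = 0"
  by (simp add: N_eq_0)

lemma N_diff: "N (x - y) \<le> max (N x) (N y)"
  using N_add[of x "- y"] by (simp add: N_minus)

lemma N_diff_commute: "N (x - y) = N (y - x)"
  using N_minus[of "x - y"] by simp

lemma N_add_le: "N x \<le> r \<Longrightarrow> N y \<le> r \<Longrightarrow> N (x + y) \<le> r"
  using N_add[of x y] by simp

lemma N_sum_le: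
  assumes "0 \<le> r" and "\<And>i. i \<in> S \<Longrightarrow> N (f i) \<le> r"
  shows "N (sum f S) \<le> r"
  using assms(2)
  by (induction S rule: infinite_finite_induct) (auto simp: assms(1) intro: N_add_le)

lemma v_1: "v 1 = 1"
  using v_mult[of \<omega> 1] v_pos_\<omega> by simp

lemma v_power: "v (c ^ n) = v c ^ n"
  by (induction n) (auto simp: v_1 v_mult)

lemma v_inverse: "v (inverse c) = inverse (v c)"
proof (cases "c = 0")
  case False
  then have "v c * v (inverse c) = 1"
    by (simp add: v_1 flip: v_mult)
  then show ?thesis
    by (metis inverse_unique)
qed (simp add: iffD2[OF v_eq_0])

text \<open>The total degree replaces the separate degrees of \<open>temp_weight\<close>, and
  boundedness replaces convergence to 0. These sets turn out to be cofinal among the bounded sets of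
  the colimit bornology.\<close>

definition growth :: "nat \<Rightarrow> nat \<Rightarrow> real \<Rightarrow> 'b mps set" where
  "growth s n C = {f. (\<forall>M. M \<notin> multi_indices s \<longrightarrow> mcoeff f M = 0) \<and>
     (\<forall>M. N (mcoeff f M) \<le> C * real (size M + 1) ^ n)}"

definition tempered :: "nat \<Rightarrow> 'b mps set" where
  "tempered s = (\<Union>n C. growth s n C)"

lemma growthD:
  assumes "f \<in> growth s n C"
  shows "M \<notin> multi_indices s \<Longrightarrow> mcoeff f M = 0"
    and "N (mcoeff f M) \<le> C * real (size M + 1) ^ n"
  using assms by (auto simp: growth_def)

lemma growth_nonneg: "f \<in> growth s n C \<Longrightarrow> 0 \<le> C"
  using growthD(2)[of f s n C "{#}"] N_nonneg[of "mcoeff f {#}"] by simp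

lemma growth_mono:
  assumes "f \<in> growth s n C" and "n \<le> n'" and "C \<le> C'"
  shows "f \<in> growth s n' C'"
proof -
  have "C * real (size M + 1) ^ n \<le> C' * real (size M + 1) ^ n'" for M :: "nat multiset"
    using assms growth_nonneg[OF assms(1)] by (intro mult_mono power_increasing) auto
  then show ?thesis
    using assms(1) unfolding growth_def by (auto intro: order_trans)
qed

lemma growth_add:
  assumes "f \<in> growth s n C" and "g \<in> growth s n' C'"
  shows "f + g \<in> growth s (max n n') (max C C')"
proof -
  have "f \<in> growth s (max n n') (max C C')" "g \<in> growth s (max n n') (max C C')"
    using assms growth_mono by auto
  then show ?thesis
    unfolding growth_def by (auto intro: N_add_le)
qed

lemma growth_uminus: "f \<in> growth s n C \<Longrightarrow> - f \<in> growth s n C"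
  by (simp add: growth_def N_minus)

lemma growth_diff:
  "f \<in> growth s n C \<Longrightarrow> g \<in> growth s n' C' \<Longrightarrow> f - g \<in> growth s (max n n') (max C C')"
  using growth_add[of f s n C "- g"] growth_uminus[of g] by simp

text \<open>For \<open>I + J = M\<close> both sizes are at most \<open>size M\<close>, and the
  ultrametric inequality makes the number of splittings irrelevant; hence exponents add and
  constants multiply.\<close>

lemma growth_mult:
  assumes f: "f \<in> growth s n C" and g: "g \<in> growth s n' C'"
  shows "f * g \<in> growth s (n + n') (C * C')"
proof -
  have C: "0 \<le> C" "0 \<le> C'" using growth_nonneg f g by auto
  have "N (mcoeff (f * g) M) \<le> C * C' * real (size M + 1) ^ (n + n')" for M
    unfolding mcoeff_mult
  proof (rule N_sum_le)
    fix p assume "p \<in> splits M"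
    then obtain I J where p: "p = (I, J)" and M: "M = I + J" by (cases p) auto
    have "N (mcoeff f I * mcoeff g J) \<le> N (mcoeff f I) * N (mcoeff g J)"
      by (rule N_mult)
    also have "\<dots> \<le> (C * real (size I + 1) ^ n) * (C' * real (size J + 1) ^ n')"
      using growthD[OF f] growthD[OF g] by (intro mult_mono) (auto simp: N_nonneg C)
    also have "\<dots> \<le> (C * real (size M + 1) ^ n) * (C' * real (size M + 1) ^ n')"
      by (intro mult_mono power_mono mult_nonneg_nonneg) (auto simp: C M)
    finally show "N (case p of (I, J) \<Rightarrow> mcoeff f I * mcoeff g J) \<le> C * C' * real (size M + 1) ^ (n + n')"
      by (simp add: p power_add algebra_simps)
  qed (use C in auto)
  moreover have "mcoeff (f * g) M = 0" if "M \<notin> multi_indices s" for M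
    unfolding mcoeff_mult
    using that growthD(1)[OF f] growthD(1)[OF g] by (auto intro!: sum.neutral)
  ultimately show ?thesis by (simp add: growth_def)
qed

lemma growth_mmonom:
  assumes "J \<in> multi_indices s"
  shows "mmonom b J \<in> growth s 0 (N b)"
  using assms by (auto simp: growth_def mcoeff_mmonom N_nonneg)

lemma tempered_add: "f \<in> tempered s \<Longrightarrow> g \<in> tempered s \<Longrightarrow> f + g \<in> tempered s"
  unfolding tempered_def by (blast intro: growth_add)

lemma tempered_diff: "f \<in> tempered s \<Longrightarrow> g \<in> tempered s \<Longrightarrow> f - g \<in> tempered s"
  unfolding tempered_def by (blast intro: growth_diff)

lemma tempered_uminus: "f \<in> tempered s \<Longrightarrow> - f \<in> tempered s"
  unfolding tempered_def by (blast intro: growth_uminus)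

lemma tempered_mult: "f \<in> tempered s \<Longrightarrow> g \<in> tempered s \<Longrightarrow> f * g \<in> tempered s"
  unfolding tempered_def by (blast intro: growth_mult)

lemma tempered_mmonom: "J \<in> multi_indices s \<Longrightarrow> mmonom b J \<in> tempered s"
  unfolding tempered_def by (blast intro: growth_mmonom)

lemma tempered_0: "0 \<in> tempered s"
  using tempered_mmonom[of "{#}" s 0] by (simp add: mmonom_0)

lemma tempered_1: "1 \<in> tempered s"
  using tempered_mmonom[of "{#}" s 1] by (simp add: mconst_1)

section \<open>Comparison with the weighted Banach modules\<close>

lemma temp_banach_iff:
  "a \<in> temp_banach N s n \<longleftrightarrow> (\<forall>J. J \<notin> multi_indices s \<longrightarrow> a J = 0) \<and>
     (\<forall>e>0. \<exists>m. \<forall>J\<in>multi_indices s. m \<le> size J \<longrightarrow> N (a J) * temp_weight s n J < e)"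
  unfolding temp_banach_def tendsto_iff eventually_inf_principal eventually_filtercomap_at_top_linorder
  by (simp add: abs_mult N_nonneg abs_of_pos temp_weight_pos) (meson UNIV_I)

text \<open>One more exponent turns a bounded family into one that tends to 0: after weighting, at
  most \<open>C / (size J + 1)\<close> remains.\<close>

lemma growth_imp_temp_banach:
  assumes f: "f \<in> growth s n C"
  shows "mcoeff f \<in> temp_banach N s (Suc n)" "temp_norm N s (Suc n) (mcoeff f) \<le> C"
proof -
  have C: "0 \<le> C" using growth_nonneg f by auto
  have *: "N (mcoeff f J) * temp_weight s (Suc n) J \<le> C / real (size J + 1)"
    if "J \<in> multi_indices s" for J
  proof -
    have "N (mcoeff f J) * temp_weight s (Suc n) J
        \<le> (C * real (size J + 1) ^ n) * inverse (real (size J + 1) ^ Suc n)"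
      using temp_weight_le[OF that, of "Suc n"] growthD(2)[OF f] C
      by (intro mult_mono) (auto intro: less_imp_le temp_weight_pos)
    also have "\<dots> = C / real (size J + 1)"
      by (simp add: divide_simps del: of_nat_Suc of_nat_add)
    finally show ?thesis .
  qed
  show "mcoeff f \<in> temp_banach N s (Suc n)"
    unfolding temp_banach_iff
  proof (intro conjI allI impI)
    fix e :: real assume e: "0 < e"
    obtain m :: nat where m: "C / e < real m" using reals_Archimedean2 by blast
    have "N (mcoeff f J) * temp_weight s (Suc n) J < e" if "J \<in> multi_indices s" "m \<le> size J" for J
    proof -
      have "C < real m * e" using m e by (simp add: field_simps)
      also have "\<dots> \<le> real (size J + 1) * e" using that e by (intro mult_right_mono) auto
      finally have "C / real (size J + 1) < e" by (simp add: field_simps)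
      then show ?thesis using *[OF that(1)] by simp
    qed
    then show "\<exists>m. \<forall>J\<in>multi_indices s. m \<le> size J \<longrightarrow> N (mcoeff f J) * temp_weight s (Suc n) J < e"
      by blast
  qed (use growthD(1)[OF f] in auto)
  have "N (mcoeff f J) * temp_weight s (Suc n) J \<le> C" if "J \<in> multi_indices s" for J
  proof -
    have "C / real (size J + 1) \<le> C / 1" using C by (intro divide_left_mono) auto
    then show ?thesis using *[OF that] by simp
  qed
  then show "temp_norm N s (Suc n) (mcoeff f) \<le> C"
    unfolding temp_norm_def by (intro cSUP_least) (use multi_indices_empty in blast)+
qed

lemma temp_banach_imp_growth:
  assumes a: "a \<in> temp_banach N s n" and r: "temp_norm N s n a \<le> r"
  shows "Mps a \<in> growth s (n * s) r"
proof -
  \<comment> \<open>The supremum \<open>temp_norm\<close> bounds its terms only if their set is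
    bounded above: outside a finite set of indices the terms are below 1.\<close>
  obtain m where m: "\<forall>J\<in>multi_indices s. m \<le> size J \<longrightarrow> N (a J) * temp_weight s n J < 1"
    using a unfolding temp_banach_iff by (meson zero_less_one)
  let ?g = "\<lambda>J. N (a J) * temp_weight s n J"
  have "?g ` multi_indices s \<subseteq> ?g ` small_indices s m \<union> {..1}"
    using m by (fastforce simp: small_indices_def not_less)
  moreover have "bdd_above (?g ` small_indices s m \<union> {..1})"
    by simp
  ultimately have bdd: "bdd_above (?g ` multi_indices s)"
    by (rule bdd_above_mono[rotated])
  have r': "?g J \<le> r" if "J \<in> multi_indices s" for J
    using cSUP_upper[OF that bdd] r unfolding temp_norm_def by simp
  have r0: "0 \<le> r"
    using r'[of "{#}"] temp_weight_pos[of s n "{#}"] N_nonneg[of "a {#}"]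
    by (meson less_imp_le mult_nonneg_nonneg multi_indices_empty order_trans)
  have "N (a J) \<le> r * real (size J + 1) ^ (n * s)" for J
  proof (cases "J \<in> multi_indices s")
    case True
    have "N (a J) * inverse (real (size J + 1) ^ (n * s)) \<le> ?g J"
      by (intro mult_left_mono temp_weight_ge N_nonneg)
    also have "\<dots> \<le> r" using r'[OF True] .
    finally show ?thesis by (simp add: field_simps)
  next
    case False
    then have "a J = 0" using a by (simp add: temp_banach_iff)
    then show ?thesis using r0 by simp
  qed
  then show ?thesis
    using a by (auto simp: growth_def temp_banach_iff)
qed

lemma Union_temp_banach: "(\<Union>n. temp_banach N s n) = mcoeff ` tempered s"
proof
  show "(\<Union>n. temp_banach N s n) \<subseteq> mcoeff ` tempered s"
    using temp_banach_imp_growth[OF _ order_refl] unfolding tempered_def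
    by (force intro: image_eqI[where x = "Mps _"])
  show "mcoeff ` tempered s \<subseteq> (\<Union>n. temp_banach N s n)"
    using growth_imp_temp_banach(1) unfolding tempered_def by blast
qed

text \<open>The passages from \<open>n\<close> to \<open>n + 1\<close> and to \<open>n * s\<close>
  in the two comparisons are absorbed by the union over all exponents.\<close>

lemma temp_bornology_iff: "B \<in> temp_bornology N s \<longleftrightarrow> (\<exists>n C. B \<subseteq> mcoeff ` growth s n C)"
proof
  assume "B \<in> temp_bornology N s"
  then obtain n r where "B \<subseteq> temp_banach N s n" "\<forall>a\<in>B. temp_norm N s n a \<le> r"
    by (auto simp: temp_bornology_def)
  then have "a \<in> mcoeff ` growth s (n * s) r" if "a \<in> B" for a
    using that temp_banach_imp_growth[of a s n r] by (intro image_eqI[of _ _ "Mps a"]) auto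
  then have "B \<subseteq> mcoeff ` growth s (n * s) r" by blast
  then show "\<exists>n C. B \<subseteq> mcoeff ` growth s n C" by blast
next
  assume "\<exists>n C. B \<subseteq> mcoeff ` growth s n C"
  then obtain n C where *: "B \<subseteq> mcoeff ` growth s n C" by blast
  then have "B \<subseteq> temp_banach N s (Suc n)" "\<forall>a\<in>B. temp_norm N s (Suc n) a \<le> C"
    using growth_imp_temp_banach by auto
  then show "B \<in> temp_bornology N s"
    unfolding temp_bornology_def by blast
qed

end

section \<open>Tempered power series as a bornological algebra\<close>

lemma ring_of_type_algebra_simps [simp]:
  "carrier (ring_of_type_algebra :: 'a::comm_ring_1 ring) = UNIV"
  "x \<otimes>\<^bsub>ring_of_type_algebra\<^esub> y = x * (y :: 'a)"
  "x \<oplus>\<^bsub>ring_of_type_algebra\<^esub> y = x + (y :: 'a)"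
  "\<one>\<^bsub>ring_of_type_algebra\<^esub> = (1 :: 'a)"
  "\<zero>\<^bsub>ring_of_type_algebra\<^esub> = (0 :: 'a)"
  by (simp_all add: ring_of_type_algebra_def)

lemma finsum_ring_of_type_algebra:
  fixes f :: "'c \<Rightarrow> 'a::comm_ring_1"
  shows "finsum ring_of_type_algebra f S = sum f S"
proof -
  interpret cring "ring_of_type_algebra :: 'a ring"
    by (rule cring_from_type_algebra)
  show ?thesis
    by (induction S rule: infinite_finite_induct) (auto simp: finsum_infinite)
qed

lemma mv_mult_ring_of_type_algebra:
  "mv_mult ring_of_type_algebra (mcoeff f) (mcoeff g) = mcoeff (f * g)"
  for f :: "'a::comm_ring_1 mps"
  by (rule ext) (simp add: mv_mult_def finsum_ring_of_type_algebra mcoeff_mult flip: splits_def)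

lemma temp_const_eq: "temp_const b = mcoeff (mconst b)"
  by (rule ext) (simp add: ring.indexed_const_def[OF ring_from_type_algebra] mcoeff_mmonom)

lemma temp_var_eq: "temp_var i = mcoeff (mvar i)"
  by (rule ext)
     (auto simp: ring.indexed_var_def[OF ring_from_type_algebra]
        ring.indexed_pmult_def[OF ring_from_type_algebra]
        ring.indexed_const_def[OF ring_from_type_algebra] mcoeff_mmonom
        dest!: multi_member_split)

lemma mconst_0: "mconst 0 = 0"
  by (rule mmonom_0)

context banach_algebra
begin

lemma temp_ring_simps:
  "carrier (temp_ring N s) = mcoeff ` tempered s"
  "mcoeff f \<otimes>\<^bsub>temp_ring N s\<^esub> mcoeff g = mcoeff (f * g)"
  "mcoeff f \<oplus>\<^bsub>temp_ring N s\<^esub> mcoeff g = mcoeff (f + g)"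
  "\<one>\<^bsub>temp_ring N s\<^esub> = mcoeff 1"
  "\<zero>\<^bsub>temp_ring N s\<^esub> = mcoeff 0"
  by (simp_all add: temp_ring_def mv_ring_def Union_temp_banach mv_mult_ring_of_type_algebra
      ring.indexed_padd_def[OF ring_from_type_algebra] temp_const_eq mconst_1 mconst_0 fun_eq_iff)

lemma cring_temp_ring: "cring (temp_ring N s)"
proof (rule cringI)
  show "abelian_group (temp_ring N s)"
  proof (rule abelian_groupI)
    fix x assume "x \<in> carrier (temp_ring N s)"
    then obtain f where "f \<in> tempered s" "x = mcoeff f"
      by (auto simp: temp_ring_simps)
    then show "\<exists>y\<in>carrier (temp_ring N s). y \<oplus>\<^bsub>temp_ring N s\<^esub> x = \<zero>\<^bsub>temp_ring N s\<^esub>"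
      by (intro bexI[of _ "mcoeff (- f)"]) (auto simp: temp_ring_simps tempered_uminus)
  qed (auto simp: temp_ring_simps algebra_simps tempered_0 tempered_add)
  show "comm_monoid (temp_ring N s)"
    by (rule comm_monoidI) (auto simp: temp_ring_simps algebra_simps tempered_1 tempered_mult)
qed (auto simp: temp_ring_simps algebra_simps)

lemma temp_ring_minus:
  assumes "f \<in> tempered s" "g \<in> tempered s"
  shows "mcoeff f \<ominus>\<^bsub>temp_ring N s\<^esub> mcoeff g = mcoeff (f - g)"
proof -
  interpret T: cring "temp_ring N s" by (rule cring_temp_ring)
  have "\<ominus>\<^bsub>temp_ring N s\<^esub> mcoeff g = mcoeff (- g)"
    by (rule T.minus_equality) (use assms in \<open>auto simp: temp_ring_simps tempered_uminus\<close>)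
  then show ?thesis
    by (simp add: a_minus_def temp_ring_simps)
qed

section \<open>Mackey convergence, closed sets and ideals\<close>

definition mackey :: "nat \<Rightarrow> (nat \<Rightarrow> 'b mps) \<Rightarrow> 'b mps \<Rightarrow> bool" where
  "mackey s u l \<longleftrightarrow> (\<exists>n C c. (\<lambda>n. v (c n)) \<longlonglongrightarrow> 0 \<and>
     (\<forall>m. \<exists>b\<in>growth s n C. u m - l = mconst (\<kappa> (c m)) * b))"

definition closed_set :: "nat \<Rightarrow> 'b mps set \<Rightarrow> bool" where
  "closed_set s S \<longleftrightarrow> S \<subseteq> tempered s \<and>
     (\<forall>u l. (\<forall>n. u n \<in> S) \<and> l \<in> tempered s \<and> mackey s u l \<longrightarrow> l \<in> S)"

lemma closed_setD:
  "closed_set s S \<Longrightarrow> (\<And>n. u n \<in> S) \<Longrightarrow> l \<in> tempered s \<Longrightarrow> mackey s u l \<Longrightarrow> l \<in> S"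
  unfolding closed_set_def by blast

definition closed_hull :: "nat \<Rightarrow> 'b mps set \<Rightarrow> 'b mps set" where
  "closed_hull s S = \<Inter>{C. closed_set s C \<and> S \<subseteq> C}"

text \<open>Every bounded set can be enlarged to a \<open>growth\<close> set, which is itself
  bounded, so the auxiliary bounded set of a Mackey limit may be taken of this form.\<close>

lemma mackey_limit_iff:
  assumes "\<And>n. u n \<in> tempered s" "l \<in> tempered s"
  shows "mackey_limit v (temp_ring N s) (\<lambda>c. temp_const (\<kappa> c)) (temp_bornology N s)
           (\<lambda>n. mcoeff (u n)) (mcoeff l) \<longleftrightarrow> mackey s u l"
proof -
  have *: "mcoeff (u n) \<ominus>\<^bsub>temp_ring N s\<^esub> mcoeff l = temp_const (\<kappa> c) \<otimes>\<^bsub>temp_ring N s\<^esub> mcoeff b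
      \<longleftrightarrow> u n - l = mconst (\<kappa> c) * b" for n c b
    unfolding temp_ring_minus[OF assms] temp_const_eq temp_ring_simps mcoeff_inject ..
  show ?thesis
  proof
    assume "mackey_limit v (temp_ring N s) (\<lambda>c. temp_const (\<kappa> c)) (temp_bornology N s)
           (\<lambda>n. mcoeff (u n)) (mcoeff l)"
    then obtain B c where B: "B \<in> temp_bornology N s" and c: "(\<lambda>n. v (c n)) \<longlonglongrightarrow> 0"
      and u: "\<And>n. \<exists>b\<in>B. mcoeff (u n) \<ominus>\<^bsub>temp_ring N s\<^esub> mcoeff l
         = temp_const (\<kappa> (c n)) \<otimes>\<^bsub>temp_ring N s\<^esub> b"
      unfolding mackey_limit_def by blast
    obtain k C where "B \<subseteq> mcoeff ` growth s k C"
      using B by (auto simp: temp_bornology_iff)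
    then have "\<exists>b\<in>growth s k C. u n - l = mconst (\<kappa> (c n)) * b" for n
      using u[of n] * by blast
    then show "mackey s u l" using c unfolding mackey_def by blast
  next
    assume "mackey s u l"
    then obtain k C c where c: "(\<lambda>n. v (c n)) \<longlonglongrightarrow> 0"
      and u: "\<And>n. \<exists>b\<in>growth s k C. u n - l = mconst (\<kappa> (c n)) * b"
      unfolding mackey_def by blast
    have "mcoeff ` growth s k C \<in> temp_bornology N s"
      unfolding temp_bornology_iff by blast
    moreover have "\<exists>b\<in>mcoeff ` growth s k C. mcoeff (u n) \<ominus>\<^bsub>temp_ring N s\<^esub> mcoeff l
         = temp_const (\<kappa> (c n)) \<otimes>\<^bsub>temp_ring N s\<^esub> b" for n
      using u[of n] * by blast
    ultimately show "mackey_limit v (temp_ring N s) (\<lambda>c. temp_const (\<kappa> c)) (temp_bornology N s)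
           (\<lambda>n. mcoeff (u n)) (mcoeff l)"
      using c unfolding mackey_limit_def by blast
  qed
qed

lemma mackey_closed_iff:
  "mackey_closed v (temp_ring N s) (\<lambda>c. temp_const (\<kappa> c)) (temp_bornology N s) (mcoeff ` S)
     \<longleftrightarrow> closed_set s S"
proof -
  have mem: "mcoeff f \<in> mcoeff ` D \<longleftrightarrow> f \<in> D" for f :: "'b mps" and D
    by (auto simp: mcoeff_inject)
  have sub: "mcoeff ` S \<subseteq> carrier (temp_ring N s) \<longleftrightarrow> S \<subseteq> tempered s"
    unfolding temp_ring_simps using mem by blast
  show ?thesis
  proof
    assume L: "mackey_closed v (temp_ring N s) (\<lambda>c. temp_const (\<kappa> c)) (temp_bornology N s) (mcoeff ` S)"
    then have S: "S \<subseteq> tempered s" unfolding mackey_closed_def sub by blast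
    have "l \<in> S" if "\<And>n. u n \<in> S" "l \<in> tempered s" "mackey s u l" for u l
    proof -
      have "mackey_limit v (temp_ring N s) (\<lambda>c. temp_const (\<kappa> c)) (temp_bornology N s)
           (\<lambda>n. mcoeff (u n)) (mcoeff l)"
        using that S by (subst mackey_limit_iff) auto
      then have "mcoeff l \<in> mcoeff ` S"
        by (intro L[unfolded mackey_closed_def, THEN conjunct2, rule_format, of "\<lambda>n. mcoeff (u n)"])
           (use that in \<open>auto simp: temp_ring_simps\<close>)
      then show ?thesis by (simp add: mem)
    qed
    then show "closed_set s S" using S unfolding closed_set_def by blast
  next
    assume R: "closed_set s S"
    then have S: "S \<subseteq> tempered s" unfolding closed_set_def by blast
    have "y \<in> mcoeff ` S" if x: "\<And>n. x n \<in> mcoeff ` S" and y: "y \<in> carrier (temp_ring N s)"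
      and lim: "mackey_limit v (temp_ring N s) (\<lambda>c. temp_const (\<kappa> c)) (temp_bornology N s) x y" for x y
    proof -
      define u where "u n = Mps (x n)" for n
      define l where "l = Mps y"
      have xy: "x = (\<lambda>n. mcoeff (u n))" "y = mcoeff l"
        by (auto simp: u_def l_def)
      have u: "u n \<in> S" for n using x[of n] unfolding xy mem .
      have l: "l \<in> tempered s" using y unfolding xy temp_ring_simps mem .
      have "mackey s u l"
        using lim u l S unfolding xy by (subst (asm) mackey_limit_iff) auto
      then show ?thesis unfolding xy mem by (rule closed_setD[OF R u l])
    qed
    then show "mackey_closed v (temp_ring N s) (\<lambda>c. temp_const (\<kappa> c)) (temp_bornology N s) (mcoeff ` S)"
      unfolding mackey_closed_def sub using S by blast
  qed
qed

lemma mackey_closure_eq: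
  "mackey_closure v (temp_ring N s) (\<lambda>c. temp_const (\<kappa> c)) (temp_bornology N s) (mcoeff ` S)
     = mcoeff ` closed_hull s S"
proof -
  have img: "\<exists>D. Y = mcoeff ` D" for Y :: "(nat multiset \<Rightarrow> 'b) set"
    by (rule exI[of _ "Mps ` Y"]) (simp add: image_image)
  have bij: "bij (mcoeff :: 'b mps \<Rightarrow> _)"
    by (metis bijI' mcoeff_Mps mcoeff_inverse)
  have sub: "mcoeff ` S \<subseteq> mcoeff ` D \<longleftrightarrow> S \<subseteq> D" for D :: "'b mps set"
    using bij by (simp add: bij_is_inj inj_image_subset_iff)
  have "{Y. mackey_closed v (temp_ring N s) (\<lambda>c. temp_const (\<kappa> c)) (temp_bornology N s) Y \<and> mcoeff ` S \<subseteq> Y}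
     = image mcoeff ` {C. closed_set s C \<and> S \<subseteq> C}" (is "?L = ?R")
  proof (intro equalityI subsetI)
    fix Y assume "Y \<in> ?L"
    moreover obtain D where "Y = mcoeff ` D" using img by blast
    ultimately show "Y \<in> ?R" by (simp add: mackey_closed_iff sub)
  next
    fix Y assume "Y \<in> ?R"
    then show "Y \<in> ?L" using mackey_closed_iff sub by auto
  qed
  then show ?thesis
    unfolding mackey_closure_def closed_hull_def
    by (simp add: bij_image_INT[OF bij, where B = id, simplified])
qed

lemma closed_hull_minimal: "closed_set s C \<Longrightarrow> S \<subseteq> C \<Longrightarrow> closed_hull s S \<subseteq> C"
  unfolding closed_hull_def by blast

lemma closed_hull_superset: "S \<subseteq> closed_hull s S"
  unfolding closed_hull_def by blast

lemma closed_set_tempered: "closed_set s (tempered s)"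
  unfolding closed_set_def by blast

lemma closed_hull_closed:
  assumes "S \<subseteq> tempered s"
  shows "closed_set s (closed_hull s S)"
proof -
  have "closed_hull s S \<subseteq> tempered s"
    using closed_hull_minimal[OF closed_set_tempered assms] .
  moreover have "l \<in> closed_hull s S"
    if "\<forall>n. u n \<in> closed_hull s S" "l \<in> tempered s" "mackey s u l" for u l
  proof -
    have "l \<in> C" if "closed_set s C" "S \<subseteq> C" for C
      by (rule closed_setD[OF that(1) _ \<open>l \<in> tempered s\<close> \<open>mackey s u l\<close>])
         (use that \<open>\<forall>n. u n \<in> closed_hull s S\<close> in \<open>auto simp: closed_hull_def\<close>)
    then show ?thesis by (simp add: closed_hull_def)
  qed
  ultimately show ?thesis unfolding closed_set_def by blast
qed

text \<open>Mackey continuity in the form in which it is used: to show that a closed hull inherits a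
  property, the elements with this property are exhibited as such a preimage.\<close>

lemma closed_set_vimage:
  assumes "closed_set s' C"
    and "\<And>f. f \<in> tempered s \<Longrightarrow> h f \<in> tempered s'"
    and "\<And>u l. (\<And>n. u n \<in> tempered s) \<Longrightarrow> l \<in> tempered s \<Longrightarrow> mackey s u l \<Longrightarrow> mackey s' (\<lambda>n. h (u n)) (h l)"
  shows "closed_set s {f \<in> tempered s. h f \<in> C}"
  unfolding closed_set_def
proof (intro conjI allI impI)
  fix u l assume *: "(\<forall>n. u n \<in> {f \<in> tempered s. h f \<in> C}) \<and> l \<in> tempered s \<and> mackey s u l"
  then have "mackey s' (\<lambda>n. h (u n)) (h l)" using assms(3)[of u l] by simp
  with * have "h l \<in> C"
    using closed_setD[OF assms(1), where u = "\<lambda>n. h (u n)"] assms(2) by blast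
  then show "l \<in> {f \<in> tempered s. h f \<in> C}" using * by simp
qed auto

lemma mackey_add: "mackey s u l \<Longrightarrow> mackey s (\<lambda>n. u n + g) (l + g)"
  by (simp add: mackey_def)

lemma mackey_mult:
  assumes "mackey s u l" "g \<in> tempered s"
  shows "mackey s (\<lambda>n. g * u n) (g * l)"
proof -
  obtain n C c where c: "(\<lambda>n. v (c n)) \<longlonglongrightarrow> 0"
    and u: "\<And>m. \<exists>b\<in>growth s n C. u m - l = mconst (\<kappa> (c m)) * b"
    using assms(1) unfolding mackey_def by blast
  obtain n' C' where g: "g \<in> growth s n' C'"
    using assms(2) by (auto simp: tempered_def)
  have "\<exists>b\<in>growth s (n' + n) (C' * C). g * u m - g * l = mconst (\<kappa> (c m)) * b" for m
  proof -
    obtain b where "b \<in> growth s n C" "u m - l = mconst (\<kappa> (c m)) * b" using u by blast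
    then have "g * b \<in> growth s (n' + n) (C' * C)" "g * u m - g * l = mconst (\<kappa> (c m)) * (g * b)"
      using growth_mult[OF g] by (auto simp: mult.left_commute simp flip: right_diff_distrib)
    then show ?thesis by blast
  qed
  then show ?thesis unfolding mackey_def using c by blast
qed

definition series_ideal :: "nat \<Rightarrow> 'b mps set \<Rightarrow> bool" where
  "series_ideal s I \<longleftrightarrow> I \<subseteq> tempered s \<and> 0 \<in> I \<and> (\<forall>f\<in>I. \<forall>g\<in>I. f + g \<in> I) \<and>
     (\<forall>f\<in>I. \<forall>g\<in>tempered s. g * f \<in> I)"

text \<open>Elements of the hull need not be limits of sequences in \<open>I\<close>, so minimality
  is used instead: for fixed \<open>g\<close> the series \<open>f\<close> with \<open>g * f\<close>
  in the hull form a closed set containing \<open>I\<close>. Addition takes two passes, first with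
  one summand in \<open>I\<close>, then, by symmetry, with both summands in the hull.\<close>

lemma series_ideal_closed_hull:
  assumes "series_ideal s I"
  shows "series_ideal s (closed_hull s I)"
proof -
  have I: "I \<subseteq> tempered s" using assms by (simp add: series_ideal_def)
  note cl = closed_hull_closed[OF I]
  have H: "closed_hull s I \<subseteq> tempered s" using cl by (simp add: closed_set_def)
  have mult: "g * f \<in> closed_hull s I" if "g \<in> tempered s" "f \<in> closed_hull s I" for f g
  proof -
    have "closed_set s {f \<in> tempered s. g * f \<in> closed_hull s I}"
      by (rule closed_set_vimage[OF cl]) (auto intro: tempered_mult mackey_mult that)
    moreover have "I \<subseteq> {f \<in> tempered s. g * f \<in> closed_hull s I}"
      using assms that closed_hull_superset[of I s] by (auto simp: series_ideal_def)
    ultimately show ?thesis using closed_hull_minimal that by blast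
  qed
  have add: "f + g \<in> closed_hull s I"
    if g: "g \<in> tempered s" and *: "\<And>f. f \<in> I \<Longrightarrow> f + g \<in> closed_hull s I" and f: "f \<in> closed_hull s I" for f g
  proof -
    have "closed_set s {f \<in> tempered s. f + g \<in> closed_hull s I}"
      by (rule closed_set_vimage[OF cl]) (auto intro: tempered_add mackey_add g)
    moreover have "I \<subseteq> {f \<in> tempered s. f + g \<in> closed_hull s I}"
      using * I by auto
    ultimately show ?thesis using closed_hull_minimal f by blast
  qed
  have add1: "f + g \<in> closed_hull s I" if g: "g \<in> I" and f: "f \<in> closed_hull s I" for f g
  proof (rule add[OF _ _ f])
    show "g \<in> tempered s" using g I by blast
    show "f' + g \<in> closed_hull s I" if "f' \<in> I" for f'
      using assms that g closed_hull_superset[of I s] unfolding series_ideal_def by blast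
  qed
  have add2: "f + g \<in> closed_hull s I" if g: "g \<in> closed_hull s I" and f: "f \<in> closed_hull s I" for f g
  proof (rule add[OF _ _ f])
    show "g \<in> tempered s" using g H by blast
    show "f' + g \<in> closed_hull s I" if "f' \<in> I" for f'
      using add1[OF that g] by (simp add: add.commute)
  qed
  have "0 \<in> closed_hull s I"
    using assms closed_hull_superset[of I s] unfolding series_ideal_def by blast
  then show ?thesis
    unfolding series_ideal_def using mult add2 H by blast
qed

lemma series_ideal_uminus:
  assumes "series_ideal s I" "f \<in> I"
  shows "- f \<in> I"
proof -
  have "- 1 * f \<in> I"
    using assms tempered_uminus[OF tempered_1] unfolding series_ideal_def by blast
  then show ?thesis by simp
qed

lemma series_ideal_iff: "ideal (mcoeff ` I) (temp_ring N s) \<longleftrightarrow> series_ideal s I"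
proof
  assume "ideal (mcoeff ` I) (temp_ring N s)"
  then interpret ideal "mcoeff ` I" "temp_ring N s" .
  have mem: "mcoeff f \<in> mcoeff ` D \<longleftrightarrow> f \<in> D" for f :: "'b mps" and D
    by (auto simp: mcoeff_inject)
  show "series_ideal s I"
    unfolding series_ideal_def
  proof (intro conjI ballI subsetI)
    show "f \<in> tempered s" if "f \<in> I" for f
      using a_subset that by (auto simp: temp_ring_simps mem mcoeff_inject)
    show "0 \<in> I" using additive_subgroup.zero_closed[OF is_additive_subgroup] unfolding temp_ring_simps mem .
    show "f + g \<in> I" if "f \<in> I" "g \<in> I" for f g
      using additive_subgroup.a_closed[OF is_additive_subgroup, of "mcoeff f" "mcoeff g"] that unfolding temp_ring_simps mem by blast
    show "g * f \<in> I" if "f \<in> I" "g \<in> tempered s" for f g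
      using I_l_closed[of "mcoeff f" "mcoeff g"] that unfolding temp_ring_simps mem by blast
  qed
next
  assume I: "series_ideal s I"
  interpret T: cring "temp_ring N s" by (rule cring_temp_ring)
  have sub: "I \<subseteq> tempered s" using I by (simp add: series_ideal_def)
  show "ideal (mcoeff ` I) (temp_ring N s)"
  proof (rule idealI)
    show "subgroup (mcoeff ` I) (add_monoid (temp_ring N s))"
    proof (rule T.add.subgroupI)
      show "mcoeff ` I \<noteq> {}" "mcoeff ` I \<subseteq> carrier (temp_ring N s)"
        using I by (auto simp: series_ideal_def temp_ring_simps)
      fix x assume "x \<in> mcoeff ` I"
      then obtain f where f: "f \<in> I" "x = mcoeff f" by blast
      then have "\<ominus>\<^bsub>temp_ring N s\<^esub> x = mcoeff (- f)"
        using sub by (intro T.minus_equality) (auto simp: temp_ring_simps tempered_uminus)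
      then show "\<ominus>\<^bsub>temp_ring N s\<^esub> x \<in> mcoeff ` I"
        using series_ideal_uminus[OF I f(1)] by simp
    next
      fix x y assume "x \<in> mcoeff ` I" "y \<in> mcoeff ` I"
      then show "x \<oplus>\<^bsub>temp_ring N s\<^esub> y \<in> mcoeff ` I"
        using I by (auto simp: temp_ring_simps series_ideal_def)
    qed
  qed (use I in \<open>auto simp: temp_ring_simps series_ideal_def mult.commute intro: T.ring_axioms\<close>)
qed

text \<open>The values of scalars are discrete in the intended case, so the rate
  \<open>1 / (m + 1)\<close> can be met only up to the factor \<open>v \<omega>\<close>; the first
  power of \<open>\<omega>\<close> that falls below it does this.\<close>

lemma scalar_of_size:
  obtains c where "v c \<le> 1 / real (m + 1)" "v \<omega> / real (m + 1) \<le> v c"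
proof -
  define P where "P k \<longleftrightarrow> v \<omega> ^ k \<le> 1 / real (m + 1)" for k
  obtain k0 where "v \<omega> ^ k0 < 1 / real (m + 1)"
    using real_arch_pow_inv[of "1 / real (m + 1)" "v \<omega>"] v_\<omega>_less_1 by auto
  then have "P k0" by (simp add: P_def)
  then have k: "P (LEAST k. P k)" by (rule LeastI)
  define k where "k = (LEAST k. P k)"
  have "v \<omega> / real (m + 1) \<le> v \<omega> ^ k"
  proof (cases k)
    case 0
    have "v \<omega> / real (m + 1) \<le> v \<omega> / 1"
      using v_pos_\<omega> by (intro divide_left_mono) auto
    then show ?thesis using 0 v_\<omega>_less_1 by simp
  next
    case (Suc j)
    then have "\<not> P j" using not_less_Least[of j P] by (simp add: k_def)
    then have "v \<omega> * (1 / real (m + 1)) \<le> v \<omega> * v \<omega> ^ j"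
      using v_pos_\<omega> by (intro mult_left_mono) (auto simp: P_def)
    then show ?thesis by (simp add: Suc)
  qed
  moreover have "v \<omega> ^ k \<le> 1 / real (m + 1)" using k by (simp add: k_def P_def)
  ultimately show ?thesis using that[of "\<omega> ^ k"] by (simp add: v_power)
qed

definition truncate :: "nat \<Rightarrow> nat \<Rightarrow> 'b mps \<Rightarrow> 'b mps" where
  "truncate s m f = (\<Sum>J\<in>small_indices s m. mmonom (mcoeff f J) J)"

lemma mcoeff_truncate:
  "mcoeff (truncate s m f) M = (if M \<in> small_indices s m then mcoeff f M else 0)"
  by (simp add: truncate_def mcoeff_sum mcoeff_mmonom)

text \<open>The remainder involves only multi-indices with \<open>m \<le> size M\<close>. Dividing
  it by a scalar of size about \<open>1 / (m + 1)\<close> therefore costs at most the factor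
  \<open>(size M + 1) / v \<omega>\<close>, that is, one more exponent of growth. So truncations
  converge bornologically and not merely coefficient by coefficient.\<close>

lemma mackey_truncate:
  assumes "f \<in> tempered s"
  shows "mackey s (\<lambda>m. truncate s m f) f"
proof -
  obtain n C where f: "f \<in> growth s n C" using assms by (auto simp: tempered_def)
  have C: "0 \<le> C" using growth_nonneg f by auto
  obtain c where c: "\<And>m. v (c m) \<le> 1 / real (m + 1)" "\<And>m. v \<omega> / real (m + 1) \<le> v (c m)"
  proof -
    have "\<exists>c. v c \<le> 1 / real (m + 1) \<and> v \<omega> / real (m + 1) \<le> v c" for m
      by (rule scalar_of_size[of m]) blast
    then show ?thesis using that by metis
  qed
  have pos: "0 < v (c m)" for m
    using c(2)[of m] v_pos_\<omega> by (auto intro: less_le_trans[rotated])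
  have "\<exists>b\<in>growth s (Suc n) (C / v \<omega>). truncate s m f - f = mconst (\<kappa> (c m)) * b" for m
  proof
    let ?b = "mconst (\<kappa> (inverse (c m))) * (truncate s m f - f)"
    have "\<kappa> (c m) * \<kappa> (inverse (c m)) = 1"
      using pos[of m] v_eq_0[of "c m"] by (simp add: \<kappa>_1 flip: \<kappa>_mult)
    then show "truncate s m f - f = mconst (\<kappa> (c m)) * ?b"
      by (simp add: mult.assoc[symmetric] mmonom_mult mconst_1)
    have "N (mcoeff ?b M) \<le> C / v \<omega> * real (size M + 1) ^ Suc n" for M
    proof (cases "M \<in> multi_indices s \<and> m \<le> size M")
      case True
      then have "N (mcoeff ?b M) = inverse (v (c m)) * N (mcoeff f M)"
        by (simp add: mcoeff_truncate small_indices_def N_scale v_inverse N_minus)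
      also have "\<dots> \<le> (real (size M + 1) / v \<omega>) * (C * real (size M + 1) ^ n)"
      proof (intro mult_mono growthD(2)[OF f])
        have "inverse (v (c m)) \<le> inverse (v \<omega> / real (m + 1))"
          using c(2)[of m] v_pos_\<omega> by (intro le_imp_inverse_le) auto
        also have "\<dots> = real (m + 1) / v \<omega>" by simp
        also have "\<dots> \<le> real (size M + 1) / v \<omega>"
          using True v_pos_\<omega> by (intro divide_right_mono) auto
        finally show "inverse (v (c m)) \<le> real (size M + 1) / v \<omega>" .
      qed (use v_pos_\<omega> N_nonneg in auto)
      finally show ?thesis by (simp add: mult.commute mult.left_commute)
    next
      case False
      then have "mcoeff ?b M = 0"
        using growthD(1)[OF f] by (auto simp: mcoeff_truncate small_indices_def)
      then show ?thesis using C v_pos_\<omega> by simp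
    qed
    moreover have "mcoeff ?b M = 0" if "M \<notin> multi_indices s" for M
      using that growthD(1)[OF f] by (simp add: mcoeff_truncate small_indices_def)
    ultimately show "?b \<in> growth s (Suc n) (C / v \<omega>)"
      unfolding growth_def by blast
  qed
  moreover have "(\<lambda>m. v (c m)) \<longlonglongrightarrow> 0"
    by (rule tendsto_sandwich[OF _ _ tendsto_const LIMSEQ_inverse_real_of_nat])
       (use c(1) v_nonneg in \<open>auto simp: inverse_eq_divide add.commute\<close>)
  ultimately show ?thesis unfolding mackey_def by blast
qed

end

section \<open>Tubes and uniqueness of morphisms\<close>

context banach_algebra
begin

definition relations :: "'b list \<Rightarrow> 'b mps set" where
  "relations fs = {mvar i - mconst (fs ! i) | i. i < length fs}"

definition kernel :: "'b list \<Rightarrow> 'b mps set" where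
  "kernel fs = closed_hull (length fs)
     (Mps ` (Idl\<^bsub>temp_ring N (length fs)\<^esub> (mcoeff ` relations fs)))"

definition tube :: "'b list \<Rightarrow> (nat multiset \<Rightarrow> 'b) set ring" where
  "tube fs = temp_ring N (length fs) Quot (mcoeff ` kernel fs)"

definition tube_class :: "'b list \<Rightarrow> 'b mps \<Rightarrow> (nat multiset \<Rightarrow> 'b) set" where
  "tube_class fs f = mcoeff ` kernel fs +>\<^bsub>temp_ring N (length fs)\<^esub> mcoeff f"

definition tube_bounded :: "'b list \<Rightarrow> (nat multiset \<Rightarrow> 'b) set set set" where
  "tube_bounded fs = quotient_bornology (temp_ring N (length fs)) (mcoeff ` kernel fs)
     (temp_bornology N (length fs))"

lemma relations_tempered: "relations fs \<subseteq> tempered (length fs)"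
  by (auto simp: relations_def intro!: tempered_diff tempered_mmonom)

lemma relations_carrier: "mcoeff ` relations fs \<subseteq> carrier (temp_ring N (length fs))"
  using relations_tempered by (auto simp: temp_ring_simps)

lemma Idl_relations_ideal:
  "series_ideal (length fs) (Mps ` (Idl\<^bsub>temp_ring N (length fs)\<^esub> (mcoeff ` relations fs)))"
proof -
  interpret T: cring "temp_ring N (length fs)" by (rule cring_temp_ring)
  show ?thesis
    unfolding series_ideal_iff[symmetric]
    using T.genideal_ideal[OF relations_carrier] by (simp add: image_image)
qed

lemma Idl_relations_tempered:
  "Mps ` (Idl\<^bsub>temp_ring N (length fs)\<^esub> (mcoeff ` relations fs)) \<subseteq> tempered (length fs)"
  using Idl_relations_ideal by (simp add: series_ideal_def)

lemma kernel_eq: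
  "mackey_closure v (temp_ring N (length fs)) (\<lambda>c. temp_const (\<kappa> c)) (temp_bornology N (length fs))
     (Idl\<^bsub>temp_ring N (length fs)\<^esub>
        {temp_var i \<ominus>\<^bsub>temp_ring N (length fs)\<^esub> temp_const (fs ! i) | i. i < length fs})
   = mcoeff ` kernel fs"
proof -
  have "{temp_var i \<ominus>\<^bsub>temp_ring N (length fs)\<^esub> temp_const (fs ! i) | i. i < length fs}
     = mcoeff ` relations fs"
    unfolding relations_def
    by (auto simp: temp_var_eq temp_const_eq temp_ring_minus tempered_mmonom image_iff)
       (metis tempered_mmonom multi_indices_single multi_indices_empty temp_ring_minus)+
  then show ?thesis
    unfolding kernel_def by (simp add: image_image flip: mackey_closure_eq)
qed

lemma kernel_ideal: "series_ideal (length fs) (kernel fs)"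
  unfolding kernel_def by (rule series_ideal_closed_hull[OF Idl_relations_ideal])

lemma kernel_closed: "closed_set (length fs) (kernel fs)"
  unfolding kernel_def by (rule closed_hull_closed[OF Idl_relations_tempered])

lemma relations_kernel: "relations fs \<subseteq> kernel fs"
proof -
  interpret T: cring "temp_ring N (length fs)" by (rule cring_temp_ring)
  have "Mps ` (mcoeff ` relations fs) \<subseteq> Mps ` (Idl\<^bsub>temp_ring N (length fs)\<^esub> (mcoeff ` relations fs))"
    by (intro image_mono T.genideal_self relations_carrier)
  then show ?thesis
    unfolding kernel_def using closed_hull_superset by (fastforce simp: image_image)
qed

text \<open>This is the universal property of the quotient in complete bornological algebras: a
  closed ideal is tested on the relations alone, never on elements of the closure.\<close>

lemma kernel_minimal:
  assumes "series_ideal (length fs) I" "closed_set (length fs) I" "relations fs \<subseteq> I"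
  shows "kernel fs \<subseteq> I"
proof -
  interpret T: cring "temp_ring N (length fs)" by (rule cring_temp_ring)
  have "Idl\<^bsub>temp_ring N (length fs)\<^esub> (mcoeff ` relations fs) \<subseteq> mcoeff ` I"
    using assms by (intro T.genideal_minimal) (auto simp: series_ideal_iff)
  then have "Mps ` (Idl\<^bsub>temp_ring N (length fs)\<^esub> (mcoeff ` relations fs)) \<subseteq> I"
    by auto
  then show ?thesis
    unfolding kernel_def by (rule closed_hull_minimal[OF assms(2)])
qed

lemma ideal_kernel: "ideal (mcoeff ` kernel fs) (temp_ring N (length fs))"
  unfolding series_ideal_iff by (rule kernel_ideal)

lemma tube_class_eq_iff:
  assumes "f \<in> tempered (length fs)" "g \<in> tempered (length fs)"
  shows "tube_class fs f = tube_class fs g \<longleftrightarrow> f - g \<in> kernel fs"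
proof -
  interpret T: cring "temp_ring N (length fs)" by (rule cring_temp_ring)
  have "mcoeff f \<in> carrier (temp_ring N (length fs))" "mcoeff g \<in> carrier (temp_ring N (length fs))"
    using assms by (auto simp: temp_ring_simps)
  from T.quotient_eq_iff_same_a_r_cos[OF ideal_kernel this]
  show ?thesis
    unfolding tube_class_def temp_ring_minus[OF assms] by (auto simp: mcoeff_inject)
qed

lemma tube_class_eq_relation:
  assumes "i < length fs"
  shows "tube_class fs (mvar i) = tube_class fs (mconst (fs ! i))"
  using assms relations_kernel[of fs]
  by (subst tube_class_eq_iff) (auto simp: relations_def intro: tempered_mmonom)

lemma carrier_tube: "carrier (tube fs) = tube_class fs ` tempered (length fs)"
  by (auto simp: tube_def FactRing_def A_RCOSETS_def' temp_ring_simps tube_class_def)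

lemma tube_simps:
  assumes "f \<in> tempered (length fs)" "g \<in> tempered (length fs)"
  shows "tube_class fs f \<otimes>\<^bsub>tube fs\<^esub> tube_class fs g = tube_class fs (f * g)"
    and "tube_class fs f \<oplus>\<^bsub>tube fs\<^esub> tube_class fs g = tube_class fs (f + g)"
proof -
  interpret T: ring_hom_ring "temp_ring N (length fs)" "tube fs"
    "(+>\<^bsub>temp_ring N (length fs)\<^esub>) (mcoeff ` kernel fs)"
    unfolding tube_def by (rule ideal.rcos_ring_hom_ring[OF ideal_kernel])
  have c: "mcoeff f \<in> carrier (temp_ring N (length fs))" "mcoeff g \<in> carrier (temp_ring N (length fs))"
    using assms by (auto simp: temp_ring_simps)
  show "tube_class fs f \<otimes>\<^bsub>tube fs\<^esub> tube_class fs g = tube_class fs (f * g)"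
    "tube_class fs f \<oplus>\<^bsub>tube fs\<^esub> tube_class fs g = tube_class fs (f + g)"
    using T.hom_mult[OF c] T.hom_add[OF c] by (simp_all add: tube_class_def temp_ring_simps)
qed

lemma tube_one: "\<one>\<^bsub>tube fs\<^esub> = tube_class fs 1"
  by (simp add: tube_def FactRing_def tube_class_def temp_ring_simps)

text \<open>\<open>quotient_bornology\<close> lists exact images of bounded sets. A subset of the
  image of a \<open>growth\<close> set is the exact image of the part of that set lying over it, so
  inclusion suffices.\<close>

lemma tube_bounded_iff:
  "B \<in> tube_bounded fs \<longleftrightarrow> (\<exists>n C. B \<subseteq> tube_class fs ` growth (length fs) n C)"
proof
  assume "B \<in> tube_bounded fs"
  then obtain B' where B': "B' \<in> temp_bornology N (length fs)"
    and B: "B = (\<lambda>x. mcoeff ` kernel fs +>\<^bsub>temp_ring N (length fs)\<^esub> x) ` B'"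
    unfolding tube_bounded_def quotient_bornology_def by blast
  obtain n C where "B' \<subseteq> mcoeff ` growth (length fs) n C"
    using B' unfolding temp_bornology_iff by blast
  then have "B \<subseteq> tube_class fs ` growth (length fs) n C"
    unfolding B tube_class_def by blast
  then show "\<exists>n C. B \<subseteq> tube_class fs ` growth (length fs) n C" by blast
next
  assume "\<exists>n C. B \<subseteq> tube_class fs ` growth (length fs) n C"
  then obtain n C where B: "B \<subseteq> tube_class fs ` growth (length fs) n C" by blast
  define B' where "B' = {x \<in> mcoeff ` growth (length fs) n C.
     mcoeff ` kernel fs +>\<^bsub>temp_ring N (length fs)\<^esub> x \<in> B}"
  have "B' \<in> temp_bornology N (length fs)"
    unfolding temp_bornology_iff B'_def by blast
  moreover have "B = (\<lambda>x. mcoeff ` kernel fs +>\<^bsub>temp_ring N (length fs)\<^esub> x) ` B'"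
    using B unfolding B'_def tube_class_def by blast
  ultimately show "B \<in> tube_bounded fs"
    unfolding tube_bounded_def quotient_bornology_def by blast
qed

lemma growth_tempered: "f \<in> growth s n C \<Longrightarrow> f \<in> tempered s"
  unfolding tempered_def by blast

text \<open>Two morphisms agree on polynomials, since each variable is congruent to a scalar; the
  target is separated because the kernel is Mackey closed.\<close>

lemma born_alg_hom_unique:
  assumes h: "\<And>i. i < 2 \<Longrightarrow>
      born_alg_hom (tube fs) (tube_bounded fs) (\<lambda>b. tube_class fs (mconst b))
        (tube gs) (tube_bounded gs) (\<lambda>b. tube_class gs (mconst b)) (h i)"
    and x: "x \<in> carrier (tube fs)"
  shows "h 0 x = h (1::nat) x"
proof -
  let ?s = "length fs"
  have hom: "h i \<in> ring_hom (tube fs) (tube gs)"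
    and scal: "h i (tube_class fs (mconst b)) = tube_class gs (mconst b)"
    and bdd: "B \<in> tube_bounded fs \<Longrightarrow> h i ` B \<in> tube_bounded gs" if "i < 2" for i b B
    using h[OF that] unfolding born_alg_hom_def by blast+
  have car: "tube_class fs f \<in> carrier (tube fs)" if "f \<in> tempered ?s" for f
    using that carrier_tube by blast
  have h_add: "h i (tube_class fs (f + g)) = h i (tube_class fs f) \<oplus>\<^bsub>tube gs\<^esub> h i (tube_class fs g)"
    and h_mult: "h i (tube_class fs (f * g)) = h i (tube_class fs f) \<otimes>\<^bsub>tube gs\<^esub> h i (tube_class fs g)"
    if "i < 2" "f \<in> tempered ?s" "g \<in> tempered ?s" for i f g
    using ring_hom_add[OF hom[OF that(1)] car[OF that(2)] car[OF that(3)]]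
      ring_hom_mult[OF hom[OF that(1)] car[OF that(2)] car[OF that(3)]] tube_simps[OF that(2,3)]
    by simp_all
  \<comment> \<open>The equalizer \<open>E\<close> is used only for polynomials. The passage to the
    limit takes place in the target, where the boundedness of both maps controls the
    remainders.\<close>
  define E where "E = {f \<in> tempered ?s. h 0 (tube_class fs f) = h 1 (tube_class fs f)}"
  have E_add: "f + g \<in> E" and E_mult: "f * g \<in> E" if "f \<in> E" "g \<in> E" for f g
    using that h_add h_mult by (auto simp: E_def tempered_add tempered_mult)
  have E_const: "mconst b \<in> E" for b
    using scal by (auto simp: E_def tempered_mmonom)
  have E_var: "mvar i \<in> E" if "i < ?s" for i
    using that E_const[of "fs ! i"] by (auto simp: E_def tempered_mmonom tube_class_eq_relation)
  have E_mmonom: "mmonom b J \<in> E" if "J \<in> multi_indices ?s" for b J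
    using that
  proof (induction J)
    case empty
    show ?case by (rule E_const)
  next
    case (add i J)
    then have "J \<in> multi_indices ?s" "i < ?s" by (auto simp: multi_indices_def)
    then have "mmonom b J * mvar i \<in> E" by (intro E_mult E_var add)
    then show ?case by (simp add: mmonom_mult)
  qed
  have E_sum: "sum g S \<in> E" if "\<And>J. J \<in> S \<Longrightarrow> g J \<in> E" for g and S :: "nat multiset set"
    using that
    by (induction S rule: infinite_finite_induct) (use E_const[of 0] E_add in \<open>auto simp: mmonom_0\<close>)
  have E_trunc: "truncate ?s m f \<in> E" for m f
    unfolding truncate_def by (rule E_sum, rule E_mmonom) (simp add: small_indices_def)
  obtain f where f: "f \<in> tempered ?s" and xf: "x = tube_class fs f"
    using x carrier_tube by blast
  obtain n C c where c: "(\<lambda>n. v (c n)) \<longlonglongrightarrow> 0"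
    and b: "\<And>m. \<exists>b\<in>growth ?s n C. truncate ?s m f - f = mconst (\<kappa> (c m)) * b"
    using mackey_truncate[OF f] unfolding mackey_def by blast
  then obtain b where b: "\<And>m. b m \<in> growth ?s n C"
    and trunc: "\<And>m. truncate ?s m f - f = mconst (\<kappa> (c m)) * b m" by metis
  have "tube_class fs ` growth ?s n C \<in> tube_bounded fs"
    unfolding tube_bounded_iff by blast
  then have "h i ` tube_class fs ` growth ?s n C \<in> tube_bounded gs" if "i < 2" for i
    using bdd that by blast
  then have "\<exists>k D. h i ` tube_class fs ` growth ?s n C \<subseteq> tube_class gs ` growth (length gs) k D"
    if "i < 2" for i
    using that unfolding tube_bounded_iff by blast
  then obtain k D where kD: "\<And>i. i < 2 \<Longrightarrow>
      h i ` tube_class fs ` growth ?s n C \<subseteq> tube_class gs ` growth (length gs) (k i) (D i)"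
    by metis
  \<comment> \<open>For each of the two maps, boundedness puts the images of all remainders
    \<open>b m\<close> into one \<open>growth\<close> set, so their lifts can be chosen with a bound
    independent of \<open>m\<close>.\<close>
  have "\<exists>g\<in>growth (length gs) (k i) (D i). h i (tube_class fs (b m)) = tube_class gs g" if "i < 2" for i m
    using kD[OF that] b[of m] by blast
  then obtain g where g: "\<And>i m. i < 2 \<Longrightarrow> g i m \<in> growth (length gs) (k i) (D i)"
    and hg: "\<And>i m. i < 2 \<Longrightarrow> h i (tube_class fs (b m)) = tube_class gs (g i m)"
    by metis
  have gt: "g i m \<in> tempered (length gs)" if "i < 2" for i m
    using g[OF that] growth_tempered by blast
  have "\<exists>d\<in>tempered (length gs). h i (tube_class fs f) = tube_class gs d" if "i < 2" for i
    using ring_hom_closed[OF hom[OF that] car[OF f]] unfolding carrier_tube by blast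
  then obtain d where d: "\<And>i. i < 2 \<Longrightarrow> d i \<in> tempered (length gs)"
    and hd: "\<And>i. i < 2 \<Longrightarrow> h i (tube_class fs f) = tube_class gs (d i)"
    by metis
  have bt: "b m \<in> tempered ?s" for m using b growth_tempered by blast
  have ct: "mconst r \<in> tempered s" for r s by (simp add: tempered_mmonom)
  have trunc_image: "h i (tube_class fs (truncate ?s m f))
      = tube_class gs (mconst (\<kappa> (c m)) * g i m + d i)" if i: "i < 2" for i m
  proof -
    have "truncate ?s m f = mconst (\<kappa> (c m)) * b m + f"
      using trunc[of m] by (simp add: algebra_simps)
    then show ?thesis
      using h_add[OF i tempered_mult[OF ct bt] f] h_mult[OF i ct bt] scal[OF i] hg[OF i] hd[OF i]
        tube_simps(1)[OF ct gt[OF i]] tube_simps(2)[OF tempered_mult[OF ct gt[OF i]] d[OF i]]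
      by simp
  qed
  have "(mconst (\<kappa> (c m)) * g 0 m + d 0) - (mconst (\<kappa> (c m)) * g 1 m + d 1) \<in> kernel gs" for m
  proof -
    have "tube_class gs (mconst (\<kappa> (c m)) * g 0 m + d 0) = tube_class gs (mconst (\<kappa> (c m)) * g 1 m + d 1)"
      using E_trunc[of m f] trunc_image[of 0 m] trunc_image[of 1 m] by (simp add: E_def)
    then show ?thesis
      by (subst (asm) tube_class_eq_iff) (auto intro!: tempered_add tempered_mult ct gt d)
  qed
  then have K: "(d 0 - d 1) + mconst (\<kappa> (c m)) * (g 0 m - g 1 m) \<in> kernel gs" for m
    by (simp add: algebra_simps)
  \<comment> \<open>The difference of the two images deviates from elements of the closed kernel by
    null scalars times a bounded sequence, hence is a Mackey limit of such elements.\<close>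
  have "mackey (length gs) (\<lambda>m. (d 0 - d 1) + mconst (\<kappa> (c m)) * (g 0 m - g 1 m)) (d 0 - d 1)"
    unfolding mackey_def
  proof (intro exI conjI allI)
    show "(\<lambda>n. v (c n)) \<longlonglongrightarrow> 0" by (rule c)
    show "\<exists>b\<in>growth (length gs) (max (k 0) (k 1)) (max (D 0) (D 1)).
        (d 0 - d 1) + mconst (\<kappa> (c m)) * (g 0 m - g 1 m) - (d 0 - d 1) = mconst (\<kappa> (c m)) * b" for m
      by (rule bexI[of _ "g 0 m - g 1 m"]) (auto intro!: growth_diff g)
  qed
  from closed_setD[OF kernel_closed K _ this] have "d 0 - d 1 \<in> kernel gs"
    by (simp add: tempered_diff d)
  then have "tube_class gs (d 0) = tube_class gs (d 1)"
    by (simp add: tube_class_eq_iff d)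
  then show ?thesis using hd[of 0] hd[of 1] by (simp add: xf)
qed

end

section \<open>Substitution into tempered power series\<close>

context banach_algebra
begin

section \<open>Limits of coefficients, and geometric decay against polynomial growth\<close>

definition N_limit :: "(nat \<Rightarrow> 'b) \<Rightarrow> 'b \<Rightarrow> bool" where
  "N_limit u l \<longleftrightarrow> (\<lambda>n. N (u n - l)) \<longlonglongrightarrow> 0"

lemma N_limitI:
  assumes "\<And>n. N (u n - l) \<le> e n" "e \<longlonglongrightarrow> 0"
  shows "N_limit u l"
  unfolding N_limit_def
  by (rule tendsto_sandwich[OF _ _ tendsto_const assms(2)]) (auto simp: N_nonneg assms(1))

lemma N_limit_const: "N_limit (\<lambda>n. l) l"
  by (simp add: N_limit_def)

lemma N_limit_add:
  assumes "N_limit u l" "N_limit u' l'"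
  shows "N_limit (\<lambda>n. u n + u' n) (l + l')"
proof (rule N_limitI)
  show "N (u n + u' n - (l + l')) \<le> N (u n - l) + N (u' n - l')" for n
    using N_add[of "u n - l" "u' n - l'"] N_nonneg[of "u n - l"] N_nonneg[of "u' n - l'"]
    by (simp add: algebra_simps)
  show "(\<lambda>n. N (u n - l) + N (u' n - l')) \<longlonglongrightarrow> 0"
    using tendsto_add[OF assms[unfolded N_limit_def]] by simp
qed

lemma N_limit_sum: "(\<And>i. i \<in> S \<Longrightarrow> N_limit (u i) (l i)) \<Longrightarrow> N_limit (\<lambda>n. \<Sum>i\<in>S. u i n) (sum l S)"
  by (induction S rule: infinite_finite_induct) (auto intro: N_limit_const N_limit_add)

lemma N_limit_mult:
  assumes "N_limit u l" "N_limit u' l'"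
  shows "N_limit (\<lambda>n. u n * u' n) (l * l')"
proof (rule N_limitI)
  fix n
  have "u n * u' n - l * l' = (u n - l) * (u' n - l') + ((u n - l) * l' + l * (u' n - l'))"
    by (simp add: algebra_simps)
  also have "N \<dots> \<le> max (N ((u n - l) * (u' n - l'))) (max (N ((u n - l) * l')) (N (l * (u' n - l'))))"
    by (rule order_trans[OF N_add]) (intro max.mono order_refl N_add)
  also have "\<dots> \<le> max (N (u n - l) * N (u' n - l')) (max (N (u n - l) * N l') (N l * N (u' n - l')))"
    by (intro max.mono N_mult)
  also have "\<dots> \<le> N (u n - l) * N (u' n - l') + (N (u n - l) * N l' + N l * N (u' n - l'))"
    using N_nonneg by (simp add: add_increasing add_increasing2)
  finally show "N (u n * u' n - l * l') \<le> \<dots>" .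
next
  show "(\<lambda>n. N (u n - l) * N (u' n - l') + (N (u n - l) * N l' + N l * N (u' n - l'))) \<longlonglongrightarrow> 0"
    using assms unfolding N_limit_def by (auto intro!: tendsto_eq_intros)
qed

lemma N_limit_le:
  assumes "N_limit u l" "\<And>n. N (u n) \<le> r"
  shows "N l \<le> r"
proof (rule ccontr)
  assume "\<not> N l \<le> r"
  then have "0 < N l" using N_nonneg[of "u 0"] assms(2)[of 0] by linarith
  then have "eventually (\<lambda>n. N (u n - l) < N l) sequentially"
    using assms(1) unfolding N_limit_def by (auto dest: order_tendstoD)
  then obtain n where "N (u n - l) < N l"
    by (auto simp: eventually_sequentially)
  moreover have "N l \<le> max (N (u n)) (N (u n - l))"
    using N_diff[of "u n" "u n - l"] by simp
  ultimately show False using assms(2)[of n] \<open>\<not> N l \<le> r\<close> by auto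
qed

lemma N_limit_unique:
  assumes "N_limit u l" "N_limit u' l'" "(\<lambda>n. N (u n - u' n)) \<longlonglongrightarrow> 0"
  shows "l = l'"
proof -
  have "N (l - l') \<le> N (u n - l) + N (u' n - l') + N (u n - u' n)" for n
  proof -
    have "N (l - l') = N ((u' n - l') - (u n - l) + (u n - u' n))"
      by (simp add: algebra_simps)
    also have "\<dots> \<le> max (max (N (u' n - l')) (N (u n - l))) (N (u n - u' n))"
      by (rule order_trans[OF N_add]) (intro max.mono order_refl N_diff)
    finally show ?thesis using N_nonneg by (smt (verit))
  qed
  moreover have "(\<lambda>n. N (u n - l) + N (u' n - l') + N (u n - u' n)) \<longlonglongrightarrow> 0 + 0 + 0"
    using assms unfolding N_limit_def by (intro tendsto_add)
  ultimately have "N (l - l') \<le> 0"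
    by (intro LIMSEQ_le_const) auto
  then show ?thesis using N_nonneg[of "l - l'"] N_eq_0[of "l - l'"] by simp
qed

text \<open>With \<open>\<tau>\<close> the root of \<open>v \<omega>\<close> of order
  \<open>n + 1\<close>, the sequence \<open>(t + 1) * \<tau> ^ t\<close> is bounded, and its power
  of exponent \<open>n + 1\<close> is the left side times \<open>t + 1\<close>. The factor
  \<open>1 / (t + 1)\<close> gained in this way makes partial sums converge instead of only staying
  bounded.\<close>

lemma decay_exists: "\<exists>D\<ge>0. \<forall>t. real (t + 1) ^ n * v \<omega> ^ t \<le> D / real (t + 1)"
proof -
  define \<tau> where "\<tau> = root (Suc n) (v \<omega>)"
  have \<tau>: "0 < \<tau>" "\<tau> < 1" "\<tau> ^ Suc n = v \<omega>"
    using v_pos_\<omega> v_\<omega>_less_1 by (auto simp: \<tau>_def simp del: power_Suc)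
  have "(\<lambda>t. real t * \<tau> ^ t + \<tau> ^ t) \<longlonglongrightarrow> 0 + 0"
    using \<tau> by (intro tendsto_add powser_times_n_limit_0 LIMSEQ_realpow_zero) auto
  then have "Bseq (\<lambda>t. real t * \<tau> ^ t + \<tau> ^ t)"
    by (intro convergent_imp_Bseq convergentI)
  then obtain B where B: "\<And>t. norm (real t * \<tau> ^ t + \<tau> ^ t) \<le> B"
    unfolding Bseq_def by auto
  have B': "real (t + 1) * \<tau> ^ t \<le> B" for t
    using B[of t] by (simp add: algebra_simps)
  have "real (t + 1) ^ n * v \<omega> ^ t \<le> B ^ Suc n / real (t + 1)" for t
  proof -
    have "real (t + 1) * (real (t + 1) ^ n * v \<omega> ^ t) = (real (t + 1) * \<tau> ^ t) ^ Suc n"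
    proof -
      have "(\<tau> ^ Suc n) ^ t = (\<tau> ^ t) ^ Suc n"
        by (metis power_mult mult.commute)
      then show ?thesis
        unfolding \<tau>(3)[symmetric] power_mult_distrib by simp
    qed
    also have "\<dots> \<le> B ^ Suc n"
      using B' \<tau> by (intro power_mono) auto
    finally show ?thesis by (simp add: field_simps)
  qed
  moreover have "0 \<le> B" using B'[of 0] \<tau> by simp
  ultimately show ?thesis by (intro exI[of _ "B ^ Suc n"]) auto
qed

definition decay :: "nat \<Rightarrow> real" where
  "decay n = (SOME D. 0 \<le> D \<and> (\<forall>t. real (t + 1) ^ n * v \<omega> ^ t \<le> D / real (t + 1)))"

lemma decay_nonneg: "0 \<le> decay n"
  and decay: "real (t + 1) ^ n * v \<omega> ^ t \<le> decay n / real (t + 1)"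
  using someI_ex[OF decay_exists[of n], folded decay_def] by auto

text \<open>The shape of a product of \<open>d\<close> factors, each a linear form with coefficients
  of norm at most 1 plus a constant of norm at most \<open>v \<omega>\<close>: every degree missing
  from \<open>d\<close> is paid for by one factor \<open>v \<omega>\<close>.\<close>

definition small_poly :: "nat \<Rightarrow> nat \<Rightarrow> 'b mps set" where
  "small_poly s d = {f. (\<forall>M. M \<notin> multi_indices s \<or> d < size M \<longrightarrow> mcoeff f M = 0) \<and>
     (\<forall>M. size M \<le> d \<longrightarrow> N (mcoeff f M) \<le> v \<omega> ^ (d - size M))}"

lemma small_poly_1: "1 \<in> small_poly s 0"
  by (auto simp: small_poly_def N_1)

lemma small_poly_mult:
  assumes f: "f \<in> small_poly s d" and g: "g \<in> small_poly s d'"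
  shows "f * g \<in> small_poly s (d + d')"
proof -
  have f0: "M \<notin> multi_indices s \<or> d < size M \<Longrightarrow> mcoeff f M = 0"
    and g0: "M \<notin> multi_indices s \<or> d' < size M \<Longrightarrow> mcoeff g M = 0"
    and fN: "size M \<le> d \<Longrightarrow> N (mcoeff f M) \<le> v \<omega> ^ (d - size M)"
    and gN: "size M \<le> d' \<Longrightarrow> N (mcoeff g M) \<le> v \<omega> ^ (d' - size M)" for M
    using f g by (auto simp: small_poly_def)
  have "mcoeff (f * g) M = 0" if "M \<notin> multi_indices s \<or> d + d' < size M" for M
    unfolding mcoeff_mult
  proof (intro sum.neutral ballI)
    fix p assume "p \<in> splits M"
    then obtain I J where p: "p = (I, J)" "M = I + J" by (cases p) auto
    then have "(I \<notin> multi_indices s \<or> d < size I) \<or> (J \<notin> multi_indices s \<or> d' < size J)"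
      using that by auto
    then show "(case p of (I, J) \<Rightarrow> mcoeff f I * mcoeff g J) = 0"
      using f0[of I] g0[of J] p by auto
  qed
  moreover have "N (mcoeff (f * g) M) \<le> v \<omega> ^ (d + d' - size M)" if "size M \<le> d + d'" for M
    unfolding mcoeff_mult
  proof (rule N_sum_le)
    fix p assume "p \<in> splits M"
    then obtain I J where p: "p = (I, J)" "M = I + J" by (cases p) auto
    show "N (case p of (I, J) \<Rightarrow> mcoeff f I * mcoeff g J) \<le> v \<omega> ^ (d + d' - size M)"
    proof (cases "d < size I \<or> d' < size J")
      case True
      then have "mcoeff f I = 0 \<or> mcoeff g J = 0" using f0 g0 by blast
      then show ?thesis using v_pos_\<omega> by (auto simp: p)
    next
      case False
      have "N (mcoeff f I * mcoeff g J) \<le> N (mcoeff f I) * N (mcoeff g J)" by (rule N_mult)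
      also have "\<dots> \<le> v \<omega> ^ (d - size I) * v \<omega> ^ (d' - size J)"
        using False v_pos_\<omega> by (intro mult_mono fN gN) (auto simp: N_nonneg)
      also have "\<dots> = v \<omega> ^ (d + d' - size M)"
        using False by (simp add: p flip: power_add)
      finally show ?thesis by (simp add: p)
    qed
  qed (use v_pos_\<omega> in auto)
  ultimately show ?thesis unfolding small_poly_def by blast
qed

end

text \<open>\<open>q i\<close> is the series put in place of the variable of index \<open>i\<close>;
  \<open>s\<close> and \<open>l\<close> count the variables of the source and of the target.\<close>

locale substitution = banach_algebra +
  fixes s l :: nat and q :: "nat \<Rightarrow> 'b mps"
  assumes q: "i < s \<Longrightarrow> q i \<in> small_poly l 1"
begin

section \<open>Convergence and multiplicativity of the substitution\<close>

definition q_power :: "nat multiset \<Rightarrow> 'b mps" where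
  "q_power J = prod_mset (image_mset q J)"

lemma q_power_add: "q_power (I + J) = q_power I * q_power J"
  by (simp add: q_power_def)

lemma q_power_small: "J \<in> multi_indices s \<Longrightarrow> q_power J \<in> small_poly l (size J)"
proof (induction J)
  case empty
  then show ?case using small_poly_1 by (simp add: q_power_def)
next
  case (add i J)
  then have "q i * q_power J \<in> small_poly l (1 + size J)"
    by (intro small_poly_mult q) (auto simp: multi_indices_def)
  then show ?case by (simp add: q_power_def)
qed

text \<open>Put \<open>t = size P - size M\<close>. Since \<open>size P + 1\<close> is at most
  \<open>(size M + 1) * (t + 1)\<close>, the growth of \<open>a\<close> splits into growth in
  \<open>M\<close> and a factor \<open>(t + 1) ^ n\<close>, which the decay
  \<open>v \<omega> ^ t\<close> of the coefficient of \<open>q_power P\<close> absorbs. The result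
  is uniform in \<open>P\<close> and tends to 0 as the lower bound \<open>m\<close> on its size
  grows.\<close>

lemma term_bound:
  assumes a: "N a \<le> C * real (size P + 1) ^ n" and m: "m \<le> size P" and P: "P \<in> multi_indices s"
  shows "N (a * mcoeff (q_power P) M)
    \<le> C * decay n * real (size M + 1) ^ n / real (m - size M + 1)"
proof -
  have "0 \<le> C * real (size P + 1) ^ n" using a N_nonneg order_trans by blast
  moreover have "0 < real (size P + 1) ^ n" by simp
  ultimately have C: "0 \<le> C" by (meson not_less mult_neg_pos)
  show ?thesis
  proof (cases "size M \<le> size P")
    case False
    then have "mcoeff (q_power P) M = 0"
      using q_power_small[OF P] by (auto simp: small_poly_def)
    then show ?thesis using C decay_nonneg by simp
  next
    case True
    define t where "t = size P - size M"
    have t: "size P + 1 \<le> (size M + 1) * (t + 1)"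
    proof -
      have "size P = size M + t" using True by (simp add: t_def)
      then show ?thesis by simp
    qed
    have "N (a * mcoeff (q_power P) M) \<le> N a * N (mcoeff (q_power P) M)" by (rule N_mult)
    also have "\<dots> \<le> (C * real (size P + 1) ^ n) * v \<omega> ^ t"
      using q_power_small[OF P] True C
      by (intro mult_mono a) (auto simp: small_poly_def t_def N_nonneg)
    also have "\<dots> \<le> (C * real ((size M + 1) * (t + 1)) ^ n) * v \<omega> ^ t"
      using t C v_pos_\<omega>
      by (intro mult_right_mono mult_left_mono power_mono) (auto simp del: of_nat_mult of_nat_add mult_Suc mult_Suc_right)
    also have "\<dots> = C * real (size M + 1) ^ n * (real (t + 1) ^ n * v \<omega> ^ t)"
      by (simp only: of_nat_mult power_mult_distrib mult.assoc)
    also have "\<dots> \<le> C * real (size M + 1) ^ n * (decay n / real (t + 1))"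
      using C by (intro mult_left_mono decay) auto
    also have "\<dots> \<le> C * real (size M + 1) ^ n * (decay n / real (m - size M + 1))"
      using C m decay_nonneg[of n]
      by (intro mult_left_mono divide_left_mono) (auto simp: t_def diff_le_mono)
    finally show ?thesis by (simp add: mult.commute mult.left_commute)
  qed
qed

lemma term_bound_tendsto: "(\<lambda>m. B / real (m - d + 1)) \<longlonglongrightarrow> 0"
proof (rule LIMSEQ_offset[of _ d])
  show "(\<lambda>n. B / real (n + d - d + 1)) \<longlonglongrightarrow> 0"
    using tendsto_mult[OF tendsto_const[of B] LIMSEQ_inverse_real_of_nat]
    by (simp add: divide_inverse add.commute)
qed

definition partial_sum :: "'b mps \<Rightarrow> nat \<Rightarrow> 'b mps" where
  "partial_sum f m = (\<Sum>J\<in>small_indices s m. mconst (mcoeff f J) * q_power J)"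

lemma mcoeff_partial_sum:
  "mcoeff (partial_sum f m) M = (\<Sum>J\<in>small_indices s m. mcoeff f J * mcoeff (q_power J) M)"
  by (simp add: partial_sum_def mcoeff_sum)

text \<open>The series \<open>q i\<close> may have a constant term, so infinitely many terms can
  contribute to one coefficient. The sum is therefore a limit of partial sums by total degree; the
  choice of \<open>b\<close> is meaningful where this limit exists.\<close>

definition substitute :: "'b mps \<Rightarrow> 'b mps" where
  "substitute f = Mps (\<lambda>M. SOME b. N_limit (\<lambda>m. mcoeff (partial_sum f m) M) b)"

text \<open>By the ultrametric inequality a difference of partial sums is at most its largest term,
  and \<open>term_bound\<close> sends these terms to 0; completeness then supplies the
  coefficient.\<close>

lemma substitute_limit:
  assumes "f \<in> tempered s"
  shows "N_limit (\<lambda>m. mcoeff (partial_sum f m) M) (mcoeff (substitute f) M)"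
proof -
  obtain n C where f: "f \<in> growth s n C" using assms by (auto simp: tempered_def)
  define B where "B = C * decay n * real (size M + 1) ^ n"
  have B0: "0 \<le> B" using growth_nonneg[OF f] decay_nonneg by (simp add: B_def)
  define bnd where "bnd m = B / real (m - size M + 1)" for m
  have step: "N (mcoeff (partial_sum f m') M - mcoeff (partial_sum f m) M) \<le> bnd m" if "m \<le> m'" for m m'
  proof -
    have sub: "small_indices s m \<subseteq> small_indices s m'"
      using that by (auto simp: small_indices_def)
    have "mcoeff (partial_sum f m') M - mcoeff (partial_sum f m) M
        = (\<Sum>J\<in>small_indices s m' - small_indices s m. mcoeff f J * mcoeff (q_power J) M)"
      unfolding mcoeff_partial_sum by (simp add: sum_diff[OF _ sub])
    also have "N \<dots> \<le> bnd m"
      unfolding bnd_def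
    proof (rule N_sum_le)
      fix J assume J: "J \<in> small_indices s m' - small_indices s m"
      show "N (mcoeff f J * mcoeff (q_power J) M) \<le> B / real (m - size M + 1)"
        unfolding B_def
        by (rule term_bound[OF growthD(2)[OF f]]) (use J in \<open>auto simp: small_indices_def\<close>)
    qed (use B0 in auto)
    finally show ?thesis .
  qed
  have "\<exists>n0. \<forall>m\<ge>n0. \<forall>n\<ge>n0. N (mcoeff (partial_sum f m) M - mcoeff (partial_sum f n) M) < e"
    if e: "0 < e" for e
  proof -
    have "eventually (\<lambda>m. bnd m < e) sequentially"
      using term_bound_tendsto[of B "size M"] e unfolding bnd_def by (auto dest: order_tendstoD)
    then obtain n0 where n0: "\<And>m. n0 \<le> m \<Longrightarrow> bnd m < e" by (auto simp: eventually_sequentially)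
    have "N (mcoeff (partial_sum f m) M - mcoeff (partial_sum f n) M) < e" if "n0 \<le> m" "n0 \<le> n" for m n
      using step[of m n] step[of n m] n0[of m] n0[of n] that
      by (cases "m \<le> n") (auto simp: N_diff_commute[of "mcoeff (partial_sum f m) M"])
    then show ?thesis by blast
  qed
  then have "\<exists>b. N_limit (\<lambda>m. mcoeff (partial_sum f m) M) b"
    unfolding N_limit_def by (rule N_complete)
  then show ?thesis
    unfolding substitute_def mcoeff_Mps by (rule someI_ex)
qed

lemma substitute_eqI:
  assumes "f \<in> tempered s" "\<And>M. N_limit (\<lambda>m. mcoeff (partial_sum f m) M) (mcoeff g M)"
  shows "substitute f = g"
  by (rule mps_eqI) (rule N_limit_unique[OF substitute_limit[OF assms(1)] assms(2)], simp)

lemma substitute_growth: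
  assumes f: "f \<in> growth s n C"
  shows "substitute f \<in> growth l n (C * decay n)"
proof -
  note lim = substitute_limit[OF growth_tempered[OF f]]
  have "N (mcoeff (substitute f) M) \<le> C * decay n * real (size M + 1) ^ n" for M
  proof (rule N_limit_le[OF lim])
    show "N (mcoeff (partial_sum f m) M) \<le> C * decay n * real (size M + 1) ^ n" for m
      unfolding mcoeff_partial_sum
    proof (rule N_sum_le)
      fix J assume J: "J \<in> small_indices s m"
      \<comment> \<open>With \<open>m = 0\<close> the truncated difference \<open>0 - size M\<close>
        is 0 and the denominator is 1: the bound is uniform in \<open>J\<close> and keeps the
        exponent \<open>n\<close>.\<close>
      have "N (mcoeff f J * mcoeff (q_power J) M) \<le> C * decay n * real (size M + 1) ^ n / real (0 - size M + 1)"
        by (rule term_bound[OF growthD(2)[OF f]]) (use J in \<open>auto simp: small_indices_def\<close>)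
      then show "N (mcoeff f J * mcoeff (q_power J) M) \<le> C * decay n * real (size M + 1) ^ n"
        by simp
    qed (use growth_nonneg[OF f] decay_nonneg in auto)
  qed
  moreover have "mcoeff (substitute f) M = 0" if "M \<notin> multi_indices l" for M
  proof -
    have "mcoeff (partial_sum f m) M = 0" for m
      unfolding mcoeff_partial_sum
      using q_power_small that by (intro sum.neutral) (auto simp: small_indices_def small_poly_def)
    then have "N (mcoeff (substitute f) M) \<le> 0"
      by (intro N_limit_le[OF lim]) simp
    then show ?thesis
      using N_nonneg[of "mcoeff (substitute f) M"] N_eq_0 by (metis order_antisym)
  qed
  ultimately show ?thesis by (simp add: growth_def)
qed

lemma substitute_tempered: "f \<in> tempered s \<Longrightarrow> substitute f \<in> tempered l"
  unfolding tempered_def by (blast intro: substitute_growth)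

lemma substitute_add:
  assumes "f \<in> tempered s" "g \<in> tempered s"
  shows "substitute (f + g) = substitute f + substitute g"
proof (rule substitute_eqI)
  fix M
  have "mcoeff (partial_sum (f + g) m) M = mcoeff (partial_sum f m) M + mcoeff (partial_sum g m) M" for m
    by (simp add: mcoeff_partial_sum sum.distrib algebra_simps)
  then show "N_limit (\<lambda>m. mcoeff (partial_sum (f + g) m) M) (mcoeff (substitute f + substitute g) M)"
    using N_limit_add[OF substitute_limit substitute_limit, OF assms] by simp
qed (intro tempered_add assms)

lemma substitute_mmonom:
  assumes P: "P \<in> multi_indices s"
  shows "substitute (mmonom b P) = mconst b * q_power P"
proof (rule substitute_eqI)
  fix M
  have "mcoeff (partial_sum (mmonom b P) m) M = b * mcoeff (q_power P) M" if "size P < m" for m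
  proof -
    have "mcoeff (partial_sum (mmonom b P) m) M = (\<Sum>J\<in>{P}. mcoeff (mmonom b P) J * mcoeff (q_power J) M)"
      unfolding mcoeff_partial_sum using that P
      by (intro sum.mono_neutral_right finite_small_indices)
         (auto simp: small_indices_def mcoeff_mmonom)
    then show ?thesis by (simp add: mcoeff_mmonom)
  qed
  then have "eventually (\<lambda>m. mcoeff (partial_sum (mmonom b P) m) M = b * mcoeff (q_power P) M) sequentially"
    by (intro eventually_sequentiallyI[of "Suc (size P)"]) auto
  then show "N_limit (\<lambda>m. mcoeff (partial_sum (mmonom b P) m) M) (mcoeff (mconst b * q_power P) M)"
    unfolding N_limit_def by (intro tendsto_eventually) (auto elim: eventually_mono)
qed (intro tempered_mmonom P)

lemma substitute_mconst: "substitute (mconst b) = mconst b"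
  by (simp add: substitute_mmonom q_power_def)

lemma substitute_mvar: "i < s \<Longrightarrow> substitute (mvar i) = q i"
  by (simp add: substitute_mmonom q_power_def mconst_1)

text \<open>The product of two partial sums runs over pairs whose two sizes are below
  \<open>m\<close>, the partial sum of the product over pairs with total size below
  \<open>m\<close>. Only pairs of total size at least \<open>m\<close> make the difference, and
  \<open>term_bound\<close> sends their contribution to 0.\<close>

lemma substitute_mult:
  assumes "f \<in> tempered s" "g \<in> tempered s"
  shows "substitute (f * g) = substitute f * substitute g"
proof (rule mps_eqI)
  fix M :: "nat multiset"
  obtain n C where f: "f \<in> growth s n C" using assms by (auto simp: tempered_def)
  obtain n' C' where g: "g \<in> growth s n' C'" using assms by (auto simp: tempered_def)
  have C: "0 \<le> C" "0 \<le> C'" using growth_nonneg f g by auto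
  define B where "B = C * C' * decay (n + n') * real (size M + 1) ^ (n + n')"
  have B0: "0 \<le> B" using C decay_nonneg by (simp add: B_def)
  have lim: "N_limit (\<lambda>m. mcoeff (partial_sum f m * partial_sum g m) M) (mcoeff (substitute f * substitute g) M)"
    unfolding mcoeff_mult case_prod_unfold
    by (intro N_limit_sum N_limit_mult substitute_limit assms)
  have diff: "N (mcoeff (partial_sum (f * g) m) M - mcoeff (partial_sum f m * partial_sum g m) M)
      \<le> B / real (m - size M + 1)" for m
  proof -
    let ?S = "small_indices s m"
    define t where "t p = mconst (mcoeff f (fst p) * mcoeff g (snd p)) * q_power (fst p + snd p)" for p
    define D where "D = {p \<in> ?S \<times> ?S. size (fst p + snd p) < m}"
    have "partial_sum f m * partial_sum g m = (\<Sum>p\<in>?S \<times> ?S. t p)"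
      unfolding partial_sum_def sum_product sum.cartesian_product t_def q_power_add
      by (rule sum.cong) (auto simp: mmonom_mult[of _ "{#}" _ "{#}", simplified, symmetric] mult_ac)
    moreover have "partial_sum (f * g) m = (\<Sum>p\<in>D. t p)"
    proof -
      have "partial_sum (f * g) m = (\<Sum>P\<in>?S. \<Sum>p\<in>splits P. t p)"
        unfolding partial_sum_def mcoeff_mult mmonom_sum sum_distrib_right
        by (intro sum.cong) (auto simp: t_def)
      also have "\<dots> = (\<Sum>(P, p)\<in>Sigma ?S splits. t p)"
        by (simp add: sum.Sigma)
      also have "\<dots> = (\<Sum>p\<in>D. t p)"
        by (rule sum.reindex_bij_witness[where i = "\<lambda>p. (fst p + snd p, p)" and j = snd])
           (auto simp: D_def small_indices_def)
      finally show ?thesis .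
    qed
    moreover have "D \<subseteq> ?S \<times> ?S" by (auto simp: D_def)
    ultimately have "partial_sum f m * partial_sum g m - partial_sum (f * g) m = (\<Sum>p\<in>?S \<times> ?S - D. t p)"
      by (simp add: sum_diff)
    then have "mcoeff (partial_sum f m * partial_sum g m) M - mcoeff (partial_sum (f * g) m) M
        = (\<Sum>p\<in>?S \<times> ?S - D. mcoeff (t p) M)"
      by (simp flip: mcoeff_sum mcoeff_simps)
    also have "N \<dots> \<le> B / real (m - size M + 1)"
    proof (rule N_sum_le)
      fix p assume p: "p \<in> ?S \<times> ?S - D"
      obtain I J where IJ: "p = (I, J)" by (cases p)
      have "N (mcoeff f I * mcoeff g J) \<le> N (mcoeff f I) * N (mcoeff g J)" by (rule N_mult)
      also have "\<dots> \<le> (C * real (size I + 1) ^ n) * (C' * real (size J + 1) ^ n')"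
        using growthD[OF f] growthD[OF g] by (intro mult_mono) (auto simp: N_nonneg C)
      also have "\<dots> \<le> (C * real (size (I + J) + 1) ^ n) * (C' * real (size (I + J) + 1) ^ n')"
        by (intro mult_mono power_mono mult_nonneg_nonneg) (auto simp: C)
      finally have *: "N (mcoeff f I * mcoeff g J) \<le> C * C' * real (size (I + J) + 1) ^ (n + n')"
        by (simp add: power_add algebra_simps)
      show "N (mcoeff (t p) M) \<le> B / real (m - size M + 1)"
        using term_bound[OF *, of m M] p
        by (auto simp: t_def IJ B_def D_def small_indices_def)
    qed (use B0 in auto)
    finally show ?thesis
      by (simp add: N_diff_commute)
  qed
  show "mcoeff (substitute (f * g)) M = mcoeff (substitute f * substitute g) M"
  proof (rule N_limit_unique[OF substitute_limit[OF tempered_mult[OF assms]] lim])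
    show "(\<lambda>m. N (mcoeff (partial_sum (f * g) m) M - mcoeff (partial_sum f m * partial_sum g m) M)) \<longlonglongrightarrow> 0"
      by (rule tendsto_sandwich[OF _ _ tendsto_const term_bound_tendsto[of B "size M"]])
         (use diff N_nonneg in auto)
  qed
qed

text \<open>A bounded linear map is Mackey continuous: the null scalars pass through it, and the
  bounded factors go to bounded ones.\<close>

lemma substitute_mackey:
  assumes "\<And>n. u n \<in> tempered s" "g \<in> tempered s" "mackey s u g"
  shows "mackey l (\<lambda>n. substitute (u n)) (substitute g)"
proof -
  obtain n C c where c: "(\<lambda>n. v (c n)) \<longlonglongrightarrow> 0"
    and u: "\<And>m. \<exists>b\<in>growth s n C. u m - g = mconst (\<kappa> (c m)) * b"
    using assms(3) unfolding mackey_def by blast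
  have "\<exists>b\<in>growth l n (C * decay n). substitute (u m) - substitute g = mconst (\<kappa> (c m)) * b" for m
  proof -
    obtain b where b: "b \<in> growth s n C" and "u m - g = mconst (\<kappa> (c m)) * b" using u by blast
    then have "u m = g + mconst (\<kappa> (c m)) * b" by (simp add: algebra_simps)
    then have "substitute (u m) = substitute g + mconst (\<kappa> (c m)) * substitute b"
      using growth_tempered[OF b] assms(2)
      by (simp add: substitute_add substitute_mult substitute_mconst tempered_mult tempered_mmonom)
    then show ?thesis using substitute_growth[OF b] by (intro bexI[of _ "substitute b"]) auto
  qed
  then show ?thesis using c unfolding mackey_def by blast
qed

end

section \<open>The canonical isomorphism of tubes\<close>

context banach_algebra
begin

abbreviation tube_hom :: "'b list \<Rightarrow> 'b list \<Rightarrow> ((nat multiset \<Rightarrow> 'b) set \<Rightarrow> (nat multiset \<Rightarrow> 'b) set) \<Rightarrow> bool"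
  where "tube_hom fs gs \<equiv>
    born_alg_hom (tube fs) (tube_bounded fs) (\<lambda>b. tube_class fs (mconst b))
      (tube gs) (tube_bounded gs) (\<lambda>b. tube_class gs (mconst b))"

lemma tube_hom_unique:
  assumes "tube_hom fs gs h" "tube_hom fs gs h'" "x \<in> carrier (tube fs)"
  shows "h x = h' x"
proof -
  have "tube_hom fs gs (if i = 0 then h else h')" for i :: nat
    using assms by simp
  then show ?thesis
    using born_alg_hom_unique[of fs gs "\<lambda>i. if i = 0 then h else h'" x] assms(3) by simp
qed

lemma tube_hom_id: "tube_hom fs fs (\<lambda>x. x)"
  by (simp add: born_alg_hom_def ring_hom_def)

lemma tube_hom_compose:
  assumes h: "tube_hom fs gs h" and h': "tube_hom gs hs h'"
  shows "tube_hom fs hs (\<lambda>x. h' (h x))"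
proof -
  have "h \<in> ring_hom (tube fs) (tube gs)" "h' \<in> ring_hom (tube gs) (tube hs)"
    using assms by (auto simp: born_alg_hom_def)
  then have "(\<lambda>x. h' (h x)) \<in> ring_hom (tube fs) (tube hs)"
    unfolding ring_hom_def by (auto simp: Pi_iff)
  moreover have "(\<lambda>x. h' (h x)) ` B \<in> tube_bounded hs" if "B \<in> tube_bounded fs" for B
  proof -
    have "h' ` h ` B \<in> tube_bounded hs" using assms that by (simp add: born_alg_hom_def)
    then show ?thesis by (simp add: image_image)
  qed
  ultimately show ?thesis using assms by (simp add: born_alg_hom_def)
qed

lemma born_alg_iso_tubes:
  assumes "tube_hom fs gs h" "tube_hom gs fs h'"
  shows "born_alg_iso (tube fs) (tube_bounded fs) (\<lambda>b. tube_class fs (mconst b))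
      (tube gs) (tube_bounded gs) (\<lambda>b. tube_class gs (mconst b)) h"
  unfolding born_alg_iso_def
  using assms tube_hom_unique[OF tube_hom_compose[OF assms] tube_hom_id]
    tube_hom_unique[OF tube_hom_compose[OF assms(2,1)] tube_hom_id] by blast

end

context substitution
begin

lemma tube_hom_substitute:
  assumes s: "length fs = s" and l: "length gs = l"
    and rel: "\<And>i. i < s \<Longrightarrow> q i - mconst (fs ! i) \<in> kernel gs"
  shows "\<exists>h. tube_hom fs gs h"
proof -
  have K: "series_ideal l (kernel gs)" "closed_set l (kernel gs)"
    using kernel_ideal kernel_closed l by auto
  have Kadd: "f + g \<in> kernel gs" if "f \<in> kernel gs" "g \<in> kernel gs" for f g
    using K(1) that unfolding series_ideal_def by blast
  have Kmult: "f * g \<in> kernel gs" if "f \<in> tempered l" "g \<in> kernel gs" for f g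
    using K(1) that unfolding series_ideal_def by blast
  have K0: "0 \<in> kernel gs"
    using K(1) unfolding series_ideal_def by blast
  \<comment> \<open>The substitution descends to the tubes if this preimage contains the kernel. It
    is an ideal because \<open>substitute\<close> is a ring homomorphism and closed by Mackey
    continuity, so only the relations remain to be checked.\<close>
  define I where "I = {f \<in> tempered s. substitute f \<in> kernel gs}"
  have subst_diff: "substitute (f - g) = substitute f - substitute g"
    if "f \<in> tempered s" "g \<in> tempered s" for f g
    using substitute_add[OF tempered_diff[OF that] that(2)] by simp
  have I: "kernel fs \<subseteq> I"
  proof (rule kernel_minimal)
    show "series_ideal (length fs) I"
      unfolding series_ideal_def s
      using K0 substitute_mconst[of 0] Kadd Kmult
      by (auto simp: I_def tempered_0 tempered_add tempered_mult substitute_add substitute_mult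
          substitute_tempered mmonom_0)
    show "closed_set (length fs) I"
      unfolding s I_def
      by (rule closed_set_vimage[OF K(2)]) (auto intro: substitute_tempered substitute_mackey)
    show "relations fs \<subseteq> I"
      unfolding relations_def I_def
    proof clarify
      fix i assume i: "i < length fs"
      have t: "mvar i \<in> tempered s" "mconst (fs ! i) \<in> tempered s"
        using i s by (auto intro: tempered_mmonom)
      then show "mvar i - mconst (fs ! i) \<in> tempered s \<and> substitute (mvar i - mconst (fs ! i)) \<in> kernel gs"
        using rel i s by (simp add: subst_diff substitute_mvar substitute_mconst tempered_diff)
    qed
  qed
  \<comment> \<open>The value is computed on a chosen representative; the inclusion of the kernel in
    \<open>I\<close> makes it independent of the choice.\<close>
  define h where "h x = tube_class gs (substitute (SOME f. f \<in> tempered s \<and> tube_class fs f = x))" for x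
  have h: "h (tube_class fs f) = tube_class gs (substitute f)" if f: "f \<in> tempered s" for f
  proof -
    define f' where "f' = (SOME f'. f' \<in> tempered s \<and> tube_class fs f' = tube_class fs f)"
    have f': "f' \<in> tempered s" "tube_class fs f' = tube_class fs f"
      using someI[of "\<lambda>f'. f' \<in> tempered s \<and> tube_class fs f' = tube_class fs f" f] f
      by (auto simp: f'_def)
    then have "f' - f \<in> kernel fs" using f s by (simp add: tube_class_eq_iff)
    then have "substitute f' - substitute f \<in> kernel gs"
      using I subst_diff[OF f'(1) f] by (auto simp: I_def)
    then show ?thesis
      using f f'(1) l by (simp add: h_def tube_class_eq_iff substitute_tempered flip: f'_def)
  qed
  have "h \<in> ring_hom (tube fs) (tube gs)"
  proof (rule ring_hom_memI)
    fix x y assume "x \<in> carrier (tube fs)" "y \<in> carrier (tube fs)"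
    then obtain f g where fg: "f \<in> tempered s" "g \<in> tempered s" "x = tube_class fs f" "y = tube_class fs g"
      by (auto simp: carrier_tube s)
    have t: "substitute f \<in> tempered (length gs)" "substitute g \<in> tempered (length gs)"
      using fg substitute_tempered unfolding l by auto
    show "h x \<in> carrier (tube gs)"
      unfolding fg h[OF fg(1)] carrier_tube using t by blast
    show "h (x \<otimes>\<^bsub>tube fs\<^esub> y) = h x \<otimes>\<^bsub>tube gs\<^esub> h y"
      unfolding fg using fg(1,2) tube_simps[OF t] s
      by (simp add: h tube_simps substitute_mult tempered_mult)
    show "h (x \<oplus>\<^bsub>tube fs\<^esub> y) = h x \<oplus>\<^bsub>tube gs\<^esub> h y"
      unfolding fg using fg(1,2) tube_simps[OF t] s
      by (simp add: h tube_simps substitute_add tempered_add)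
  next
    show "h \<one>\<^bsub>tube fs\<^esub> = \<one>\<^bsub>tube gs\<^esub>"
      using substitute_mconst[of 1] by (simp add: tube_one h tempered_1 mconst_1)
  qed
  moreover have "h (tube_class fs (mconst b)) = tube_class gs (mconst b)" for b
    by (simp add: h tempered_mmonom substitute_mconst)
  moreover have "h ` B \<in> tube_bounded gs" if Bd: "B \<in> tube_bounded fs" for B
  proof -
    obtain n C where B: "B \<subseteq> tube_class fs ` growth s n C"
      using Bd unfolding tube_bounded_iff s by blast
    have "h ` B \<subseteq> tube_class gs ` growth (length gs) n (C * decay n)"
    proof (rule image_subsetI)
      fix x assume "x \<in> B"
      then obtain f where f: "f \<in> growth s n C" "x = tube_class fs f" using B by blast
      then show "h x \<in> tube_class gs ` growth (length gs) n (C * decay n)"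
        using substitute_growth[OF f(1)] l by (simp add: h growth_tempered)
    qed
    then show ?thesis unfolding tube_bounded_iff by blast
  qed
  ultimately show ?thesis unfolding born_alg_hom_def by blast
qed

end

context banach_algebra
begin

lemma tube_hom_exists:
  assumes eq: "\<And>i. i < length fs \<Longrightarrow> fs ! i = (\<Sum>j<length gs. a i j * gs ! j) + r i"
    and a: "\<And>i j. i < length fs \<Longrightarrow> j < length gs \<Longrightarrow> N (a i j) \<le> 1"
    and r: "\<And>i. i < length fs \<Longrightarrow> N (r i) \<le> v \<omega>"
  shows "\<exists>h. tube_hom fs gs h"
proof -
  let ?l = "length gs"
  \<comment> \<open>The given expression of \<open>fs ! i\<close>, with the variable of index
    \<open>j\<close> in place of \<open>gs ! j\<close>.\<close>
  define q where "q i = (\<Sum>j<?l. mconst (a i j) * mvar j) + mconst (r i)" for i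
  have coeff: "mcoeff (q i) M = (\<Sum>j<?l. if M = {#j#} then a i j else 0) + (if M = {#} then r i else 0)" for i M
    by (simp add: q_def mcoeff_sum mmonom_mult mcoeff_mmonom)
  have "q i \<in> small_poly ?l 1" if i: "i < length fs" for i
  proof -
    have "mcoeff (q i) M = 0" if "M \<notin> multi_indices ?l \<or> 1 < size M" for M
      unfolding coeff using that by (auto intro!: sum.neutral)
    moreover have "N (mcoeff (q i) M) \<le> v \<omega> ^ (1 - size M)" if M: "size M \<le> 1" for M
    proof (cases "size M = 0")
      case True
      then show ?thesis using r[OF i] by (simp add: coeff)
    next
      case False
      then have "size M = 1" using M by linarith
      moreover have "N (\<Sum>j<?l. if M = {#j#} then a i j else 0) \<le> 1"
        using a[OF i] by (intro N_sum_le) auto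
      ultimately show ?thesis by (auto simp: coeff)
    qed
    ultimately show ?thesis by (simp add: small_poly_def)
  qed
  then interpret substitution v \<kappa> N \<omega> "length fs" ?l q
    by unfold_locales
  show ?thesis
  proof (rule tube_hom_substitute[OF refl refl])
    fix i assume i: "i < length fs"
    have "mconst (fs ! i) = (\<Sum>j<?l. mconst (a i j) * mconst (gs ! j)) + mconst (r i)"
      by (subst eq[OF i]) (simp add: mmonom_mult mmonom_sum flip: mmonom_add)
    \<comment> \<open>The constants \<open>r i\<close> cancel, which leaves a combination of the
      relations for \<open>gs\<close>.\<close>
    then have "q i - mconst (fs ! i) = (\<Sum>j<?l. mconst (a i j) * (mvar j - mconst (gs ! j)))"
      by (simp add: q_def sum_subtractf right_diff_distrib)
    moreover have sum: "sum g S \<in> kernel gs" if "\<And>j. j \<in> S \<Longrightarrow> g j \<in> kernel gs" for g and S :: "nat set"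
      using that kernel_ideal[of gs]
      by (induction S rule: infinite_finite_induct) (auto simp: series_ideal_def)
    moreover have "(\<Sum>j<?l. mconst (a i j) * (mvar j - mconst (gs ! j))) \<in> kernel gs"
    proof (rule sum)
      fix j assume "j \<in> {..<?l}"
      then have j: "j < ?l" by simp
      have "mvar j - mconst (gs ! j) \<in> kernel gs"
        using relations_kernel[of gs] j by (auto simp: relations_def)
      moreover have "mconst (a i j) \<in> tempered ?l" by (simp add: tempered_mmonom)
      ultimately show "mconst (a i j) * (mvar j - mconst (gs ! j)) \<in> kernel gs"
        using kernel_ideal[of gs] by (simp add: series_ideal_def)
    qed
    ultimately show "q i - mconst (fs ! i) \<in> kernel gs" by simp
  qed
qed

end

section \<open>The supremum norm on a formal model\<close>

text \<open>Extracts sequential completeness from the metric predicate, both for the absolute value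
  of the field and for the supremum norm.\<close>

lemma mcomplete_normD:
  fixes n :: "'a::ab_group_add \<Rightarrow> real"
  assumes "Metric_space.mcomplete UNIV (\<lambda>x y. n (x - y))"
    and nonneg: "\<And>x. 0 \<le> n x" and zero: "\<And>x. n x = 0 \<longleftrightarrow> x = 0"
    and diff: "\<And>x y. n (x - y) \<le> n x + n y"
    and cauchy: "\<And>e. 0 < e \<Longrightarrow> \<exists>n0. \<forall>m\<ge>n0. \<forall>k\<ge>n0. n (u m - u k) < e"
  shows "\<exists>l. (\<lambda>k. n (u k - l)) \<longlonglongrightarrow> 0"
proof -
  have "n (- x) \<le> n x" for x using diff[of 0 x] zero[of 0] by simp
  from this[of "- _"] this have minus: "n (- x) = n x" for x
    by (metis add.inverse_inverse order_antisym)
  have commute: "n (x - y) = n (y - x)" for x y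
    using minus[of "x - y"] by simp
  interpret Metric_space UNIV "\<lambda>x y. n (x - y)"
  proof
    show "n (x - z) \<le> n (x - y) + n (y - z)" for x y z
      using diff[of "x - y" "z - y"] commute[of z y] by simp
  qed (auto simp: nonneg zero commute)
  have "MCauchy u"
    unfolding MCauchy_def
  proof (intro conjI allI impI)
    show "\<exists>n0. \<forall>m k. n0 \<le> m \<longrightarrow> n0 \<le> k \<longrightarrow> n (u m - u k) < e" if "0 < e" for e
      using cauchy[OF that] by blast
  qed simp
  then obtain l where "limitin mtopology u l sequentially"
    using assms(1) mcomplete_def by blast
  then have "\<forall>e>0. \<exists>n0. \<forall>k\<ge>n0. n (u k - l) < e"
    by (auto simp: limit_metric_sequentially)
  then show ?thesis
    using nonneg by (auto simp: LIMSEQ_iff intro!: exI[of _ l])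
qed

locale valued_algebra =
  fixes v :: "'k::field_char_0 \<Rightarrow> real" and \<kappa> :: "'k \<Rightarrow> 'b::comm_ring_1"
  assumes cdv: "complete_discretely_valued v"
    and \<kappa>_hom: "\<kappa> \<in> ring_hom ring_of_type_algebra ring_of_type_algebra"
begin

lemma v_nonneg: "0 \<le> v c"
  and v_eq_0: "v c = 0 \<longleftrightarrow> c = 0"
  and v_mult: "v (c * d) = v c * v d"
  and v_add: "v (c + d) \<le> max (v c) (v d)"
  using cdv by (auto simp: complete_discretely_valued_def)

lemma v_0 [simp]: "v 0 = 0"
  by (simp add: v_eq_0)

lemma v_1 [simp]: "v 1 = 1"
  using v_mult[of 1 1] v_eq_0[of 1] by simp

lemma v_minus [simp]: "v (- c) = v c"
proof -
  have "v (- 1) * v (- 1) = 1" by (simp flip: v_mult)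
  then have "v (- 1) = 1"
    using v_nonneg[of "- 1"] by (simp add: square_eq_1_iff)
  then show ?thesis using v_mult[of "- 1" c] by simp
qed

lemma v_diff: "v (c - d) \<le> max (v c) (v d)"
  using v_add[of c "- d"] by simp

lemma v_divide: "v (c / d) = v c / v d"
proof (cases "d = 0")
  case False
  then show ?thesis
    using v_mult[of "c / d" d] v_eq_0[of d] by (simp add: field_simps)
qed auto

lemma v_complete:
  assumes "\<And>e. 0 < e \<Longrightarrow> \<exists>n0. \<forall>m\<ge>n0. \<forall>n\<ge>n0. v (u m - u n) < e"
  shows "\<exists>l. (\<lambda>n. v (u n - l)) \<longlonglongrightarrow> 0"
proof (rule mcomplete_normD[OF _ v_nonneg v_eq_0 _ assms])
  show "Metric_space.mcomplete UNIV (\<lambda>x y. v (x - y))"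
    using cdv by (simp add: complete_discretely_valued_def)
  show "v (x - y) \<le> v x + v y" for x y
    using v_diff[of x y] v_nonneg[of x] v_nonneg[of y] by linarith
qed

text \<open>By discreteness a nonzero value below 1 is a positive power of
  \<open>v \<omega>\<close>. Hence one bound smaller than 1 serves the whole maximal ideal of the
  valuation ring.\<close>

lemma uniformizer:
  obtains \<omega> where "0 < v \<omega>" "v \<omega> < 1" "\<And>c. v c < 1 \<Longrightarrow> v c \<le> v \<omega>"
proof -
  obtain \<omega> where \<omega>: "0 < v \<omega>" "v \<omega> < 1" "\<And>x. x \<noteq> 0 \<Longrightarrow> \<exists>n::int. v x = v \<omega> powi n"
  proof -
    have "\<exists>w. 0 < v w \<and> v w < 1 \<and> (\<forall>x. x \<noteq> 0 \<longrightarrow> (\<exists>n::int. v x = v w powi n))"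
      using cdv by (simp add: complete_discretely_valued_def)
    then show ?thesis using that by metis
  qed
  have "v c \<le> v \<omega>" if "v c < 1" for c
  proof (cases "c = 0")
    case False
    then obtain n :: int where n: "v c = v \<omega> powi n" using \<omega>(3) by blast
    have "0 < n"
    proof (rule ccontr)
      assume "\<not> 0 < n"
      then have "v c = inverse (v \<omega> ^ nat (- n))"
        using n by (auto simp: power_int_def power_inverse)
      moreover have "v \<omega> ^ nat (- n) \<le> 1" using \<omega> by (intro power_le_one) auto
      ultimately have "1 \<le> v c" using \<omega>(1) by (simp add: one_le_inverse)
      then show False using that by simp
    qed
    then have "v c = v \<omega> ^ Suc (nat n - 1)" using n by (simp add: power_int_def)
    also have "\<dots> \<le> v \<omega> * 1"
      unfolding power_Suc using \<omega> by (intro mult_left_mono power_le_one) auto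
    finally show ?thesis by simp
  qed (use \<omega> in simp)
  then show ?thesis using that \<omega> by blast
qed

lemma \<kappa>_1 [simp]: "\<kappa> 1 = 1"
  and \<kappa>_mult: "\<kappa> (c * d) = \<kappa> c * \<kappa> d"
  and \<kappa>_add: "\<kappa> (c + d) = \<kappa> c + \<kappa> d"
  using \<kappa>_hom by (auto simp: ring_hom_def)

lemma \<kappa>_0 [simp]: "\<kappa> 0 = 0"
  using \<kappa>_add[of 0 0] by simp

lemma \<kappa>_minus: "\<kappa> (- c) = - \<kappa> c"
  using \<kappa>_add[of c "- c"] by (simp add: eq_neg_iff_add_eq_0 add.commute)

lemma \<kappa>_diff: "\<kappa> (c - d) = \<kappa> c - \<kappa> d"
  using \<kappa>_add[of c "- d"] by (simp add: \<kappa>_minus)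

lemma \<kappa>_of_nat: "\<kappa> (of_nat n) = of_nat n"
  by (induction n) (auto simp: \<kappa>_add)

end

text \<open>Equality in the residue field of a point is written as \<open>w (f - g) = 0\<close>, so
  all computations stay in the affinoid algebra and no quotient is formed.\<close>

locale multiplicative_seminorm = valued_algebra v \<kappa>
  for v :: "'k::field_char_0 \<Rightarrow> real" and \<kappa> :: "'k \<Rightarrow> 'b::comm_ring_1" +
  fixes w :: "'b \<Rightarrow> real"
  assumes w_nonneg: "0 \<le> w f"
    and w_mult: "w (f * g) = w f * w g"
    and w_add: "w (f + g) \<le> max (w f) (w g)"
    and w_\<kappa>: "w (\<kappa> c) = v c"
begin

lemma w_0 [simp]: "w 0 = 0"
  using w_\<kappa>[of 0] by simp

lemma w_1 [simp]: "w 1 = 1"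
  using w_\<kappa>[of 1] by simp

lemma w_minus: "w (- f) = w f"
proof -
  have "w (- 1) = 1" using w_\<kappa>[of "- 1"] by (simp add: \<kappa>_minus)
  then show ?thesis using w_mult[of "- 1" f] by simp
qed

lemma w_diff: "w (f - g) \<le> max (w f) (w g)"
  using w_add[of f "- g"] by (simp add: w_minus)

lemma w_diff_commute: "w (f - g) = w (g - f)"
  using w_minus[of "f - g"] by simp

lemma w_power: "w (f ^ n) = w f ^ n"
  by (induction n) (auto simp: w_mult)

lemma w_sum_le:
  assumes "0 \<le> r" and "\<And>i. i \<in> S \<Longrightarrow> w (f i) \<le> r"
  shows "w (sum f S) \<le> r"
  using assms(2)
proof (induction S rule: infinite_finite_induct)
  case (insert x F)
  then show ?case using w_add[of "f x" "sum f F"] by (auto intro: order_trans)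
qed (auto simp: assms(1))

lemma w_null_diff: "w (f - g) = 0 \<Longrightarrow> w (g - h) = 0 \<Longrightarrow> w (f - h) = 0"
  using w_add[of "f - g" "g - h"] w_nonneg[of "f - h"] by simp

lemma w_eq_of_null_diff: "w (f - g) = 0 \<Longrightarrow> w f = w g"
  using w_add[of "f - g" g] w_add[of "g - f" f] w_diff_commute[of f g] w_nonneg[of f] w_nonneg[of g]
  by simp

section \<open>Coordinates modulo the null ideal of a point\<close>

definition combination :: "('b \<Rightarrow> 'k) \<Rightarrow> 'b set \<Rightarrow> 'b" where
  "combination c E = (\<Sum>e\<in>E. \<kappa> (c e) * e)"

lemma combination_add: "combination (\<lambda>e. c e + d e) E = combination c E + combination d E"
  by (simp add: combination_def \<kappa>_add distrib_right sum.distrib)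

lemma combination_diff: "combination (\<lambda>e. c e - d e) E = combination c E - combination d E"
  by (simp add: combination_def \<kappa>_diff left_diff_distrib sum_subtractf)

lemma combination_scale: "combination (\<lambda>e. a * c e) E = \<kappa> a * combination c E"
  by (simp add: combination_def \<kappa>_mult sum_distrib_left mult.assoc)

lemma combination_insert:
  "finite E \<Longrightarrow> e \<notin> E \<Longrightarrow> combination c (insert e E) = \<kappa> (c e) * e + combination c E"
  by (simp add: combination_def)

lemma combination_cong: "(\<And>e. e \<in> E \<Longrightarrow> c e = d e) \<Longrightarrow> combination c E = combination d E"
  by (simp add: combination_def)

lemma combination_limit:
  assumes "\<And>e. e \<in> E \<Longrightarrow> (\<lambda>n. v (c n e - l e)) \<longlonglongrightarrow> 0"
  shows "(\<lambda>n. w (combination (c n) E - combination l E)) \<longlonglongrightarrow> 0"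
proof (rule tendsto_sandwich[OF _ _ tendsto_const])
  show "\<forall>\<^sub>F n in sequentially. w (combination (c n) E - combination l E) \<le> (\<Sum>e\<in>E. v (c n e - l e) * w e)"
  proof (rule always_eventually, rule allI)
    fix n
    show "w (combination (c n) E - combination l E) \<le> (\<Sum>e\<in>E. v (c n e - l e) * w e)"
    proof (cases "finite E")
      case True
      show ?thesis
        unfolding combination_diff[symmetric] unfolding combination_def
      proof (rule w_sum_le)
        show "w (\<kappa> (c n e - l e) * e) \<le> (\<Sum>e\<in>E. v (c n e - l e) * w e)" if "e \<in> E" for e
          unfolding w_mult w_\<kappa>
          using True that v_nonneg w_nonneg by (intro member_le_sum) auto
      qed (auto intro!: sum_nonneg mult_nonneg_nonneg v_nonneg w_nonneg)
    qed (simp add: combination_def)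
  qed
  have "(\<lambda>n. \<Sum>e\<in>E. v (c n e - l e) * w e) \<longlonglongrightarrow> (\<Sum>e\<in>E. 0 * w e)"
    by (intro tendsto_sum tendsto_mult tendsto_const assms)
  then show "(\<lambda>n. \<Sum>e\<in>E. v (c n e - l e) * w e) \<longlonglongrightarrow> 0" by simp
qed (auto simp: w_nonneg)

text \<open>\<open>E\<close> need not be independent at the point, so coordinates are not unique;
  the bound asks only for one good choice for each element of the span.\<close>

definition bounded_coords :: "real \<Rightarrow> 'b set \<Rightarrow> bool" where
  "bounded_coords C E \<longleftrightarrow> 0 \<le> C \<and> (\<forall>f. (\<exists>c. w (f - combination c E) = 0) \<longrightarrow>
     (\<exists>c. w (f - combination c E) = 0 \<and> (\<forall>e\<in>E. v (c e) \<le> C * w f)))"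

text \<open>The span of \<open>E\<close> is complete. If combinations came arbitrarily close to
  \<open>x\<close>, small coordinates of their successive differences would sum to a convergent
  series in the field, and the limit combination would have distance 0 from
  \<open>x\<close>.\<close>

lemma distance_positive:
  assumes C: "bounded_coords C E" and far: "\<And>c. w (x - combination c E) \<noteq> 0"
  shows "\<exists>\<delta>>0. \<forall>c. \<delta> \<le> w (x - combination c E)"
proof (rule ccontr)
  assume not: "\<not> ?thesis"
  have "\<exists>c. w (x - combination c E) < 1 / real (n + 1)" for n
    using not[simplified, rule_format, of "1 / real (n + 1)"] by (auto simp: not_le)
  then obtain c where c: "\<And>n. w (x - combination (c n) E) < 1 / real (n + 1)" by metis
  define s where "s n = combination (c n) E" for n
  have c: "w (x - s n) < 1 / real (n + 1)" for n using c by (simp add: s_def)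
  have step: "w (s (Suc n) - s n) \<le> 1 / real (n + 1)" for n
  proof -
    have "w (s (Suc n) - s n) \<le> max (w (x - s n)) (w (x - s (Suc n)))"
      using w_diff[of "x - s n" "x - s (Suc n)"] by simp
    moreover have "1 / real (Suc n + 1) \<le> 1 / real (n + 1)"
      by (intro divide_left_mono) auto
    ultimately show ?thesis using c[of n] c[of "Suc n"] by linarith
  qed
  have "\<exists>d. w ((s (Suc n) - s n) - combination d E) = 0 \<and>
      (\<forall>e\<in>E. v (d e) \<le> C * w (s (Suc n) - s n))" for n
  proof -
    have "w ((s (Suc n) - s n) - combination (\<lambda>e. c (Suc n) e - c n e) E) = 0"
      by (simp add: s_def combination_diff)
    then show ?thesis using C unfolding bounded_coords_def by blast
  qed
  then obtain d where d0: "\<And>n. w ((s (Suc n) - s n) - combination (d n) E) = 0"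
    and dC: "\<And>n e. e \<in> E \<Longrightarrow> v (d n e) \<le> C * w (s (Suc n) - s n)" by metis
  have dC: "v (d n e) \<le> C / real (n + 1)" if "e \<in> E" for n e
    using dC[OF that, of n] mult_left_mono[OF step[of n], of C] C
    by (simp add: bounded_coords_def)
  \<comment> \<open>The small coordinates \<open>d n\<close> may differ from those of
    \<open>c (Suc n)\<close> minus \<open>c n\<close>; their partial sums nevertheless represent
    \<open>s n - s 0\<close> at the point.\<close>
  define D where "D n e = (\<Sum>k<n. d k e)" for n e
  have sD: "w ((s n - s 0) - combination (D n) E) = 0" for n
  proof (induction n)
    case 0
    then show ?case by (simp add: D_def combination_def)
  next
    case (Suc n)
    have "combination (D (Suc n)) E = combination (D n) E + combination (d n) E"
      by (subst combination_add[symmetric], rule combination_cong) (simp add: D_def)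
    then have "w ((s (Suc n) - s 0) - combination (D (Suc n)) E)
        = w (((s n - s 0) - combination (D n) E) + ((s (Suc n) - s n) - combination (d n) E))"
      by (simp add: algebra_simps)
    also have "\<dots> \<le> 0"
      using w_add[of "(s n - s 0) - combination (D n) E" "(s (Suc n) - s n) - combination (d n) E"]
      by (simp add: Suc d0)
    finally show ?case using w_nonneg order_antisym by blast
  qed
  have "\<exists>l. (\<lambda>n. v (D n e - l)) \<longlonglongrightarrow> 0" if e: "e \<in> E" for e
  proof (rule v_complete)
    fix \<epsilon> :: real assume \<epsilon>: "0 < \<epsilon>"
    obtain n0 :: nat where n0: "C / \<epsilon> < real n0" using reals_Archimedean2 by blast
    have small: "v (d k e) < \<epsilon>" if "n0 \<le> k" for k
    proof -
      have "C < real n0 * \<epsilon>" using n0 \<epsilon> by (simp add: field_simps)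
      also have "\<dots> \<le> real (k + 1) * \<epsilon>" using that \<epsilon> by (intro mult_right_mono) auto
      finally have "C / real (k + 1) < \<epsilon>" by (subst pos_divide_less_eq) (auto simp: mult.commute)
      then show ?thesis using dC[OF e, of k] by linarith
    qed
    \<comment> \<open>The bounds \<open>C / (k + 1)\<close> are not summable, but by the ultrametric
      inequality it is enough that they tend to 0.\<close>
    have up: "v (D (n + j) e - D n e) < \<epsilon>" if "n0 \<le> n" for n j
    proof (induction j)
      case (Suc j)
      have "D (n + Suc j) e - D n e = (D (n + j) e - D n e) + d (n + j) e"
        by (simp add: D_def)
      then have "v (D (n + Suc j) e - D n e) \<le> max (v (D (n + j) e - D n e)) (v (d (n + j) e))"
        by (simp only: v_add)
      then show ?case
        by (rule le_less_trans) (use Suc small[of "n + j"] that in simp)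
    qed (use \<epsilon> in simp)
    have "v (D m e - D n e) < \<epsilon>" if "n0 \<le> m" "n0 \<le> n" for m n
    proof (cases "n \<le> m")
      case True
      then show ?thesis using up[OF that(2), of "m - n"] by simp
    next
      case False
      then show ?thesis using up[OF that(1), of "n - m"] v_minus[of "D n e - D m e"] by simp
    qed
    then show "\<exists>n0. \<forall>m\<ge>n0. \<forall>n\<ge>n0. v (D m e - D n e) < \<epsilon>" by blast
  qed
  then obtain l where l: "\<And>e. e \<in> E \<Longrightarrow> (\<lambda>n. v (D n e - l e)) \<longlonglongrightarrow> 0" by metis
  have cl: "(\<lambda>n. w (combination (D n) E - combination l E)) \<longlonglongrightarrow> 0"
    by (rule combination_limit[OF l])
  have "w (x - s 0 - combination l E) \<le> 1 / real (n + 1) + w (combination (D n) E - combination l E)" for n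
  proof -
    have "x - s 0 - combination l E = (x - s n) +
        (((s n - s 0) - combination (D n) E) + (combination (D n) E - combination l E))"
      by simp
    also have "w \<dots> \<le> max (w (x - s n)) (max (w ((s n - s 0) - combination (D n) E))
        (w (combination (D n) E - combination l E)))"
      by (rule order_trans[OF w_add]) (intro max.mono order_refl w_add)
    finally show ?thesis
      using c[of n] sD[of n] w_nonneg[of "combination (D n) E - combination l E"] w_nonneg[of "x - s n"]
      by (auto simp: max_def split: if_splits)
  qed
  moreover have "(\<lambda>n. 1 / real (n + 1) + w (combination (D n) E - combination l E)) \<longlonglongrightarrow> 0 + 0"
    using LIMSEQ_inverse_real_of_nat cl
    by (intro tendsto_add) (auto simp: inverse_eq_divide add.commute)
  ultimately have "w (x - s 0 - combination l E) \<le> 0"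
    by (intro LIMSEQ_le_const) auto
  then have "w (x - combination (\<lambda>e. c 0 e + l e) E) = 0"
    using w_nonneg[of "x - s 0 - combination l E"]
    by (simp add: combination_add s_def diff_diff_eq)
  then show False using far by blast
qed

text \<open>All norms on a finite-dimensional vector space over a complete field are equivalent.\<close>

lemma bounded_coords_exists:
  assumes "finite E"
  shows "\<exists>C. bounded_coords C E"
  using assms
proof (induction E rule: finite_induct)
  case empty
  then show ?case by (auto simp: bounded_coords_def intro!: exI[of _ 0])
next
  case (insert x E)
  then obtain C where C: "bounded_coords C E" by blast
  have C0: "0 \<le> C" using C by (simp add: bounded_coords_def)
  have CE: "\<exists>c. w (f - combination c E) = 0 \<and> (\<forall>e\<in>E. v (c e) \<le> C * w f)"
    if "w (f - combination c E) = 0" for f c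
    using C that unfolding bounded_coords_def by blast
  note ins = combination_insert[OF insert(1,2)]
  have upd: "combination (c(x := a)) E = combination c E" for c a
    using insert(2) by (intro combination_cong) auto
  show ?case
  proof (cases "\<exists>b. w (x - combination b E) = 0")
    case True
    then obtain b where b: "w (x - combination b E) = 0" by blast
    \<comment> \<open>Here \<open>x\<close> is redundant at the point: it is replaced by its
      expression in \<open>E\<close> and receives the coordinate 0.\<close>
    have "\<exists>c. w (f - combination c (insert x E)) = 0 \<and> (\<forall>e\<in>insert x E. v (c e) \<le> C * w f)"
      if "w (f - combination c (insert x E)) = 0" for f c
    proof -
      have "w (\<kappa> (c x) * (x - combination b E)) = 0" by (simp add: w_mult b)
      then have "w ((f - combination c (insert x E)) + \<kappa> (c x) * (x - combination b E)) = 0"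
        using that w_add[of "f - combination c (insert x E)" "\<kappa> (c x) * (x - combination b E)"]
          w_nonneg[of "(f - combination c (insert x E)) + \<kappa> (c x) * (x - combination b E)"] by simp
      moreover have "combination (\<lambda>e. c x * b e + c e) E = \<kappa> (c x) * combination b E + combination c E"
        by (simp add: combination_add combination_scale)
      ultimately have "w (f - combination (\<lambda>e. c x * b e + c e) E) = 0"
        by (simp add: ins algebra_simps)
      then obtain d where "w (f - combination d E) = 0" "\<forall>e\<in>E. v (d e) \<le> C * w f"
        using CE by blast
      then show ?thesis
        using C0 w_nonneg[of f] by (intro exI[of _ "d(x := 0)"]) (auto simp: ins upd)
    qed
    then show ?thesis unfolding bounded_coords_def using C0 by blast
  next
    case False
    then obtain \<delta> where \<delta>: "0 < \<delta>" "\<And>c. \<delta> \<le> w (x - combination c E)"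
      using distance_positive[OF C] by blast
    \<comment> \<open>\<open>1 / \<delta>\<close> bounds the coordinate of \<open>x\<close>, because
      \<open>w f\<close> is \<open>v (c x)\<close> times the seminorm of \<open>x\<close> minus some
      combination of \<open>E\<close> when \<open>c x\<close> is nonzero. The second entry bounds
      the other coordinates, as removing the part along \<open>x\<close> enlarges the seminorm by a
      factor of at most \<open>max 1 (w x / \<delta>)\<close>.\<close>
    define C' where "C' = max (1 / \<delta>) (C * max 1 (w x / \<delta>))"
    have "\<exists>c. w (f - combination c (insert x E)) = 0 \<and> (\<forall>e\<in>insert x E. v (c e) \<le> C' * w f)"
      if c: "w (f - combination c (insert x E)) = 0" for f c
    proof -
      have cx: "v (c x) * \<delta> \<le> w f"
      proof (cases "c x = 0")
        case False
        have "w f = w (combination c (insert x E))" by (rule w_eq_of_null_diff[OF c])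
        also have "combination c (insert x E) = \<kappa> (c x) * (x - combination (\<lambda>e. (- 1 / c x) * c e) E)"
        proof -
          have "\<kappa> (c x) * \<kappa> (- 1 / c x) = - 1"
            using False by (simp add: \<kappa>_minus flip: \<kappa>_mult)
          then have "\<kappa> (c x) * (\<kappa> (- 1 / c x) * combination c E) = - combination c E"
            by (metis mult.assoc mult_minus1)
          then show ?thesis
            unfolding ins combination_scale right_diff_distrib by simp
        qed
        also have "w \<dots> = v (c x) * w (x - combination (\<lambda>e. (- 1 / c x) * c e) E)"
          by (simp add: w_mult w_\<kappa>)
        finally show ?thesis using \<delta>(2) v_nonneg by (metis mult_left_mono)
      qed (simp add: w_nonneg)
      then have cx': "v (c x) \<le> 1 / \<delta> * w f" using \<delta>(1) by (simp add: field_simps)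
      have "w ((f - \<kappa> (c x) * x) - combination c E) = 0"
        using c by (simp add: ins algebra_simps)
      then obtain d where d: "w ((f - \<kappa> (c x) * x) - combination d E) = 0"
        "\<And>e. e \<in> E \<Longrightarrow> v (d e) \<le> C * w (f - \<kappa> (c x) * x)"
        using CE by blast
      have "w (f - \<kappa> (c x) * x) \<le> max 1 (w x / \<delta>) * w f"
      proof -
        have "w (\<kappa> (c x) * x) \<le> (1 / \<delta> * w f) * w x"
          unfolding w_mult w_\<kappa> by (intro mult_right_mono cx' w_nonneg)
        then have "w (f - \<kappa> (c x) * x) \<le> max (1 * w f) (w x / \<delta> * w f)"
          using w_diff[of f "\<kappa> (c x) * x"] by (auto simp: mult_ac)
        also have "\<dots> = max 1 (w x / \<delta>) * w f"
          using w_nonneg[of f] by (simp add: max_mult_distrib_right)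
        finally show ?thesis .
      qed
      then have dC: "v (d e) \<le> C * (max 1 (w x / \<delta>) * w f)" if "e \<in> E" for e
        using d(2)[OF that] C0 by (meson mult_left_mono order_trans)
      show ?thesis
      proof (intro exI[of _ "d(x := c x)"] conjI ballI)
        show "w (f - combination (d(x := c x)) (insert x E)) = 0"
          using d(1) by (simp add: ins upd algebra_simps)
        fix e assume e: "e \<in> insert x E"
        have "1 / \<delta> * w f \<le> C' * w f" "C * max 1 (w x / \<delta>) * w f \<le> C' * w f"
          by (rule mult_right_mono; simp add: C'_def w_nonneg)+
        then show "v ((d(x := c x)) e) \<le> C' * w f"
          using e cx' dC[of e] insert(2) by (auto simp: mult.assoc)
      qed
    qed
    moreover have "0 \<le> C'" using \<delta>(1) by (simp add: C'_def le_max_iff_disj)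
    ultimately show ?thesis unfolding bounded_coords_def by blast
  qed
qed

end

lemma mem_cgenideal_subring_of:
  "x \<in> PIdl\<^bsub>subring_of A\<^esub> y \<longleftrightarrow> (\<exists>a\<in>A. x = a * y)"
  by (auto simp: cgenideal_def subring_of_def)

lemma affinoid_point_seminorm:
  assumes "valued_algebra v \<kappa>" "affinoid_point v \<kappa> w"
  shows "multiplicative_seminorm v \<kappa> w"
  using assms by (simp add: multiplicative_seminorm_def multiplicative_seminorm_axioms_def affinoid_point_def)

locale formal_model = valued_algebra v \<kappa>
  for v :: "'k::field_char_0 \<Rightarrow> real" and \<kappa> :: "'k \<Rightarrow> 'b::comm_ring_1" +
  fixes p :: nat and A :: "'b set"
  assumes perfect: "perfect_of_char (residue_ring_of v) p"
    and smooth: "smooth_formal_algebra v p \<kappa> A"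
    and generic: "is_generic_fibre \<kappa> A"
    and banach: "banach_ring_norm (sup_norm v \<kappa>)"
begin

section \<open>The integral model and its p-adic completeness\<close>

lemma subring_A: "subring A (ring_of_type_algebra :: 'b ring)"
  using smooth by (simp add: smooth_formal_algebra_def)

lemma \<kappa>_in_A: "v c \<le> 1 \<Longrightarrow> \<kappa> c \<in> A"
  using smooth by (auto simp: smooth_formal_algebra_def valuation_ring_def)

lemma A_add: "a \<in> A \<Longrightarrow> b \<in> A \<Longrightarrow> a + b \<in> A"
  and A_mult: "a \<in> A \<Longrightarrow> b \<in> A \<Longrightarrow> a * b \<in> A"
  using subringE(6,7)[OF subring_A] by simp_all

lemma A_0: "0 \<in> A" and A_1: "1 \<in> A"
  using \<kappa>_in_A[of 0] \<kappa>_in_A[of 1] by simp_all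

lemma A_uminus: "a \<in> A \<Longrightarrow> - a \<in> A"
  using A_mult[OF \<kappa>_in_A[of "- 1"]] by (simp add: \<kappa>_minus)

lemma A_diff: "a \<in> A \<Longrightarrow> b \<in> A \<Longrightarrow> a - b \<in> A"
  using A_add[of a "- b"] A_uminus by simp

lemma A_power: "a \<in> A \<Longrightarrow> a ^ n \<in> A"
  by (induction n) (auto intro: A_1 A_mult)

lemma A_sum: "(\<And>i. i \<in> S \<Longrightarrow> f i \<in> A) \<Longrightarrow> sum f S \<in> A"
  by (induction S rule: infinite_finite_induct) (auto intro: A_0 A_add)

lemma subring_of_simps [simp]:
  "carrier (subring_of A) = A"
  "x \<otimes>\<^bsub>subring_of A\<^esub> y = x * y"
  "x \<oplus>\<^bsub>subring_of A\<^esub> y = x + y"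
  "\<one>\<^bsub>subring_of A\<^esub> = 1"
  "\<zero>\<^bsub>subring_of A\<^esub> = 0"
  by (simp_all add: subring_of_def ring_of_type_algebra_def)

lemma cring_A: "cring (subring_of A)"
proof -
  interpret ring "subring_of A"
    using ring.subring_is_ring[OF ring_from_type_algebra subring_A] by (simp add: subring_of_def)
  show ?thesis by unfold_locales (simp add: mult.commute)
qed

lemma ideal_AI:
  assumes "I \<subseteq> A" "0 \<in> I" "\<And>x y. x \<in> I \<Longrightarrow> y \<in> I \<Longrightarrow> x + y \<in> I"
    and "\<And>x a. x \<in> I \<Longrightarrow> a \<in> A \<Longrightarrow> a * x \<in> I"
  shows "ideal I (subring_of A)"
proof -
  interpret cring "subring_of A" by (rule cring_A)
  show ?thesis
  proof (rule idealI[OF ring_axioms])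
    show "subgroup I (add_monoid (subring_of A))"
    proof (rule add.subgroupI)
      fix x assume x: "x \<in> I"
      have "- 1 * x \<in> I" by (rule assms(4)[OF x A_uminus[OF A_1]])
      moreover have "\<ominus>\<^bsub>subring_of A\<^esub> x = - x"
        using x assms(1) by (intro minus_equality) (auto intro: A_uminus)
      ultimately show "\<ominus>\<^bsub>subring_of A\<^esub> x \<in> I" by simp
    qed (use assms in auto)
  qed (use assms in \<open>auto simp: mult.commute\<close>)
qed

text \<open>The residue field has characteristic \<open>p\<close>, so the class of \<open>p\<close>
  is 0 there and \<open>p\<close> lies in the valuation ideal.\<close>

lemma v_p: "v (of_nat p) < 1"
proof -
  let ?V = "valuation_ring v" and ?m = "valuation_ideal v"
  have simps: "carrier ?V = {x. v x \<le> 1}" "x \<otimes>\<^bsub>?V\<^esub> y = x * y" "x \<oplus>\<^bsub>?V\<^esub> y = x + y"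
    "\<one>\<^bsub>?V\<^esub> = 1" "\<zero>\<^bsub>?V\<^esub> = 0" for x y
    by (simp_all add: valuation_ring_def ring_of_type_algebra_def)
  have le: "v (x + y) \<le> 1" if "v x \<le> 1" "v y \<le> 1" for x y
    using v_add[of x y] that by simp
  have lt: "v (x + y) < 1" if "v x < 1" "v y < 1" for x y
    using v_add[of x y] that by simp
  interpret V: cring ?V
  proof (rule cringI)
    show "abelian_group ?V"
      by (rule abelian_groupI) (auto simp: simps le add.assoc add.commute intro: exI[of _ "- _"])
    show "comm_monoid ?V"
      by (rule comm_monoidI) (auto simp: simps v_mult v_nonneg mult_le_one mult_ac)
  qed (auto simp: simps algebra_simps)
  have "ideal ?m ?V"
  proof (rule idealI[OF V.ring_axioms])
    show "subgroup ?m (add_monoid ?V)"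
    proof (rule V.add.subgroupI)
      fix x assume x: "x \<in> ?m"
      then have "\<ominus>\<^bsub>?V\<^esub> x = - x"
        by (intro V.minus_equality) (auto simp: simps valuation_ideal_def)
      then show "\<ominus>\<^bsub>?V\<^esub> x \<in> ?m" using x by (simp add: valuation_ideal_def)
    next
      show "?m \<noteq> {}" using v_0 by (auto simp: valuation_ideal_def intro!: exI[of _ 0])
    qed (auto simp: simps valuation_ideal_def lt)
  next
    fix a x assume "a \<in> ?m" "x \<in> carrier ?V"
    then have "v x * v a < 1"
      using v_nonneg[of a] mult_left_le_one_le[of "v a" "v x"] v_nonneg[of x]
      by (simp add: simps valuation_ideal_def)
    then show "x \<otimes>\<^bsub>?V\<^esub> a \<in> ?m" "a \<otimes>\<^bsub>?V\<^esub> x \<in> ?m"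
      by (simp_all add: simps valuation_ideal_def v_mult mult.commute)
  qed
  then interpret m: ideal ?m ?V .
  interpret k: ring_hom_ring ?V "?V Quot ?m" "(+>\<^bsub>?V\<^esub>) ?m"
    by (rule m.rcos_ring_hom_ring)
  have in_V: "v (of_nat n) \<le> 1" for n
    by (induction n) (auto intro: le)
  have "add_pow (?V Quot ?m) n \<one>\<^bsub>?V Quot ?m\<^esub> = ?m +>\<^bsub>?V\<^esub> of_nat n" for n
  proof (induction n)
    case 0
    then show ?case using k.hom_zero by (simp add: simps)
  next
    case (Suc n)
    have "?m +>\<^bsub>?V\<^esub> of_nat (Suc n) = (?m +>\<^bsub>?V\<^esub> of_nat n) \<oplus>\<^bsub>?V Quot ?m\<^esub> (?m +>\<^bsub>?V\<^esub> 1)"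
      using k.hom_add[of "of_nat n" 1] in_V[of n] by (simp add: simps add.commute)
    moreover have "?m +>\<^bsub>?V\<^esub> 1 = \<one>\<^bsub>?V Quot ?m\<^esub>"
      using k.hom_one by (simp add: simps)
    ultimately show ?case by (simp add: Suc)
  qed
  then have "?m +>\<^bsub>?V\<^esub> of_nat p = \<zero>\<^bsub>?V Quot ?m\<^esub>"
    using perfect by (simp add: perfect_of_char_def residue_ring_of_def)
  also have "\<zero>\<^bsub>?V Quot ?m\<^esub> = ?m"
    unfolding FactRing_def by (rule ring.select_convs)
  finally have "of_nat p \<in> ?m"
    using m.rcos_const_imp_mem in_V[of p] by (simp add: simps)
  then show ?thesis by (simp add: valuation_ideal_def)
qed

lemma v_p_pos: "0 < v (of_nat p)"
proof -
  have "p \<noteq> 0" using perfect by (auto simp: perfect_of_char_def prime_gt_0_nat)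
  then show ?thesis using v_nonneg[of "of_nat p"] v_eq_0[of "of_nat p"] by simp
qed

text \<open>The geometric series converges \<open>p\<close>-adically.\<close>

lemma one_minus_p_unit:
  assumes y: "y \<in> A"
  shows "\<exists>z. (1 - of_nat p * y) * z = 1"
proof -
  have complete: "(\<forall>n. a n \<in> A \<and> (\<exists>b\<in>A. a (Suc n) - a n = b * of_nat p ^ n)) \<Longrightarrow>
      \<exists>!l. l \<in> A \<and> (\<forall>n. \<exists>b\<in>A. a n - l = b * of_nat p ^ n)" for a
    using smooth unfolding smooth_formal_algebra_def mem_cgenideal_subring_of by blast
  define a where "a n = (\<Sum>k<n. (of_nat p * y) ^ k)" for n
  have pA: "of_nat p \<in> A" using \<kappa>_in_A[of "of_nat p"] v_p by (simp add: \<kappa>_of_nat)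
  have aA: "a n \<in> A" for n
    unfolding a_def by (intro A_sum A_power A_mult pA y)
  have "a (Suc n) - a n = y ^ n * of_nat p ^ n" for n
    by (simp add: a_def power_mult_distrib mult.commute)
  then obtain z where z: "z \<in> A" "\<And>n. \<exists>b\<in>A. a n - z = b * of_nat p ^ n"
    using complete[of a] aA A_power[OF y] by blast
  \<comment> \<open>The failure of \<open>z\<close> to be the inverse. It is divisible in
    \<open>A\<close> by every power of \<open>p\<close>, and uniqueness of limits, applied to the
    zero sequence, forces it to vanish.\<close>
  define d where "d = (1 - of_nat p * y) * z - 1"
  have "\<exists>b\<in>A. 0 - d = b * of_nat p ^ n" for n
  proof -
    obtain b where b: "b \<in> A" "a n - z = b * of_nat p ^ n" using z(2) by blast
    have "z = a n - b * of_nat p ^ n" using b(2) by (simp add: algebra_simps)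
    then have "d = (1 - of_nat p * y) * a n - 1 - (1 - of_nat p * y) * b * of_nat p ^ n"
      unfolding d_def by (simp add: right_diff_distrib mult.assoc)
    also have "(1 - of_nat p * y) * a n = 1 - (of_nat p * y) ^ n"
      unfolding a_def by (rule one_diff_power_eq[symmetric])
    finally have "0 - d = (y ^ n + (1 - of_nat p * y) * b) * of_nat p ^ n"
      by (simp add: power_mult_distrib algebra_simps)
    moreover have "y ^ n + (1 - of_nat p * y) * b \<in> A"
      by (intro A_add A_power A_mult A_diff A_1 pA y b)
    ultimately show ?thesis by blast
  qed
  moreover have "d \<in> A"
    unfolding d_def by (intro A_diff A_mult A_1 pA y z)
  moreover have "\<exists>!l. l \<in> A \<and> (\<forall>n. \<exists>b\<in>A. 0 - l = b * of_nat p ^ n)"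
    by (rule complete, intro allI conjI A_0 bexI[OF _ A_0]) simp
  moreover have "(0 :: 'b) \<in> A \<and> (\<forall>n. \<exists>b\<in>A. 0 - 0 = b * of_nat p ^ n)"
    by (intro allI conjI A_0 bexI[OF _ A_0]) simp
  ultimately have "d = 0" by blast
  then show ?thesis by (auto simp: d_def)
qed

text \<open>The elements that agree at the point with a multiple of \<open>a\<close> form an ideal
  containing the maximal ideal and also \<open>a\<close>; by maximality it contains 1.\<close>

lemma affinoid_point_inverse:
  assumes w: "affinoid_point v \<kappa> w" and a: "w a \<noteq> 0"
  shows "\<exists>t. w (a * t - 1) = 0"
proof -
  interpret multiplicative_seminorm v \<kappa> w
    by (rule affinoid_point_seminorm[OF valued_algebra_axioms w])
  let ?R = "ring_of_type_algebra :: 'b ring" and ?I = "{f. w f = 0}"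
  interpret R: cring ?R by (rule cring_from_type_algebra)
  interpret m: maximalideal ?I ?R
    using w by (simp add: affinoid_point_def)
  define J where "J = {x. \<exists>t. w (a * t - x) = 0}"
  have null_add: "w (f + g) = 0" if "w f = 0" "w g = 0" for f g
    using w_add[of f g] w_nonneg[of "f + g"] that by simp
  have J_add: "x + y \<in> J" if xy: "x \<in> J" "y \<in> J" for x y
  proof -
    obtain t u where "w (a * t - x) = 0" "w (a * u - y) = 0" using xy by (auto simp: J_def)
    then have "w ((a * t - x) + (a * u - y)) = 0" by (rule null_add)
    then have "w (a * (t + u) - (x + y)) = 0" by (simp add: algebra_simps)
    then show ?thesis by (auto simp: J_def)
  qed
  have J_mult: "y * x \<in> J" if x: "x \<in> J" for x y
  proof -
    obtain t where "w (a * t - x) = 0" using x by (auto simp: J_def)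
    then have "w (y * (a * t - x)) = 0" by (simp add: w_mult)
    then have "w (a * (y * t) - y * x) = 0" by (simp add: algebra_simps)
    then show ?thesis by (auto simp: J_def)
  qed
  have "ideal J ?R"
  proof (rule idealI[OF R.ring_axioms])
    show "subgroup J (add_monoid ?R)"
    proof (rule R.add.subgroupI)
      fix x assume x: "x \<in> J"
      have "\<ominus>\<^bsub>?R\<^esub> x = - x" by (rule R.minus_equality) auto
      then show "\<ominus>\<^bsub>?R\<^esub> x \<in> J" using J_mult[OF x, of "- 1"] by simp
    next
      have "0 \<in> J" by (auto simp: J_def intro: exI[of _ 0])
      then show "J \<noteq> {}" by blast
    qed (auto intro: J_add)
  qed (use J_mult in \<open>auto simp: mult.commute\<close>)
  moreover have "?I \<subseteq> J" by (auto simp: J_def w_minus intro!: exI[of _ 0])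
  ultimately have "J = ?I \<or> J = carrier ?R" by (intro m.I_maximal) auto
  moreover have "a \<in> J" by (auto simp: J_def intro: exI[of _ 1])
  ultimately have "1 \<in> J" using a by auto
  then show ?thesis by (simp add: J_def)
qed

text \<open>If \<open>w a > 1\<close>, a high power of the inverse \<open>t\<close> of \<open>a\<close> at the point has small coordinates,
  hence is represented there by some \<open>p y\<close> with \<open>y \<in> A\<close>; then the unit \<open>1 - p a\<^sup>n y\<close> of \<open>A\<close> vanishes
  at the point.\<close>

lemma affinoid_point_le_1:
  assumes w: "affinoid_point v \<kappa> w" and a: "a \<in> A"
  shows "w a \<le> 1"
proof (rule ccontr)
  assume "\<not> w a \<le> 1"
  then have wa: "1 < w a" by simp
  interpret multiplicative_seminorm v \<kappa> w
    by (rule affinoid_point_seminorm[OF valued_algebra_axioms w])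
  obtain t where t: "w (a * t - 1) = 0"
    using affinoid_point_inverse[OF w, of a] wa by auto
  have "w a * w t = 1" using w_eq_of_null_diff[OF t] by (simp add: w_mult)
  then have wt: "w t = 1 / w a" using wa by (simp add: field_simps)
  then have wt1: "w t < 1" using wa by simp
  obtain E where E: "finite E" "\<And>f. \<exists>c. w (f - combination c E) = 0"
    using w unfolding affinoid_point_def combination_def by blast
  obtain C where C: "bounded_coords C E" using bounded_coords_exists[OF E(1)] by blast
  \<comment> \<open>Each spanning element is a scalar times an element of \<open>A\<close>. As
    \<open>G\<close> bounds these scalars, sufficiently small coordinates yield coefficients
    divisible by \<open>p\<close> in the valuation ring.\<close>
  have "\<forall>e. \<exists>c. \<exists>b\<in>A. e = \<kappa> c * b" using generic by (simp add: is_generic_fibre_def)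
  then obtain g b where gb: "\<And>e. b e \<in> A" "\<And>e. e = \<kappa> (g e) * b e" by metis
  define G where "G = (\<Sum>e\<in>E. v (g e))"
  have gG: "v (g e) \<le> G" if "e \<in> E" for e
    unfolding G_def using E(1) that v_nonneg by (intro member_le_sum) auto
  have "(\<lambda>n. C * w t ^ n * G) \<longlonglongrightarrow> C * 0 * G"
    using wt1 w_nonneg by (intro tendsto_intros LIMSEQ_realpow_zero)
  then have "(\<lambda>n. C * w t ^ n * G) \<longlonglongrightarrow> 0" by simp
  then have "eventually (\<lambda>n. C * w t ^ n * G < v (of_nat p)) sequentially"
    using v_p_pos by (rule order_tendstoD)
  then obtain n where n: "C * w t ^ n * G < v (of_nat p)"
    by (auto simp: eventually_sequentially)
  obtain d where d: "w (t ^ n - combination d E) = 0" "\<And>e. e \<in> E \<Longrightarrow> v (d e) \<le> C * w (t ^ n)"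
    using C E(2)[of "t ^ n"] unfolding bounded_coords_def by blast
  define y where "y = (\<Sum>e\<in>E. \<kappa> (d e * g e / of_nat p) * b e)"
  have "y \<in> A"
    unfolding y_def
  proof (intro A_sum A_mult \<kappa>_in_A gb)
    fix e assume e: "e \<in> E"
    have "v (d e * g e) \<le> (C * w t ^ n) * G"
      unfolding v_mult using d(2)[OF e] gG[OF e] C
      by (intro mult_mono) (auto simp: w_power v_nonneg bounded_coords_def w_nonneg)
    then show "v (d e * g e / of_nat p) \<le> 1"
      using n v_p_pos by (simp add: v_divide field_simps)
  qed
  have "combination d E = of_nat p * y"
  proof -
    have "\<kappa> (d e) * e = of_nat p * (\<kappa> (d e * g e / of_nat p) * b e)" for e
    proof -
      have "of_nat p * \<kappa> (d e * g e / of_nat p) = \<kappa> (d e * g e)"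
        using v_p_pos v_eq_0[of "of_nat p"] by (simp flip: \<kappa>_of_nat \<kappa>_mult)
      then have "of_nat p * (\<kappa> (d e * g e / of_nat p) * b e) = \<kappa> (d e) * (\<kappa> (g e) * b e)"
        by (simp add: \<kappa>_mult flip: mult.assoc)
      then show ?thesis using gb(2)[of e] by simp
    qed
    then show ?thesis by (simp add: combination_def y_def sum_distrib_left)
  qed
  then have ty: "w (t ^ n - of_nat p * y) = 0" using d(1) by simp
  have "w (a ^ m * t ^ m - 1) = 0" for m
  proof (induction m)
    case (Suc m)
    have "w (a ^ Suc m * t ^ Suc m - a ^ m * t ^ m) = 0"
    proof -
      have "a ^ Suc m * t ^ Suc m - a ^ m * t ^ m = (a ^ m * t ^ m) * (a * t - 1)"
        by (simp add: algebra_simps)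
      then show ?thesis by (simp add: w_mult t)
    qed
    then show ?case using Suc w_null_diff by blast
  qed simp
  moreover have "w (of_nat p * (a ^ n * y) - a ^ n * t ^ n) = 0"
  proof -
    have "of_nat p * (a ^ n * y) - a ^ n * t ^ n = - (a ^ n * (t ^ n - of_nat p * y))"
      by (simp add: algebra_simps)
    then show ?thesis by (simp add: w_minus w_mult ty)
  qed
  ultimately have "w (of_nat p * (a ^ n * y) - 1) = 0" using w_null_diff by blast
  then have null: "w (1 - of_nat p * (a ^ n * y)) = 0" by (simp add: w_diff_commute)
  obtain z where "(1 - of_nat p * (a ^ n * y)) * z = 1"
    using one_minus_p_unit[of "a ^ n * y"] A_mult[OF A_power[OF a] \<open>y \<in> A\<close>] by blast
  then have "w (1 - of_nat p * (a ^ n * y)) * w z = 1" by (simp flip: w_mult)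
  then show False using null by simp
qed

section \<open>The supremum norm on the generic fibre\<close>

abbreviation "N \<equiv> sup_norm v \<kappa>"
abbreviation "points \<equiv> {w. affinoid_point v \<kappa> w}"

lemma N_nonneg: "0 \<le> N x"
  and N_eq_0: "N x = 0 \<longleftrightarrow> x = 0"
  and N_diff_le: "N (x - y) \<le> N x + N y"
  and N_mult: "N (x * y) \<le> N x * N y"
  using banach by (auto simp: banach_ring_norm_def)

text \<open>Without points the supremum would be the same for every element, whereas the norm
  separates 0 from 1.\<close>

lemma points_nonempty: "points \<noteq> {}"
proof
  assume "points = {}"
  then have "N 1 = N 0" unfolding sup_norm_def by (simp only: image_empty)
  then show False using N_eq_0[of 0] N_eq_0[of 1] by simp
qed

lemma point_seminorm: "w \<in> points \<Longrightarrow> multiplicative_seminorm v \<kappa> w"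
  using affinoid_point_seminorm[OF valued_algebra_axioms] by simp

lemma point_\<kappa>: "w \<in> points \<Longrightarrow> w (\<kappa> c) = v c"
  and point_\<kappa>_mult: "w \<in> points \<Longrightarrow> w (\<kappa> c * x) = v c * w x"
  using multiplicative_seminorm.w_\<kappa>[OF point_seminorm]
    multiplicative_seminorm.w_mult[OF point_seminorm] by simp_all

lemma N_\<kappa>: "N (\<kappa> c) = v c"
proof -
  have "N (\<kappa> c) = (SUP w\<in>points. v c)"
    unfolding sup_norm_def by (rule SUP_cong) (auto simp: point_\<kappa>)
  then show ?thesis using points_nonempty by simp
qed

text \<open>On an unbounded set of reals, \<open>Sup\<close> takes a fixed junk value; as unboundedness is invariant
  under scaling, submultiplicativity would force this value to be \<open>0\<close>.\<close>

lemma points_bdd_above: "bdd_above ((\<lambda>w. w x) ` points)"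
proof (rule ccontr)
  assume unbdd: "\<not> ?thesis"
  obtain \<omega> where \<omega>: "0 < v \<omega>" "v \<omega> < 1" by (rule uniformizer) blast
  have junk: "Sup S = (LEAST z. False)" if "\<not> bdd_above S" for S :: "real set"
  proof -
    have "(\<forall>s\<in>S. s \<le> z) = False" for z using that by (auto simp: bdd_above_def)
    then show ?thesis by (simp only: Sup_real_def)
  qed
  have "\<not> bdd_above ((\<lambda>w. w (\<kappa> \<omega> * x)) ` points)"
  proof
    assume "bdd_above ((\<lambda>w. w (\<kappa> \<omega> * x)) ` points)"
    then obtain B where "\<And>w. w \<in> points \<Longrightarrow> v \<omega> * w x \<le> B"
      by (auto simp: bdd_above_def point_\<kappa>_mult)
    then have "\<And>w. w \<in> points \<Longrightarrow> w x \<le> B / v \<omega>" using \<omega> by (simp add: field_simps)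
    then show False using unbdd by (auto simp: bdd_above_def)
  qed
  then have "N (\<kappa> \<omega> * x) = N x"
    unfolding sup_norm_def using junk unbdd by metis
  then have "N x \<le> v \<omega> * N x" using N_mult[of "\<kappa> \<omega>" x] by (simp add: N_\<kappa>)
  then have "(1 - v \<omega>) * N x \<le> 0" by (simp add: algebra_simps)
  then have "N x = 0" using \<omega> N_nonneg[of x] by (simp add: mult_le_0_iff)
  then have "x = 0" by (simp add: N_eq_0)
  then have "(\<lambda>w. w x) ` points \<subseteq> {0}"
    using point_\<kappa>[of _ 0] by auto
  then show False using unbdd bdd_above_mono bdd_above_finite by (metis finite.emptyI finite.insertI)
qed

lemma point_le_N: "w \<in> points \<Longrightarrow> w x \<le> N x"
  unfolding sup_norm_def by (rule cSUP_upper[OF _ points_bdd_above])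

lemma N_leI: "(\<And>w. w \<in> points \<Longrightarrow> w x \<le> r) \<Longrightarrow> N x \<le> r"
  unfolding sup_norm_def by (rule cSUP_least[OF points_nonempty])

lemma N_add: "N (x + y) \<le> max (N x) (N y)"
proof (rule N_leI)
  fix w assume w: "w \<in> points"
  show "w (x + y) \<le> max (N x) (N y)"
    using multiplicative_seminorm.w_add[OF point_seminorm[OF w], of x y]
      point_le_N[OF w, of x] point_le_N[OF w, of y] by linarith
qed

lemma N_minus: "N (- x) = N x"
proof -
  have "N (- x) \<le> N x" for x
    using N_diff_le[of 0 x] N_eq_0[of 0] by simp
  from this[of x] this[of "- x"] show ?thesis by simp
qed

lemma N_scale: "N (\<kappa> c * x) = v c * N x"
proof (rule antisym)
  have le: "N (\<kappa> c * x) \<le> v c * N x" for c x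
    using N_mult[of "\<kappa> c" x] by (simp add: N_\<kappa>)
  show "N (\<kappa> c * x) \<le> v c * N x" by (rule le)
  show "v c * N x \<le> N (\<kappa> c * x)"
  proof (cases "c = 0")
    case False
    then have "\<kappa> (1 / c) * (\<kappa> c * x) = x"
      by (simp flip: mult.assoc \<kappa>_mult)
    then have "N x \<le> v (1 / c) * N (\<kappa> c * x)" using le[of "1 / c" "\<kappa> c * x"] by simp
    then show ?thesis
      using False v_nonneg[of c] v_eq_0[of c] by (simp add: v_divide field_simps)
  qed (simp add: N_nonneg)
qed

lemma N_le_1: "a \<in> A \<Longrightarrow> N a \<le> 1"
  by (rule N_leI) (simp add: affinoid_point_le_1)

lemma banach_algebra_N:
  assumes "0 < v \<omega>" "v \<omega> < 1"
  shows "banach_algebra v \<kappa> N \<omega>"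
proof
  show "\<exists>l. (\<lambda>n. N (u n - l)) \<longlonglongrightarrow> 0"
    if "\<And>e. 0 < e \<Longrightarrow> \<exists>n0. \<forall>m\<ge>n0. \<forall>n\<ge>n0. N (u m - u n) < e" for u
    using banach by (intro mcomplete_normD[OF _ N_nonneg N_eq_0 N_diff_le that])
      (auto simp: banach_ring_norm_def)
  show "N 1 = 1" using N_\<kappa>[of 1] by simp
qed (use assms in \<open>auto simp: v_nonneg v_eq_0 v_mult \<kappa>_mult N_nonneg N_eq_0 N_minus N_add N_mult N_scale\<close>)

section \<open>From ideal membership in the special fibre to homomorphisms of tubes\<close>

lemma special_ideal_ideal: "ideal (special_ideal v \<kappa> A) (subring_of A)"
  unfolding special_ideal_def
  by (rule ring.genideal_ideal[OF cring.axioms(1)[OF cring_A]])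
     (auto simp: valuation_ideal_def intro!: \<kappa>_in_A)

text \<open>As \<open>A\<close> has norm at most 1, its elements of norm at most
  \<open>v \<omega>\<close> form an ideal, and the choice of \<open>\<omega>\<close> places all
  generators of the special ideal in it.\<close>

lemma special_ideal_small:
  assumes "r \<in> special_ideal v \<kappa> A" and \<omega>: "\<And>c. v c < 1 \<Longrightarrow> v c \<le> v \<omega>"
  shows "N r \<le> v \<omega>"
proof -
  let ?J = "{a \<in> A. N a \<le> v \<omega>}"
  have "ideal ?J (subring_of A)"
  proof (rule ideal_AI)
    fix x a assume x: "x \<in> ?J" and a: "a \<in> A"
    have "N (a * x) \<le> N a * N x" by (rule N_mult)
    also have "\<dots> \<le> 1 * v \<omega>"
      using x N_le_1[OF a] by (intro mult_mono) (auto simp: N_nonneg v_nonneg)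
    finally show "a * x \<in> ?J" using A_mult[OF a] x by simp
  next
    fix x y assume "x \<in> ?J" "y \<in> ?J"
    then show "x + y \<in> ?J" using N_add[of x y] A_add by auto
  next
    show "0 \<in> ?J" using N_eq_0[of 0] v_nonneg A_0 by simp
  qed auto
  moreover have "\<kappa> ` valuation_ideal v \<subseteq> ?J"
    using \<omega> by (auto simp: valuation_ideal_def N_\<kappa> intro!: \<kappa>_in_A)
  ultimately have "special_ideal v \<kappa> A \<subseteq> ?J"
    unfolding special_ideal_def by (rule ring.genideal_minimal[OF cring.axioms(1)[OF cring_A]])
  then show ?thesis using assms(1) by blast
qed

text \<open>\<open>W\<close> is the ideal of \<open>A\<close> generated by the lifts
  \<open>lgs\<close> together with the special ideal. Its image in the special fibre is an ideal
  containing \<open>gs\<close>, hence also \<open>fs\<close>; and since \<open>W\<close> contains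
  the special ideal, membership of a class in the image gives membership of each of its lifts in
  \<open>W\<close>.\<close>

lemma lifts_combination:
  assumes lfs: "are_lifts v \<kappa> A fs lfs" and lgs: "are_lifts v \<kappa> A gs lgs"
    and gs: "set gs \<subseteq> carrier (special_fibre v \<kappa> A)"
    and fs: "set fs \<subseteq> Idl\<^bsub>special_fibre v \<kappa> A\<^esub> (set gs)"
    and i: "i < length lfs"
  shows "\<exists>a r. (\<forall>j. a j \<in> A) \<and> r \<in> special_ideal v \<kappa> A \<and>
     lfs ! i = (\<Sum>j<length lgs. a j * lgs ! j) + r"
proof -
  let ?R = "subring_of A" and ?I = "special_ideal v \<kappa> A"
  interpret R: cring ?R by (rule cring_A)
  interpret I: ideal ?I ?R by (rule special_ideal_ideal)
  interpret k: ring "special_fibre v \<kappa> A"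
    unfolding special_fibre_def by (rule I.quotient_is_ring)
  have I_sub: "?I \<subseteq> A" using I.a_subset by simp
  have I0: "0 \<in> ?I" using additive_subgroup.zero_closed[OF I.is_additive_subgroup] by simp
  have Iadd: "x + y \<in> ?I" if "x \<in> ?I" "y \<in> ?I" for x y
    using additive_subgroup.a_closed[OF I.is_additive_subgroup that] by simp
  have Imult: "a * x \<in> ?I" if "x \<in> ?I" "a \<in> A" for x a
    using I.I_l_closed[of x a] that by simp
  have lg: "lgs ! j \<in> A" "gs ! j = ?I +>\<^bsub>?R\<^esub> lgs ! j" if "j < length lgs" for j
    using lgs that by (auto simp: are_lifts_def list_all2_conv_all_nth)
  have len: "length gs = length lgs" "length fs = length lfs"
    using lgs lfs by (auto simp: are_lifts_def dest: list_all2_lengthD)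
  define W where "W = {x. \<exists>a r. (\<forall>j. a j \<in> A) \<and> r \<in> ?I \<and> x = (\<Sum>j<length lgs. a j * lgs ! j) + r}"
  have W: "ideal W ?R"
  proof (rule ideal_AI)
    show "W \<subseteq> A"
      using I_sub lg(1) by (auto simp: W_def intro!: A_add A_sum A_mult)
    show "0 \<in> W"
      unfolding W_def using I0 A_0 by (auto intro!: exI[of _ "\<lambda>_. 0"] exI[of _ 0])
    fix x assume "x \<in> W"
    then obtain a r where x: "\<And>j. a j \<in> A" "r \<in> ?I" "x = (\<Sum>j<length lgs. a j * lgs ! j) + r"
      by (auto simp: W_def)
    show "x + y \<in> W" if yW: "y \<in> W" for y
    proof -
      obtain b s where y: "\<And>j. b j \<in> A" "s \<in> ?I" "y = (\<Sum>j<length lgs. b j * lgs ! j) + s"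
        using yW by (auto simp: W_def)
      have "x + y = (\<Sum>j<length lgs. (a j + b j) * lgs ! j) + (r + s)"
        by (simp add: x y sum.distrib algebra_simps)
      then show ?thesis
        unfolding W_def using A_add[OF x(1) y(1)] Iadd[OF x(2) y(2)]
        by (intro CollectI exI[of _ "\<lambda>j. a j + b j"] exI[of _ "r + s"]) auto
    qed
    show "b * x \<in> W" if "b \<in> A" for b
    proof -
      have "b * x = (\<Sum>j<length lgs. (b * a j) * lgs ! j) + b * r"
        by (simp add: x sum_distrib_left algebra_simps)
      then show ?thesis
        unfolding W_def using A_mult[OF that x(1)] Imult[OF x(2) that]
        by (intro CollectI exI[of _ "\<lambda>j. b * a j"] exI[of _ "b * r"]) auto
    qed
  qed
  have IW: "?I \<subseteq> W"
  proof
    fix r assume r: "r \<in> ?I"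
    have "r = (\<Sum>j<length lgs. 0 * lgs ! j) + r" by simp
    then show "r \<in> W"
      unfolding W_def using r A_0 by (intro CollectI exI[of _ "\<lambda>_. 0"] exI[of _ r]) auto
  qed
  have "ideal ((+>\<^bsub>?R\<^esub>) ?I ` W) (special_fibre v \<kappa> A)"
    unfolding special_fibre_def by (rule R.ring_ideal_imp_quot_ideal[OF special_ideal_ideal W])
  moreover have "set gs \<subseteq> (+>\<^bsub>?R\<^esub>) ?I ` W"
  proof
    fix g assume "g \<in> set gs"
    then obtain j where j: "j < length lgs" "g = ?I +>\<^bsub>?R\<^esub> lgs ! j"
      using len lg(2) by (metis in_set_conv_nth)
    have "lgs ! j = (\<Sum>i<length lgs. (if i = j then 1 else 0) * lgs ! i) + 0"
      using j(1) by (simp add: if_distrib[of "\<lambda>x. x * _"] cong: if_cong)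
    then have "lgs ! j \<in> W"
      unfolding W_def using I0 A_0 A_1 by (intro CollectI exI[of _ "\<lambda>i. if i = j then 1 else 0"] exI[of _ 0]) auto
    then show "g \<in> (+>\<^bsub>?R\<^esub>) ?I ` W" using j(2) by blast
  qed
  ultimately have "Idl\<^bsub>special_fibre v \<kappa> A\<^esub> (set gs) \<subseteq> (+>\<^bsub>?R\<^esub>) ?I ` W"
    by (rule k.genideal_minimal)
  moreover have "fs ! i \<in> set fs" using i len by simp
  moreover have lf: "lfs ! i \<in> A" "fs ! i = ?I +>\<^bsub>?R\<^esub> lfs ! i"
    using lfs i by (auto simp: are_lifts_def list_all2_conv_all_nth)
  ultimately obtain x where x: "x \<in> W" "?I +>\<^bsub>?R\<^esub> lfs ! i = ?I +>\<^bsub>?R\<^esub> x"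
    using fs by auto
  have xA: "x \<in> carrier ?R" using x(1) ideal.Icarr[OF W] by blast
  have lfA: "lfs ! i \<in> carrier ?R" using lf by simp
  have "lfs ! i \<in> ?I +>\<^bsub>?R\<^esub> x"
    using I.a_rcos_self[OF lfA] x(2) by simp
  then obtain r where "r \<in> ?I" "lfs ! i = r + x"
    by (auto simp: a_r_coset_def r_coset_def)
  then have "lfs ! i \<in> W"
    using additive_subgroup.a_closed[OF ideal.axioms(1)[OF W], of r x] IW x(1) by auto
  then show ?thesis by (simp add: W_def)
qed

text \<open>One inclusion of ideals yields a homomorphism in one direction, so that equal ideals
  give both directions by exchanging the roles of the two sequences.\<close>

lemma tube_hom_lifts:
  assumes \<omega>: "0 < v \<omega>" "v \<omega> < 1" "\<And>c. v c < 1 \<Longrightarrow> v c \<le> v \<omega>"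
    and lifts: "are_lifts v \<kappa> A fs lfs" "are_lifts v \<kappa> A gs lgs"
    and gs: "set gs \<subseteq> carrier (special_fibre v \<kappa> A)"
    and fs: "set fs \<subseteq> Idl\<^bsub>special_fibre v \<kappa> A\<^esub> (set gs)"
  shows "\<exists>h. banach_algebra.tube_hom v \<kappa> N lfs lgs h"
proof -
  interpret banach_algebra v \<kappa> N \<omega> by (rule banach_algebra_N[OF \<omega>(1,2)])
  define P where "P i a r \<longleftrightarrow> (\<forall>j. a j \<in> A) \<and> r \<in> special_ideal v \<kappa> A \<and>
     lfs ! i = (\<Sum>j<length lgs. a j * lgs ! j) + r" for i a r
  have "\<forall>i. \<exists>a r. i < length lfs \<longrightarrow> P i a r"
    using lifts_combination[OF lifts gs fs] unfolding P_def by blast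
  then obtain a r where P: "\<And>i. i < length lfs \<Longrightarrow> P i (a i) (r i)" by metis
  show ?thesis
  proof (rule tube_hom_exists)
    fix i assume "i < length lfs"
    from P[OF this] show "lfs ! i = (\<Sum>j<length lgs. a i j * lgs ! j) + r i" "N (r i) \<le> v \<omega>"
      using special_ideal_small[OF _ \<omega>(3)] by (auto simp: P_def)
  next
    fix i j assume "i < length lfs" "j < length lgs"
    then show "N (a i j) \<le> 1" using P[of i] N_le_1 by (simp add: P_def)
  qed
qed

end

theorem proposition8p17:
  fixes v :: "'k::field_char_0 \<Rightarrow> real"
    and p :: nat
    and \<kappa> :: "'k \<Rightarrow> 'b::comm_ring_1"
    and A :: "'b set"
    and X_ideal :: "'b set set"
    and fs gs :: "'b set list"
    and lfs lgs :: "'b list"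
  assumes "complete_discretely_valued v"
    and "perfect_of_char (residue_ring_of v) p"
    and "smooth_formal_algebra v p \<kappa> A"
    and "is_generic_fibre \<kappa> A"
    and "connected_spectrum (special_fibre v \<kappa> A)"
    and "smooth_ring_hom (residue_ring_of v) (special_fibre v \<kappa> A)
           (residue_map \<kappa> (subring_of A) (special_ideal v \<kappa> A))"
    and "banach_ring_norm (sup_norm v \<kappa>)"
    and "ideal X_ideal (special_fibre v \<kappa> A)"
    and "regular_sequence (special_fibre v \<kappa> A) fs"
    and "Idl\<^bsub>special_fibre v \<kappa> A\<^esub> set fs = X_ideal"
    and "regular_sequence (special_fibre v \<kappa> A) gs"
    and "Idl\<^bsub>special_fibre v \<kappa> A\<^esub> set gs = X_ideal"
    and "are_lifts v \<kappa> A fs lfs"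
    and "are_lifts v \<kappa> A gs lgs"
  shows "\<exists>h. born_alg_iso
               (tube_ring v \<kappa> lfs) (tube_bornology v \<kappa> lfs) (tube_scalar v \<kappa> lfs)
               (tube_ring v \<kappa> lgs) (tube_bornology v \<kappa> lgs) (tube_scalar v \<kappa> lgs) h \<and>
             (\<forall>h'. born_alg_hom
                     (tube_ring v \<kappa> lfs) (tube_bornology v \<kappa> lfs) (tube_scalar v \<kappa> lfs)
                     (tube_ring v \<kappa> lgs) (tube_bornology v \<kappa> lgs) (tube_scalar v \<kappa> lgs) h' \<longrightarrow>
                   (\<forall>x \<in> carrier (tube_ring v \<kappa> lfs). h' x = h x))"
proof -
  interpret formal_model v \<kappa> p A
    using assms by unfold_locales (auto simp: is_generic_fibre_def)
  obtain \<omega> where \<omega>: "0 < v \<omega>" "v \<omega> < 1" "\<And>c. v c < 1 \<Longrightarrow> v c \<le> v \<omega>"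
    by (rule uniformizer) blast
  interpret B: banach_algebra v \<kappa> N \<omega> by (rule banach_algebra_N[OF \<omega>(1,2)])
  \<comment> \<open>The same closure in two guises: formed in \<open>temp_ring\<close> on the left,
    and on the type of power series on the right.\<close>
  have ideal: "tube_ideal v \<kappa> hs = mcoeff ` B.kernel hs" for hs
    unfolding tube_ideal_def Let_def by (rule B.kernel_eq)
  have tube: "tube_ring v \<kappa> hs = B.tube hs" "tube_bornology v \<kappa> hs = B.tube_bounded hs"
    "tube_scalar v \<kappa> hs = (\<lambda>b. B.tube_class hs (mconst b))" for hs
    by (simp_all add: tube_ring_def tube_bornology_def tube_scalar_def ideal B.tube_def
        B.tube_bounded_def B.tube_class_def temp_const_eq fun_eq_iff)
  interpret k: ring "special_fibre v \<kappa> A"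
    unfolding special_fibre_def by (rule ideal.quotient_is_ring[OF special_ideal_ideal])
  have carr: "set fs \<subseteq> carrier (special_fibre v \<kappa> A)" "set gs \<subseteq> carrier (special_fibre v \<kappa> A)"
    using assms(9,11) by (auto simp: regular_sequence_def)
  have same: "Idl\<^bsub>special_fibre v \<kappa> A\<^esub> (set fs) = Idl\<^bsub>special_fibre v \<kappa> A\<^esub> (set gs)"
    using assms(10,12) by simp
  obtain h where h: "B.tube_hom lfs lgs h"
    using tube_hom_lifts[OF \<omega> assms(13,14) carr(2)] k.genideal_self[OF carr(1)] same by auto
  obtain h' where h': "B.tube_hom lgs lfs h'"
    using tube_hom_lifts[OF \<omega> assms(14,13) carr(1)] k.genideal_self[OF carr(2)] same by auto
  show ?thesis
    unfolding tube
    using B.born_alg_iso_tubes[OF h h'] B.tube_hom_unique[OF _ h] by blast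
qed

end
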